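(* Let $k$ be an algebraically closed field of characteristic zero, let $n\ge 2$, $R=k[x_1,\ldots,x_n]$, and let $f\in R$ be a reduced polynomial such that the hypersurface $X=V(f)\subseteq\mathbb{A}_k^n$ has isolated singularities. Let $J(f)=(\partial f/\partial x_1,\ldots,\partial f/\partial x_n)$ and $I(f)=(f,\partial f/\partial x_1,\ldots,\partial f/\partial x_n)$. The following are equivalent: (a) $X$ is locally Eulerian, i.e. $f\in J(f)_{\mathfrak m}$ for every maximal ideal $\mathfrak m$ of $R$ corresponding to a singular point of $X$. (b) The Jacobian ideal $I(f)$ is locally a complete intersection at the singular points, i.e. for every maximal ideal $\mathfrak m$ of $R$ corresponding to a singular point of $X$, the ideal $I(f)_{\mathfrak m}\subset R_{\mathfrak m}$ is generated by a regular sequence. (c) $X$ is of Jacobian linear type, i.e. the ideal $I(f)$ of $R$ is of linear type.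
   Context: $X=V(f)$ has isolated singularities if its singular locus $V(I(f))$ consists of finitely many points. An ideal $I$ of a commutative ring $A$ is of linear type if its symmetric algebra and its Rees algebra are isomorphic, i.e. the canonical surjection $\mathrm{Sym}_A(I)\to\mathcal{R}_A(I)=\bigoplus_{t\ge0}I^t$ is an isomorphism. *)

theory Defs
  imports
    "HOL-Algebra.Algebra"
    "HOL-Algebra.Algebraic_Closure_Type"
    "HOL-Library.Cardinality"
    "HOL-Library.Poly_Mapping"
    "HOL-Computational_Algebra.Computational_Algebra"
begin

section \<open>Multivariate polynomials\<close>

text \<open>Finitely supported functions from exponent vectors to coefficients, multiplied by
  convolution: \<open>('v, 'a) mpoly\<close> is \<open>'a[x\<^sub>v | v :: 'v]\<close>.\<close>

type_synonym ('v, 'a) mpoly = "('v \<Rightarrow>\<^sub>0 nat) \<Rightarrow>\<^sub>0 'a"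

abbreviation mconst :: "'a::zero \<Rightarrow> ('v, 'a) mpoly" where
  "mconst c \<equiv> Poly_Mapping.single 0 c"

abbreviation mvar :: "'v \<Rightarrow> ('v, 'a::zero_neq_one) mpoly" where
  "mvar v \<equiv> Poly_Mapping.single (Poly_Mapping.single v 1) 1"

text \<open>Substitution \<open>x\<^sub>v := a v\<close>, with coefficients transported along \<open>h\<close>.\<close>

definition mpoly_subst ::
  "('a::zero \<Rightarrow> 'b::comm_semiring_1) \<Rightarrow> ('v \<Rightarrow> 'b) \<Rightarrow> ('v, 'a) mpoly \<Rightarrow> 'b" where
  "mpoly_subst h a p =
    (\<Sum>m \<in> Poly_Mapping.keys p. h (Poly_Mapping.lookup p m) * (\<Prod>v \<in> Poly_Mapping.keys m. a v ^ Poly_Mapping.lookup m v))"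

definition mpoly_pderiv ::
  "'v \<Rightarrow> ('v, 'a::comm_semiring_1) mpoly \<Rightarrow> ('v, 'a) mpoly" where
  "mpoly_pderiv v p =
    (\<Sum>m \<in> Poly_Mapping.keys p.
      Poly_Mapping.single (m - Poly_Mapping.single v 1) (of_nat (Poly_Mapping.lookup m v) * Poly_Mapping.lookup p m))"

section \<open>Localisation\<close>

text \<open>Fractions are classes of pairs (numerator, denominator); no assumption that \<open>R\<close> is a
  domain is made, whence the extra factor \<open>u\<close>.\<close>

definition frac_rel :: "('a, 'm) ring_scheme \<Rightarrow> 'a set \<Rightarrow> (('a \<times> 'a) \<times> ('a \<times> 'a)) set" where
  "frac_rel R S = {((a, s), (b, t)). a \<in> carrier R \<and> s \<in> S \<and> b \<in> carrier R \<and> t \<in> S \<and>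
     (\<exists>u\<in>S. u \<otimes>\<^bsub>R\<^esub> (t \<otimes>\<^bsub>R\<^esub> a) = u \<otimes>\<^bsub>R\<^esub> (s \<otimes>\<^bsub>R\<^esub> b))}"

definition fraction :: "('a, 'm) ring_scheme \<Rightarrow> 'a set \<Rightarrow> 'a \<Rightarrow> 'a \<Rightarrow> ('a \<times> 'a) set" where
  "fraction R S a s = frac_rel R S `` {(a, s)}"

definition localization :: "('a, 'm) ring_scheme \<Rightarrow> 'a set \<Rightarrow> ('a \<times> 'a) set ring" where
  "localization R S = \<lparr>
     carrier = (carrier R \<times> S) // frac_rel R S,
     monoid.mult = (\<lambda>P Q. \<Union>(a, s)\<in>P. \<Union>(b, t)\<in>Q. fraction R S (a \<otimes>\<^bsub>R\<^esub> b) (s \<otimes>\<^bsub>R\<^esub> t)),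
     one = fraction R S \<one>\<^bsub>R\<^esub> \<one>\<^bsub>R\<^esub>,
     ring.zero = fraction R S \<zero>\<^bsub>R\<^esub> \<one>\<^bsub>R\<^esub>,
     add = (\<lambda>P Q. \<Union>(a, s)\<in>P. \<Union>(b, t)\<in>Q.
              fraction R S (a \<otimes>\<^bsub>R\<^esub> t \<oplus>\<^bsub>R\<^esub> b \<otimes>\<^bsub>R\<^esub> s) (s \<otimes>\<^bsub>R\<^esub> t)) \<rparr>"

abbreviation local_ring_at :: "('a, 'm) ring_scheme \<Rightarrow> 'a set \<Rightarrow> ('a \<times> 'a) set ring" where
  "local_ring_at R M \<equiv> localization R (carrier R - M)"

definition ideal_at :: "('a, 'm) ring_scheme \<Rightarrow> 'a set \<Rightarrow> 'a set \<Rightarrow> ('a \<times> 'a) set set" where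
  "ideal_at R I M = {fraction R (carrier R - M) a s | a s. a \<in> I \<and> s \<in> carrier R - M}"

section \<open>Regular sequences\<close>

definition regular_sequence :: "('a, 'm) ring_scheme \<Rightarrow> 'a list \<Rightarrow> bool" where
  "regular_sequence R xs \<longleftrightarrow>
     set xs \<subseteq> carrier R \<and>
     (\<forall>i < length xs. \<forall>y \<in> carrier R.
        xs ! i \<otimes>\<^bsub>R\<^esub> y \<in> Idl\<^bsub>R\<^esub> (set (take i xs)) \<longrightarrow> y \<in> Idl\<^bsub>R\<^esub> (set (take i xs))) \<and>
     Idl\<^bsub>R\<^esub> (set xs) \<noteq> carrier R"

section \<open>Symmetric algebra, Rees algebra, linear type\<close>

definition mpoly_ring_on :: "'v set \<Rightarrow> ('v, 'a::comm_ring_1) mpoly ring" where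
  "mpoly_ring_on V =
     ring_of_type_algebra \<lparr> carrier := {p. \<forall>m \<in> Poly_Mapping.keys p. Poly_Mapping.keys m \<subseteq> V} \<rparr>"

text \<open>\<open>Sym\<^sub>A(I)\<close> is the free commutative \<open>A\<close>-algebra on symbols \<open>T\<^sub>u\<close>, \<open>u \<in> I\<close>, modulo the
  relations making \<open>u \<mapsto> T\<^sub>u\<close> an \<open>A\<close>-linear map. The variables are indexed by all elements
  of \<open>I\<close>, not by chosen generators.\<close>

definition sym_relations :: "'a::comm_ring_1 set \<Rightarrow> ('a, 'a) mpoly set" where
  "sym_relations I =
     {mvar (u + v) - (mvar u + mvar v) | u v. u \<in> I \<and> v \<in> I} \<union>
     {mvar (c * u) - mconst c * mvar u | c u. u \<in> I}"

definition sym_algebra :: "'a::comm_ring_1 set \<Rightarrow> ('a, 'a) mpoly set ring" where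
  "sym_algebra I = mpoly_ring_on I Quot (Idl\<^bsub>mpoly_ring_on I\<^esub> (sym_relations I))"

text \<open>\<open>\<Oplus>\<^sub>t I\<^sup>t\<close>, with the degree \<open>t\<close> component stored as the coefficient of degree \<open>t\<close>.\<close>

definition rees_algebra :: "'a::comm_ring_1 set \<Rightarrow> 'a poly ring" where
  "rees_algebra I = ring_of_type_algebra
     \<lparr> carrier := {p. \<forall>t. coeff p t \<in> I [^]\<^bsub>ideals_set ring_of_type_algebra\<^esub> t} \<rparr>"

text \<open>The canonical \<open>A\<close>-algebra map, sending the class of \<open>T\<^sub>u\<close> to \<open>u\<close> in degree 1.\<close>

definition sym_to_rees :: "('a::comm_ring_1, 'a) mpoly set \<Rightarrow> 'a poly" where
  "sym_to_rees P = the_elem (mpoly_subst (\<lambda>c. [:c:]) (\<lambda>u. monom u 1) ` P)"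

definition linear_type :: "'a::comm_ring_1 set \<Rightarrow> bool" where
  "linear_type I \<longleftrightarrow> sym_to_rees \<in> ring_iso (sym_algebra I) (rees_algebra I)"

section \<open>Hypersurfaces in affine space\<close>

text \<open>A point of \<open>\<bbbA>\<^sup>n\<close> is a function \<open>'n \<Rightarrow> 'k\<close>; over an algebraically closed field these
  are the closed points, with maximal ideals \<open>point_ideal a\<close>.\<close>

definition zero_locus :: "('n, 'k::comm_ring_1) mpoly set \<Rightarrow> ('n \<Rightarrow> 'k) set" where
  "zero_locus I = {a. \<forall>g \<in> I. mpoly_subst (\<lambda>c. c) a g = 0}"

definition point_ideal :: "('n \<Rightarrow> 'k::comm_ring_1) \<Rightarrow> ('n, 'k) mpoly set" where
  "point_ideal a = {g. mpoly_subst (\<lambda>c. c) a g = 0}"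

definition gradient_ideal :: "('n::finite, 'k::comm_ring_1) mpoly \<Rightarrow> ('n, 'k) mpoly set" where
  "gradient_ideal f = Idl\<^bsub>ring_of_type_algebra\<^esub> {mpoly_pderiv i f | i. True}"

definition jacobian_ideal :: "('n::finite, 'k::comm_ring_1) mpoly \<Rightarrow> ('n, 'k) mpoly set" where
  "jacobian_ideal f = Idl\<^bsub>ring_of_type_algebra\<^esub> (insert f {mpoly_pderiv i f | i. True})"

definition singular_locus :: "('n::finite, 'k::comm_ring_1) mpoly \<Rightarrow> ('n \<Rightarrow> 'k) set" where
  "singular_locus f = zero_locus (jacobian_ideal f)"

definition isolated_singularities :: "('n::finite, 'k::comm_ring_1) mpoly \<Rightarrow> bool" where
  "isolated_singularities f \<longleftrightarrow> finite (singular_locus f)"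

definition locally_eulerian :: "('n::finite, 'k::comm_ring_1) mpoly \<Rightarrow> bool" where
  "locally_eulerian f \<longleftrightarrow>
     (\<forall>a \<in> singular_locus f.
        fraction ring_of_type_algebra (carrier ring_of_type_algebra - point_ideal a) f 1
          \<in> ideal_at ring_of_type_algebra (gradient_ideal f) (point_ideal a))"

definition jacobian_locally_ci :: "('n::finite, 'k::comm_ring_1) mpoly \<Rightarrow> bool" where
  "jacobian_locally_ci f \<longleftrightarrow>
     (\<forall>a \<in> singular_locus f.
        \<exists>xs. regular_sequence (local_ring_at ring_of_type_algebra (point_ideal a)) xs \<and>
          ideal_at ring_of_type_algebra (jacobian_ideal f) (point_ideal a) =
            Idl\<^bsub>local_ring_at ring_of_type_algebra (point_ideal a)\<^esub> (set xs))"

definition jacobian_linear_type :: "('n::finite, 'k::comm_ring_1) mpoly \<Rightarrow> bool" where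
  "jacobian_linear_type f \<longleftrightarrow> linear_type (jacobian_ideal f)"

end

theory Submission
  imports Defs
begin

text \<open>Let \<open>I\<close> be the Jacobian ideal of \<open>f\<close>, let \<open>J\<close> be generated by the partial derivatives alone, and let \<open>a\<close>
  be a singular point with maximal ideal \<open>M\<close>. The equivalence is proved as a cycle.

  Eulerian implies complete intersection. Locally \<open>I = J\<close> has \<open>n\<close> generators, and by the Nullstellensatz it
  contains powers of the \<open>n\<close> coordinates centred at the isolated point \<open>a\<close>. These powers form a regular
  sequence. An ideal of a Noetherian local ring that has \<open>n\<close> generators and contains a regular sequence of
  length \<open>n\<close> is generated by a regular sequence (\<open>generated_by_regular_sequence\<close>): generic combinations of the
  generators replace the members of the given sequence one after the other.

  Complete intersection implies linear type. Locally, a form \<open>P\<close> in the symmetric algebra with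
  value zero is reduced to zero by removing the variables belonging to the regular sequence one at a time
  (\<open>reducible_to_step\<close>). The annihilator of \<open>P\<close> in the symmetric algebra thus has no zero,
  hence contains 1 by the Nullstellensatz (\<open>linear_type_if_locally_regular\<close>).

  Linear type implies Eulerian. The \<open>n + 1\<close> polynomials \<open>f, \<partial>\<^sub>1 f, \<dots>, \<partial>\<^sub>n f\<close> in \<open>n\<close> variables are
  algebraically dependent. If they were minimal generators of \<open>I\<close> at \<open>a\<close>, linear type would make the
  fibre of the Rees algebra a polynomial ring in \<open>n + 1\<close> variables, and the lowest form of an algebraic relation
  would be a nonzero element that vanishes there. So there is a syzygy with a unit entry
  (\<open>linear_type_syzygy\<close>). If that entry belongs to \<open>f\<close>, then \<open>f \<in> J\<close> locally. Otherwise the syzygy is a vector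
  field that does not vanish at \<open>a\<close> and maps \<open>f\<close> into \<open>(f)\<close>. Such a field preserves \<open>I\<close>, and
  differentiating the least power of a coordinate in \<open>I\<close> shows in characteristic zero that \<open>I\<close> is
  the unit ideal at \<open>a\<close>, which is absurd (\<open>unit_syzygy_imp_eulerian\<close>).

  Ideals of the local ring at \<open>M\<close> are represented throughout by their contractions to the polynomial ring.\<close>

(* The literal 1 stays in place of Suc 0, so that the exponent of a variable keeps its syntactic form. *)
declare One_nat_def [simp del]

section \<open>Ideals as submodules\<close>

global_interpretation idl: Modules.module "(*) :: 'a::comm_ring_1 \<Rightarrow> 'a \<Rightarrow> 'a"
  by unfold_locales (simp_all add: algebra_simps)

(* As a rewrite rule it works against associativity in algebra_simps. *)
declare idl.scale_scale [simp del]

lemma subspace_mult_right: "idl.subspace I \<Longrightarrow> x \<in> I \<Longrightarrow> x * c \<in> I"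
  using idl.subspace_scale[of I x c] by (simp add: mult.commute)

lemma ideal_ring_of_type_algebra_iff:
  "ideal I (ring_of_type_algebra :: 'a::comm_ring_1 ring) \<longleftrightarrow> idl.subspace I"
proof
  assume I: "ideal I (ring_of_type_algebra :: 'a ring)"
  interpret ideal I "ring_of_type_algebra :: 'a ring" by fact
  note closed = additive_subgroup.zero_closed[OF is_additive_subgroup] additive_subgroup.a_closed[OF is_additive_subgroup] I_l_closed
  show "idl.subspace I"
    by (rule idl.subspaceI) (use closed in \<open>simp_all add: ring_of_type_algebra_def\<close>)
next
  assume I: "idl.subspace I"
  show "ideal I (ring_of_type_algebra :: 'a ring)"
  proof (rule idealI)
    show "ring (ring_of_type_algebra :: 'a ring)"
      by (rule ring_from_type_algebra)
    interpret ring "ring_of_type_algebra :: 'a ring"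
      by (rule ring_from_type_algebra)
    show "subgroup I (add_monoid (ring_of_type_algebra :: 'a ring))"
    proof (rule add.subgroupI)
      fix a assume a: "a \<in> I"
      have "\<ominus>\<^bsub>ring_of_type_algebra\<^esub> a = - a"
        by (rule minus_equality) (auto simp: ring_of_type_algebra_def)
      then show "\<ominus>\<^bsub>ring_of_type_algebra\<^esub> a \<in> I"
        using idl.subspace_neg[OF I a] by simp
    qed (use I in \<open>auto simp: ring_of_type_algebra_def idl.subspace_def\<close>)
  qed (use idl.subspace_scale[OF I] subspace_mult_right[OF I] in
      \<open>auto simp: ring_of_type_algebra_def\<close>)
qed

lemma genideal_eq_span:
  "Idl\<^bsub>ring_of_type_algebra\<^esub> G = idl.span (G :: 'a::comm_ring_1 set)"
proof -
  have "{I. idl.subspace I \<and> G \<subseteq> I} = {I. G \<subseteq> I \<and> idl.subspace I}" by auto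
  then show ?thesis
    by (simp add: genideal_def ideal_ring_of_type_algebra_iff idl.span_def hull_def)
qed

lemma subspace_eq_UNIV: "idl.subspace I \<Longrightarrow> 1 \<in> I \<Longrightarrow> I = UNIV"
  using idl.subspace_scale[of I 1] by auto

lemma in_span_range_iff:
  fixes h :: "'i \<Rightarrow> 'a::comm_ring_1"
  assumes "finite A"
  shows "x \<in> idl.span (h ` A) \<longleftrightarrow> (\<exists>r. x = (\<Sum>i\<in>A. r i * h i))"
proof
  show "x \<in> idl.span (h ` A) \<Longrightarrow> \<exists>r. x = (\<Sum>i\<in>A. r i * h i)"
  proof (induction rule: idl.span_induct_alt)
    case base
    show ?case by (intro exI[of _ "\<lambda>_. 0"]) simp
  next
    case (step c y z)
    then obtain r i where r: "z = (\<Sum>i\<in>A. r i * h i)" and i: "i \<in> A" "y = h i" by auto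
    have "(\<Sum>j\<in>A. (if j = i then c else 0) * h j) = (\<Sum>j\<in>A. if j = i then c * h j else 0)"
      by (intro sum.cong) auto
    also have "\<dots> = c * y" using assms i by simp
    finally have "c * y + z = (\<Sum>j\<in>A. ((if j = i then c else 0) + r j) * h j)"
      using r by (simp add: algebra_simps sum.distrib)
    then show ?case by (intro exI[of _ "\<lambda>j. (if j = i then c else 0) + r j"])
  qed
next
  show "\<exists>r. x = (\<Sum>i\<in>A. r i * h i) \<Longrightarrow> x \<in> idl.span (h ` A)"
    by (auto intro: idl.span_sum idl.span_scale idl.span_base)
qed

section \<open>Multivariate polynomials\<close>

abbreviation lookup :: "('m \<Rightarrow>\<^sub>0 'a::zero) \<Rightarrow> 'm \<Rightarrow> 'a" where "lookup \<equiv> Poly_Mapping.lookup"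
abbreviation keys :: "('m \<Rightarrow>\<^sub>0 'a::zero) \<Rightarrow> 'm set" where "keys \<equiv> Poly_Mapping.keys"
abbreviation single :: "'m \<Rightarrow> 'a::zero \<Rightarrow> 'm \<Rightarrow>\<^sub>0 'a" where "single \<equiv> Poly_Mapping.single"

definition monom_eval :: "('v \<Rightarrow> 'b::comm_semiring_1) \<Rightarrow> ('v \<Rightarrow>\<^sub>0 nat) \<Rightarrow> 'b" where
  "monom_eval a m = (\<Prod>v\<in>keys m. a v ^ lookup m v)"

locale coeff_hom =
  fixes h :: "'a::comm_ring_1 \<Rightarrow> 'b::comm_ring_1"
  assumes hom_add: "h (x + y) = h x + h y"
    and hom_mult: "h (x * y) = h x * h y"
    and hom_one: "h 1 = 1"
begin

lemma hom_zero: "h 0 = 0"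
  using hom_add[of 0 0] by simp

lemma hom_uminus: "h (- x) = - h x"
  using hom_add[of x "- x"] hom_zero by (simp add: eq_neg_iff_add_eq_0 add.commute)

lemma hom_diff: "h (x - y) = h x - h y"
  using hom_add[of x "- y"] hom_uminus by simp

lemma hom_sum: "h (\<Sum>i\<in>A. g i) = (\<Sum>i\<in>A. h (g i))"
  by (induction A rule: infinite_finite_induct) (auto simp: hom_zero hom_add)

lemma hom_prod: "h (\<Prod>i\<in>A. g i) = (\<Prod>i\<in>A. h (g i))"
  by (induction A rule: infinite_finite_induct) (auto simp: hom_one hom_mult)

lemma hom_power: "h (x ^ n) = h x ^ n"
  by (induction n) (auto simp: hom_one hom_mult)

lemma hom_monom_eval: "h (monom_eval x b) = monom_eval (\<lambda>v. h (x v)) b"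
  by (simp add: monom_eval_def hom_prod hom_power)

lemmas hom_simps = hom_zero hom_add hom_mult hom_one hom_uminus hom_diff hom_sum hom_prod hom_power

end

lemma coeff_hom_id: "coeff_hom (\<lambda>c. c)"
  by unfold_locales auto

lemma coeff_hom_mconst: "coeff_hom (mconst :: 'a::comm_ring_1 \<Rightarrow> ('v, 'a) mpoly)"
  by unfold_locales (auto simp: single_add mult_single)

lemma coeff_hom_pCons: "coeff_hom (\<lambda>c::'a::comm_ring_1. [:c:])"
  by unfold_locales auto

lemma coeff_hom_comp: "coeff_hom g \<Longrightarrow> coeff_hom h \<Longrightarrow> coeff_hom (\<lambda>x. g (h x))"
  by (auto simp: coeff_hom_def)

lemma mpoly_sum_monomials:
  fixes p :: "'m \<Rightarrow>\<^sub>0 'a::comm_monoid_add"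
  shows "(\<Sum>m\<in>keys p. single m (lookup p m)) = p"
proof (rule poly_mapping_eqI)
  fix k
  show "lookup (\<Sum>m\<in>keys p. single m (lookup p m)) k
      = lookup p k"
    by (cases "k \<in> keys p")
      (auto simp: lookup_sum lookup_single when_def in_keys_iff)
qed

lemma eq_mconst_if_keys:
  assumes "\<And>m. m \<in> keys p \<Longrightarrow> m = 0"
  shows "p = mconst (lookup p 0)"
proof (rule poly_mapping_eqI)
  fix m
  show "lookup p m = lookup (mconst (lookup p 0)) m"
    using assms[of m] by (cases "m = 0") (auto simp: in_keys_iff lookup_single_not_eq)
qed

lemma exponent_split:
  fixes m :: "'v \<Rightarrow>\<^sub>0 nat"
  assumes "n \<le> lookup m v"
  shows "m = single v n + (m - single v n)"
  by (rule poly_mapping_eqI) (use assms in \<open>auto simp: lookup_add lookup_minus lookup_single when_def\<close>)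

lemma mpoly_induct [case_names zero monomial add]:
  fixes p :: "'m \<Rightarrow>\<^sub>0 'a::comm_monoid_add"
  assumes "P 0" and "\<And>m c. m \<in> keys p \<Longrightarrow> P (single m c)"
    and "\<And>q r. P q \<Longrightarrow> P r \<Longrightarrow> P (q + r)"
  shows "P p"
proof -
  have "P (\<Sum>m\<in>A. single m (lookup p m))" if "A \<subseteq> keys p" for A
    using finite_subset[OF that finite_keys] that
    by (induction A rule: finite_induct) (use assms in auto)
  then show ?thesis using mpoly_sum_monomials[of p] by (metis subset_refl)
qed

lemma monom_eval_superset:
  assumes "finite A" "keys m \<subseteq> A"
  shows "monom_eval a m = (\<Prod>v\<in>A. a v ^ lookup m v)"
  unfolding monom_eval_def
  by (rule prod.mono_neutral_left) (use assms in \<open>auto simp: in_keys_iff\<close>)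

lemma monom_eval_0 [simp]: "monom_eval a 0 = 1"
  by (simp add: monom_eval_def)

lemma monom_eval_add: "monom_eval a (m + n) = monom_eval a m * monom_eval a n"
proof -
  let ?A = "keys m \<union> keys n"
  have k: "keys (m + n) \<subseteq> ?A" by (rule keys_add)
  show ?thesis
    by (simp add: monom_eval_superset[of ?A] k lookup_add power_add prod.distrib)
qed

lemma monom_eval_single: "monom_eval a (single v n) = a v ^ n"
  by (simp add: monom_eval_def)

lemma monom_eval_cong:
  "(\<And>v. v \<in> keys m \<Longrightarrow> a v = b v) \<Longrightarrow> monom_eval a m = monom_eval b m"
  by (simp add: monom_eval_def)

lemma mpoly_subst_monom_eval:
  "mpoly_subst h a p = (\<Sum>m\<in>keys p. h (lookup p m) * monom_eval a m)"
  by (simp add: mpoly_subst_def monom_eval_def)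

lemma mpoly_subst_zero [simp]: "mpoly_subst h a 0 = 0"
  by (simp add: mpoly_subst_def)

context coeff_hom
begin

lemma subst_superset:
  assumes "finite A" "keys p \<subseteq> A"
  shows "mpoly_subst h a p = (\<Sum>m\<in>A. h (lookup p m) * monom_eval a m)"
  unfolding mpoly_subst_monom_eval
  by (rule sum.mono_neutral_left) (use assms in \<open>auto simp: in_keys_iff hom_zero\<close>)

lemma subst_single: "mpoly_subst h a (single m c) = h c * monom_eval a m"
  by (subst subst_superset[of "{m}"]) auto

lemma subst_mconst: "mpoly_subst h a (mconst c) = h c"
  by (simp add: subst_single)

lemma subst_mvar: "mpoly_subst h a (mvar v) = a v"
  by (simp add: subst_single monom_eval_single hom_one)

lemma subst_add: "mpoly_subst h a (p + q) = mpoly_subst h a p + mpoly_subst h a q"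
proof -
  let ?A = "keys p \<union> keys q"
  have k: "keys (p + q) \<subseteq> ?A" by (rule keys_add)
  show ?thesis
    by (simp add: subst_superset[of ?A] k lookup_add hom_add distrib_right sum.distrib)
qed

lemma subst_mult: "mpoly_subst h a (p * q) = mpoly_subst h a p * mpoly_subst h a q"
proof (induction p rule: mpoly_induct)
  case (monomial m c)
  show ?case
  proof (induction q rule: mpoly_induct)
    case (monomial n d)
    then show ?case
      by (simp add: subst_single mult_single hom_mult monom_eval_add)
  next
    case (add q r)
    then show ?case by (simp only: distrib_left subst_add)
  qed simp
qed (auto simp: subst_add distrib_right)

lemma coeff_hom_subst: "coeff_hom (mpoly_subst h a)"
proof
  show "mpoly_subst h a 1 = 1"
    using subst_mconst[of a 1] by (simp add: hom_one)
qed (rule subst_add subst_mult)+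

end

lemma monomial_eq_prod:
  fixes m :: "'v \<Rightarrow>\<^sub>0 nat"
  shows "single m (1 :: 'a::comm_ring_1) = monom_eval mvar m"
proof -
  have pw: "mvar v ^ n = (single (single v n) 1 :: ('v, 'a) mpoly)" for v n
    by (induction n) (simp_all add: mult_single single_add[symmetric] plus_1_eq_Suc)
  have pr: "(\<Prod>v\<in>A. mvar v ^ lookup m v) =
      (single (\<Sum>v\<in>A. single v (lookup m v)) 1 :: ('v, 'a) mpoly)"
    for A
    by (induction A rule: infinite_finite_induct) (auto simp: pw mult_single)
  show ?thesis unfolding monom_eval_def pr by (simp add: mpoly_sum_monomials)
qed

lemma single_eq_mconst_times: "single m c = mconst c * single m (1::'a::comm_ring_1)"
  by (simp add: mult_single)

lemma mpoly_hom_eqI: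
  fixes g h :: "('v, 'a::comm_ring_1) mpoly \<Rightarrow> 'b::comm_ring_1"
  assumes g: "coeff_hom g" and h: "coeff_hom h"
    and c: "\<And>c. g (mconst c) = h (mconst c)" and v: "\<And>v. g (mvar v) = h (mvar v)"
  shows "g p = h p"
proof -
  interpret g: coeff_hom g by fact
  interpret h: coeff_hom h by fact
  have s: "g (single m x) = h (single m x)" for m x
    by (subst (1 2) single_eq_mconst_times, subst (1 2) monomial_eq_prod)
      (simp add: g.hom_simps h.hom_simps c v monom_eval_def)
  show ?thesis
    by (induction p rule: mpoly_induct) (simp_all add: s g.hom_simps h.hom_simps)
qed

abbreviation eval_at :: "('v \<Rightarrow> 'a::comm_ring_1) \<Rightarrow> ('v, 'a) mpoly \<Rightarrow> 'a" where
  "eval_at a \<equiv> mpoly_subst (\<lambda>c. c) a"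

lemma coeff_hom_eval_at: "coeff_hom (eval_at a)"
  by (rule coeff_hom.coeff_hom_subst[OF coeff_hom_id])

lemmas eval_at_simps [simp] =
  coeff_hom.hom_simps[OF coeff_hom_eval_at]
  coeff_hom.subst_mconst[OF coeff_hom_id] coeff_hom.subst_mvar[OF coeff_hom_id]

subsection \<open>Partial derivatives\<close>

lemma pderiv_superset:
  assumes "finite A" "keys p \<subseteq> A"
  shows "mpoly_pderiv v p = (\<Sum>m\<in>A. single (m - single v 1)
    (of_nat (lookup m v) * lookup p m))"
  unfolding mpoly_pderiv_def
  by (rule sum.mono_neutral_left) (use assms in \<open>auto simp: in_keys_iff\<close>)

lemma pderiv_single:
  "mpoly_pderiv v (single m c) =
    single (m - single v 1) (of_nat (lookup m v) * c)"
  by (subst pderiv_superset[of "{m}"]) auto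

lemma pderiv_zero [simp]: "mpoly_pderiv v 0 = 0"
  by (simp add: mpoly_pderiv_def)

lemma pderiv_add: "mpoly_pderiv v (p + q) = mpoly_pderiv v p + mpoly_pderiv v q"
proof -
  let ?A = "keys p \<union> keys q"
  have k: "keys (p + q) \<subseteq> ?A" by (rule keys_add)
  show ?thesis
    by (simp add: pderiv_superset[of ?A] k lookup_add distrib_left single_add sum.distrib)
qed

lemma pderiv_sum: "mpoly_pderiv v (\<Sum>i\<in>A. g i) = (\<Sum>i\<in>A. mpoly_pderiv v (g i))"
  by (induction A rule: infinite_finite_induct) (auto simp: pderiv_add)

lemma exponent_diff_add:
  assumes "lookup m v \<noteq> (0::nat)"
  shows "m - single v 1 + n = m + n - single v 1"
  by (rule poly_mapping_eqI) (use assms in \<open>auto simp: lookup_add lookup_minus lookup_single when_def\<close>)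

lemma pderiv_mult_single:
  fixes c d :: "'a::comm_ring_1"
  shows "mpoly_pderiv v (single m c * single n d) =
    single m c * mpoly_pderiv v (single n d) +
    mpoly_pderiv v (single m c) * single n d"
proof -
  let ?e = "single v (1::nat)"
  have 1: "single (m - ?e + n) (of_nat (lookup m v) * c * d) =
      single (m + n - ?e) (of_nat (lookup m v) * c * d)"
    using exponent_diff_add[of m v n] by (cases "lookup m v = 0") auto
  have 2: "single (m + (n - ?e)) (of_nat (lookup n v) * c * d) =
      single (m + n - ?e) (of_nat (lookup n v) * c * d)"
    using exponent_diff_add[of n v m] by (cases "lookup n v = 0") (auto simp: add.commute)
  show ?thesis
    unfolding mult_single pderiv_single lookup_add of_nat_add mult.left_commute[of c]
    unfolding mult.assoc[symmetric] distrib_right single_add 1 2 by (rule add.commute)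
qed

lemma pderiv_mult:
  "mpoly_pderiv v (p * q) = p * mpoly_pderiv v q + mpoly_pderiv v p * (q :: ('v, 'a::comm_ring_1) mpoly)"
proof (induction p rule: mpoly_induct)
  case (monomial m c)
  show ?case
  proof (induction q rule: mpoly_induct)
    case (monomial n d)
    show ?case by (rule pderiv_mult_single)
  next
    case (add q r)
    then show ?case by (simp only: distrib_left pderiv_add) simp
  qed simp
next
  case (add q r)
  then show ?case by (simp only: distrib_right pderiv_add) simp
qed simp

lemma pderiv_commute:
  "mpoly_pderiv v (mpoly_pderiv w p) = mpoly_pderiv w (mpoly_pderiv v (p :: ('v, 'a::comm_ring_1) mpoly))"
proof (induction p rule: mpoly_induct)
  case (monomial m c)
  have "m - single w 1 - single v 1 =
      m - single v 1 - single w (1::nat)"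
    by (rule poly_mapping_eqI) (auto simp: lookup_minus)
  then show ?case
    unfolding pderiv_single lookup_minus
    by (cases "v = w") (simp_all add: lookup_single_not_eq mult.left_commute)
qed (simp_all only: pderiv_add pderiv_zero)

lemma pderiv_mvar: "mpoly_pderiv v (mvar w) = (if v = w then 1 else 0 :: ('v, 'a::comm_ring_1) mpoly)"
  by (auto simp: pderiv_single lookup_single when_def)

lemma pderiv_mconst [simp]: "mpoly_pderiv v (mconst c) = 0"
  by (simp add: pderiv_single)

section \<open>The Nullstellensatz\<close>

definition prime_ideal :: "'a::comm_ring_1 set \<Rightarrow> bool" where
  "prime_ideal Q \<longleftrightarrow> idl.subspace Q \<and> 1 \<notin> Q \<and> (\<forall>x y. x * y \<in> Q \<longrightarrow> x \<in> Q \<or> y \<in> Q)"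

lemma prime_idealD:
  assumes "prime_ideal Q"
  shows "idl.subspace Q" "1 \<notin> Q" "x * y \<in> Q \<Longrightarrow> x \<in> Q \<or> y \<in> Q"
  using assms by (auto simp: prime_ideal_def)

lemma prime_ideal_power: "prime_ideal Q \<Longrightarrow> x ^ n \<in> Q \<Longrightarrow> x \<in> Q"
  by (induction n) (auto simp: prime_ideal_def)

definition subring_set :: "'a::comm_ring_1 set \<Rightarrow> bool" where
  "subring_set B \<longleftrightarrow> 1 \<in> B \<and> (\<forall>x\<in>B. \<forall>y\<in>B. x + y \<in> B \<and> x - y \<in> B \<and> x * y \<in> B)"

lemma subring_setD:
  assumes "subring_set B"
  shows "1 \<in> B" "0 \<in> B" "x \<in> B \<Longrightarrow> y \<in> B \<Longrightarrow> x + y \<in> B" "x \<in> B \<Longrightarrow> y \<in> B \<Longrightarrow> x - y \<in> B"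
    "x \<in> B \<Longrightarrow> y \<in> B \<Longrightarrow> x * y \<in> B" "x \<in> B \<Longrightarrow> - x \<in> B" "x \<in> B \<Longrightarrow> x ^ n \<in> B"
proof -
  show z: "0 \<in> B" using assms by (metis cancel_comm_monoid_add_class.diff_cancel subring_set_def)
  show "x \<in> B \<Longrightarrow> - x \<in> B" using assms z by (metis diff_0 subring_set_def)
  show "x \<in> B \<Longrightarrow> x ^ n \<in> B" using assms by (induction n) (auto simp: subring_set_def)
qed (use assms in \<open>auto simp: subring_set_def\<close>)

lemma subring_set_sum: "subring_set B \<Longrightarrow> (\<And>i. i \<in> A \<Longrightarrow> g i \<in> B) \<Longrightarrow> sum g A \<in> B"
  by (induction A rule: infinite_finite_induct) (auto simp: subring_setD)

definition polys_over :: "'a::comm_ring_1 set \<Rightarrow> 'a poly set" where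
  "polys_over B = {p. \<forall>i. coeff p i \<in> B}"

lemma polys_over_closed:
  assumes "subring_set B" "p \<in> polys_over B" "q \<in> polys_over B"
  shows "p + q \<in> polys_over B" "p - q \<in> polys_over B" "p * q \<in> polys_over B"
  using assms by (auto simp: polys_over_def coeff_mult subring_setD intro!: subring_set_sum)

lemma polys_over_monom: "subring_set B \<Longrightarrow> c \<in> B \<Longrightarrow> monom c n \<in> polys_over B"
  by (auto simp: polys_over_def subring_setD)

lemma polys_over_smult: "subring_set B \<Longrightarrow> c \<in> B \<Longrightarrow> p \<in> polys_over B \<Longrightarrow> smult c p \<in> polys_over B"
  by (auto simp: polys_over_def subring_setD)

text \<open>The coefficients stay in the given subring, because the leading coefficient of \<open>e\<close> is multiplied
  into \<open>p\<close> and never inverted. The degree bound on the quotient has to be part of the claim: leading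
  coefficients may be zero divisors.\<close>

lemma pseudo_division:
  assumes B: "subring_set B" and p: "p \<in> polys_over B" and e: "e \<in> polys_over B" "e \<noteq> 0"
  obtains N q r where "smult (lead_coeff e ^ N) p = q * e + r" "q \<in> polys_over B" "r \<in> polys_over B"
    "r = 0 \<or> degree r < degree e" "q = 0 \<or> degree q + degree e \<le> degree p"
proof -
  let ?c = "lead_coeff e"
  have c: "?c \<in> B" using e by (auto simp: polys_over_def)
  have "\<exists>N q r. smult (?c ^ N) p = q * e + r \<and> q \<in> polys_over B \<and> r \<in> polys_over B \<and>
    (r = 0 \<or> degree r < degree e) \<and> (q = 0 \<or> degree q + degree e \<le> degree p)"
    using p
  proof (induction "degree p" arbitrary: p rule: less_induct)
    case less
    show ?case
    proof (cases "p = 0 \<or> degree p < degree e")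
      case True
      then show ?thesis
        using less.prems B by (intro exI[of _ 0] exI[of _ p]) (auto simp: polys_over_def subring_setD)
    next
      case False
      let ?d = "degree p - degree e"
      let ?t = "monom (lead_coeff p) ?d"
      define p' where "p' = smult ?c p - ?t * e"
      have lp: "lead_coeff p \<in> B" using less.prems by (auto simp: polys_over_def)
      have t: "?t \<in> polys_over B" using polys_over_monom[OF B lp] .
      have p': "p' \<in> polys_over B"
        unfolding p'_def using B less.prems e t c by (intro polys_over_closed polys_over_smult)
      have dt: "degree (?t * e) \<le> degree p"
        using degree_mult_le[of ?t e] degree_monom_le[of "lead_coeff p" ?d] False by linarith
      have dp': "degree p' \<le> degree p"
        unfolding p'_def by (intro degree_diff_le dt degree_smult_le)
      have cp': "coeff p' (degree p) = 0"
        unfolding p'_def using False by (simp add: coeff_monom_mult)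
      have "p' = 0 \<or> degree p' < degree p"
        using dp' cp' by (metis le_neq_implies_less leading_coeff_0_iff)
      then obtain N q r where nqr: "smult (?c ^ N) p' = q * e + r" "q \<in> polys_over B" "r \<in> polys_over B"
        "r = 0 \<or> degree r < degree e" "q = 0 \<or> degree q + degree e \<le> degree p"
      proof
        assume "p' = 0"
        then show ?thesis using that[of 0 0 0] B by (auto simp: polys_over_def subring_setD)
      next
        assume "degree p' < degree p"
        from less.hyps[OF this p'] obtain N q r where "smult (?c ^ N) p' = q * e + r"
          "q \<in> polys_over B" "r \<in> polys_over B"
          "r = 0 \<or> degree r < degree e" "q = 0 \<or> degree q + degree e \<le> degree p'" by blast
        then show ?thesis using that[of N q r] dp' by force
      qed
      let ?q = "q + smult (?c ^ N) ?t"
      have "smult (?c ^ Suc N) p = smult (?c ^ N) p' + smult (?c ^ N) (?t * e)"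
        by (simp add: p'_def smult_diff_right mult.commute)
      then have "smult (?c ^ Suc N) p = ?q * e + r"
        using nqr(1) by (simp add: algebra_simps)
      moreover have "?q \<in> polys_over B"
        using B nqr(2) t c by (intro polys_over_closed polys_over_smult subring_setD)
      moreover have "degree ?q + degree e \<le> degree p"
      proof -
        have "degree (smult (?c ^ N) ?t) \<le> ?d"
          using degree_smult_le[of "?c ^ N" ?t] degree_monom_le[of "lead_coeff p" ?d] by linarith
        moreover have "degree q \<le> ?d" using nqr(5) by auto
        ultimately have "degree ?q \<le> ?d" by (intro degree_add_le)
        then show ?thesis using False by linarith
      qed
      ultimately show ?thesis using nqr(3,4) by blast
    qed
  qed
  then show thesis using that by blast
qed

definition polys_in :: "'v set \<Rightarrow> ('v, 'a::zero) mpoly set" where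
  "polys_in V = {p. \<forall>m\<in>keys p. keys m \<subseteq> V}"

lemma polys_in_UNIV [simp]: "polys_in UNIV = UNIV"
  by (simp add: polys_in_def)

lemma polys_in_mono: "V \<subseteq> W \<Longrightarrow> polys_in V \<subseteq> polys_in W"
  by (auto simp: polys_in_def)

lemma polys_in_single: "keys m \<subseteq> V \<Longrightarrow> single m c \<in> polys_in V"
  by (auto simp: polys_in_def)

lemma mconst_in_polys_in: "mconst c \<in> polys_in V"
  by (rule polys_in_single) simp

lemma mvar_in_polys_in: "v \<in> V \<Longrightarrow> mvar v \<in> polys_in V"
  by (rule polys_in_single) simp

lemma keys_add_nat: "keys (m + n) = keys m \<union> keys (n :: 'v \<Rightarrow>\<^sub>0 nat)"
  by (auto simp: in_keys_iff lookup_add)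

lemma subring_set_polys_in: "subring_set (polys_in V :: ('v, 'a::comm_ring_1) mpoly set)"
proof -
  have "p * q \<in> polys_in V" if "p \<in> polys_in V" "q \<in> polys_in V" for p q :: "('v, 'a) mpoly"
    using that keys_mult[of p q] by (fastforce simp: polys_in_def keys_add_nat)
  moreover have "p + q \<in> polys_in V" if "p \<in> polys_in V" "q \<in> polys_in V" for p q :: "('v, 'a) mpoly"
    using that keys_add[of p q] by (auto simp: polys_in_def)
  moreover have "p - q \<in> polys_in V" if "p \<in> polys_in V" "q \<in> polys_in V" for p q :: "('v, 'a) mpoly"
    using that keys_diff[of p q] by (auto simp: polys_in_def)
  moreover have "(1 :: ('v, 'a) mpoly) \<in> polys_in V"
    by (metis mconst_in_polys_in single_one)
  ultimately show ?thesis by (auto simp: subring_set_def)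
qed

lemmas polys_in_closed = subring_setD[OF subring_set_polys_in]

lemma polys_in_induct [consumes 1, case_names monomial add]:
  fixes p :: "('v, 'a::comm_ring_1) mpoly"
  assumes "p \<in> polys_in V"
    and "\<And>m c. keys m \<subseteq> V \<Longrightarrow> P (single m c)"
    and "\<And>q r. P q \<Longrightarrow> P r \<Longrightarrow> P (q + r)"
  shows "P p"
proof (induction p rule: mpoly_induct)
  case zero
  then show ?case using assms(2)[of 0 0] by simp
next
  case (monomial m c)
  then show ?case using assms by (auto simp: polys_in_def)
qed (use assms in auto)

text \<open>A polynomial is regarded as one in the single variable \<open>v\<close> over the ring of the polynomials in the
  others; evaluation at \<open>mvar v\<close> returns it. This makes induction on the number of variables possible.\<close>

lemma polys_in_insert_as_poly:
  assumes "g \<in> polys_in (insert v W)"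
  obtains P where "P \<in> polys_over (polys_in W)" "poly P (mvar v) = (g :: ('v, 'a::comm_ring_1) mpoly)"
proof -
  have "\<exists>P \<in> polys_over (polys_in W). poly P (mvar v) = g"
    using assms
  proof (induction rule: polys_in_induct)
    case (monomial m c)
    let ?n = "lookup m v"
    let ?m = "m - single v ?n"
    have m: "m = ?m + single v ?n" using exponent_split[of ?n m v] by (simp add: add.commute)
    have "keys ?m \<subseteq> W"
    proof
      fix w assume "w \<in> keys ?m"
      then have "w \<in> keys m" "w \<noteq> v"
        by (auto simp: in_keys_iff lookup_minus lookup_single when_def split: if_splits)
      then show "w \<in> W" using monomial by auto
    qed
    then have "monom (single ?m c) ?n \<in> polys_over (polys_in W)"
      by (intro polys_over_monom subring_set_polys_in polys_in_single)
    moreover have "poly (monom (single ?m c) ?n) (mvar v) = single m c"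
      by (subst (4) m) (simp add: poly_monom monomial_eq_prod[symmetric] mult_single
        monom_eval_single[of mvar v, symmetric])
    ultimately show ?case by blast
  next
    case (add q r)
    then show ?case
      by (metis poly_add polys_over_closed(1) subring_set_polys_in)
  qed
  then show thesis using that by blast
qed

lemma poly_in_polys_in_insert:
  assumes "P \<in> polys_over (polys_in W)"
  shows "poly P (mvar v) \<in> (polys_in (insert v W) :: ('v, 'a::comm_ring_1) mpoly set)"
proof -
  have c: "coeff P i \<in> polys_in (insert v W)" for i
    using assms polys_in_mono[of W "insert v W"] by (auto simp: polys_over_def)
  show ?thesis
    unfolding poly_altdef
    by (intro subring_set_sum subring_set_polys_in polys_in_closed(5,7) c
      mvar_in_polys_in) auto
qed

lemma eval_at_cong:
  "p \<in> polys_in V \<Longrightarrow> (\<And>v. v \<in> V \<Longrightarrow> a v = b v) \<Longrightarrow> eval_at a p = eval_at b p"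
  by (auto simp: mpoly_subst_monom_eval polys_in_def intro!: sum.cong arg_cong2[of _ _ _ _ "(*)"] monom_eval_cong)

lemma eval_at_poly:
  assumes "P \<in> polys_over (polys_in W)" "v \<notin> W"
  shows "eval_at (a(v := r)) (poly P (mvar v)) = poly (map_poly (eval_at a) P) (r :: 'a::comm_ring_1)"
proof -
  have "eval_at (a(v := r)) (coeff P i) = eval_at a (coeff P i)" for i
    by (rule eval_at_cong[of _ W]) (use assms in \<open>auto simp: polys_over_def\<close>)
  then have "eval_at (a(v := r)) (poly P (mvar v)) = (\<Sum>i\<le>degree P. eval_at a (coeff P i) * r ^ i)"
    by (simp add: poly_altdef)
  also have "\<dots> = poly (map_poly (eval_at a) P) r"
    unfolding poly_altdef
    by (rule sum.mono_neutral_cong_right) (auto simp: map_poly_degree_leq coeff_map_poly intro!: le_degree)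
  finally show ?thesis .
qed

text \<open>Points of a variety are built one coordinate at a time. Over the ring of the polynomials in
  the variables fixed so far, a prime ideal is either extended from that ring, and then almost every
  value of the new coordinate is admissible, or it is controlled by a polynomial of minimal degree
  in the new variable, and then the new coordinate has to be one of its roots. That step loses
  points at which some leading coefficient vanishes, so the statement has to
  carry along a polynomial \<open>t\<close> that is kept different from zero.\<close>

lemma prime_ideal_has_zero_finite:
  fixes Q :: "('v, 'k::{alg_closed_field, field_char_0}) mpoly set"
  assumes Q: "prime_ideal Q" and "finite W" and "t \<in> polys_in W" "t \<notin> Q"
  shows "\<exists>a. (\<forall>g\<in>Q \<inter> polys_in W. eval_at a g = 0) \<and> eval_at a t \<noteq> 0"
  using assms(2-4)
proof (induction W arbitrary: t)
  case empty
  have const: "g = mconst (lookup g 0)" if "g \<in> polys_in {}" for g :: "('v, 'k) mpoly"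
    using that by (intro eq_mconst_if_keys) (auto simp: polys_in_def)
  have unit: "mconst c \<notin> Q" if "c \<noteq> 0" for c
  proof
    assume "mconst c \<in> Q"
    then have "mconst (inverse c) * mconst c \<in> Q"
      using prime_idealD(1)[OF Q] by (rule idl.subspace_scale[rotated])
    then show False using that prime_idealD(2)[OF Q] by (simp add: mult_single)
  qed
  show ?case
  proof (intro exI[of _ "\<lambda>_. 0"] conjI ballI)
    fix g assume "g \<in> Q \<inter> polys_in {}"
    then show "eval_at (\<lambda>_. 0) g = 0"
      using const[of g] unit[of "lookup g 0"] by (metis IntE eval_at_simps(10) single_zero)
  next
    show "eval_at (\<lambda>_. 0) t \<noteq> 0"
      using const[OF empty(1)] empty(2) prime_idealD(1)[OF Q]
      by (metis eval_at_simps(10) idl.subspace_0 single_zero)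
  qed
next
  case (insert v W)
  let ?B = "polys_in W :: ('v, 'k) mpoly set"
  let ?V = "polys_in (insert v W) :: ('v, 'k) mpoly set"
  let ?P = "polys_over ?B"
  let ?x = "mvar v :: ('v, 'k) mpoly"
  note Qsub = prime_idealD(1)[OF Q]
  note Bsub = subring_set_polys_in[of W, where 'a='k]
  note Qpow = prime_ideal_power[OF Q]
  note Qprime = prime_idealD(3)[OF Q]
  define nz where "nz p \<longleftrightarrow> (\<exists>i. coeff p i \<notin> Q)" for p
  have eval_Q: "poly p x \<in> Q" if "\<not> nz p" for p x
    using that unfolding nz_def poly_altdef
    by (auto intro!: idl.subspace_sum[OF Qsub] subspace_mult_right[OF Qsub])
  \<comment> \<open>A polynomial of minimal degree has its leading coefficient outside \<open>Q\<close>, since otherwise the leading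
      term could be dropped. The condition \<open>C\<close> is membership in \<open>Q\<close> for \<open>p\<close> and in \<open>Q + (t)\<close> for \<open>e\<close> below.\<close>
  have lead: "lead_coeff p \<notin> Q"
    if p: "p \<in> ?P" "nz p" "C (poly p ?x)" and C: "\<And>z y. C z \<Longrightarrow> y \<in> Q \<Longrightarrow> C (z - y)"
      and min: "\<And>q. q \<in> ?P \<Longrightarrow> nz q \<Longrightarrow> C (poly q ?x) \<Longrightarrow> degree p \<le> degree q" for p C
  proof
    assume l: "lead_coeff p \<in> Q"
    define q where "q = p - monom (lead_coeff p) (degree p)"
    obtain i where i: "coeff p i \<notin> Q" using p by (auto simp: nz_def)
    have "i \<noteq> degree p" using i l by auto
    then have "coeff q i \<notin> Q" using i by (simp add: q_def)
    then have nzq: "nz q" by (auto simp: nz_def)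
    have "lead_coeff p \<in> ?B" using p by (auto simp: polys_over_def)
    then have "q \<in> ?P"
      unfolding q_def by (intro polys_over_closed polys_over_monom Bsub p)
    moreover have "C (poly q ?x)"
      unfolding q_def using C[OF p(3)] l
      by (simp add: poly_monom subspace_mult_right[OF Qsub])
    ultimately have "degree p \<le> degree q" using min nzq by blast
    moreover have "degree q \<le> degree p"
      unfolding q_def by (intro degree_diff_le degree_monom_le order_refl)
    moreover have "coeff q (degree p) = 0" by (simp add: q_def)
    ultimately have "q = 0" by (metis le_antisym leading_coeff_0_iff)
    then show False using nzq idl.subspace_0[OF Qsub] by (simp add: nz_def)
  qed
  obtain T where T: "T \<in> ?P" "poly T ?x = t"
    using polys_in_insert_as_poly[OF insert.prems(1)] by blast
  show ?case
  proof (cases "\<exists>p\<in>?P. nz p \<and> poly p ?x \<in> Q")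
    case False
    \<comment> \<open>The ideal is extended from the smaller ring: any value of the new coordinate works that is not
        a root of \<open>t\<close> specialised at \<open>a\<close>.\<close>
    have "nz T" using eval_Q[of T ?x] T(2) insert.prems(2) by auto
    then obtain i where i: "coeff T i \<notin> Q" by (auto simp: nz_def)
    moreover have "coeff T i \<in> ?B" using T(1) by (auto simp: polys_over_def)
    ultimately obtain a where a: "\<forall>g\<in>Q \<inter> ?B. eval_at a g = 0" "eval_at a (coeff T i) \<noteq> 0"
      using insert.IH[of "coeff T i"] by blast
    have "coeff (map_poly (eval_at a) T) i \<noteq> 0" using a by (simp add: coeff_map_poly)
    then have "map_poly (eval_at a) T \<noteq> 0" by auto
    then obtain r where r: "poly (map_poly (eval_at a) T) r \<noteq> 0"
      using ex_new_if_finite[OF infinite_UNIV_char_0 poly_roots_finite] by blast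
    show ?thesis
    proof (intro exI[of _ "a(v := r)"] conjI ballI)
      fix g assume g: "g \<in> Q \<inter> ?V"
      then obtain G where G: "G \<in> ?P" "poly G ?x = g"
        using polys_in_insert_as_poly[of g v W] by blast
      then have "\<not> nz G" using False g by blast
      then have "map_poly (eval_at a) G = 0"
        using a(1) G(1) by (intro poly_eqI) (auto simp: coeff_map_poly nz_def polys_over_def)
      then show "eval_at (a(v := r)) g = 0"
        using eval_at_poly[OF G(1) insert.hyps(2), of a r] G(2) by simp
    next
      show "eval_at (a(v := r)) t \<noteq> 0"
        using eval_at_poly[OF T(1) insert.hyps(2), of a r] T(2) r by simp
    qed
  next
    case True
    then obtain p where p: "p \<in> ?P" "nz p" "poly p ?x \<in> Q"
      and pmin: "\<And>q. q \<in> ?P \<Longrightarrow> nz q \<Longrightarrow> poly q ?x \<in> Q \<Longrightarrow> degree p \<le> degree q"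
      using ex_has_least_nat[of "\<lambda>p. p \<in> ?P \<and> nz p \<and> poly p ?x \<in> Q" _ degree] by blast
    let ?c = "lead_coeff p"
    have c: "?c \<notin> Q"
      by (rule lead[of p "\<lambda>z. z \<in> Q"]) (use p pmin in \<open>auto intro: idl.subspace_diff[OF Qsub]\<close>)
    \<comment> \<open>The ideal of \<open>t\<close> and \<open>Q\<close> contains an element \<open>l\<close> of the smaller ring outside \<open>Q\<close>: an
        element \<open>e\<close> of minimal degree has degree zero.\<close>
    define C where "C z \<longleftrightarrow> (\<exists>u\<in>?V. z - t * u \<in> Q)" for z
    have C_diff: "C (z - y)" if Cz: "C z" and yQ: "y \<in> Q" for z y
    proof -
      obtain u where u: "u \<in> ?V" "z - t * u \<in> Q" using Cz unfolding C_def by blast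
      have "z - y - t * u = (z - t * u) - y" by simp
      then show ?thesis using u idl.subspace_diff[OF Qsub u(2) yQ] unfolding C_def by metis
    qed
    have C_mult: "C (w * z)" if Cz: "C z" and w: "w \<in> ?V" for z w
    proof -
      obtain u where u: "u \<in> ?V" "z - t * u \<in> Q" using Cz unfolding C_def by blast
      have "w * z - t * (w * u) = w * (z - t * u)"
        by (simp only: right_diff_distrib mult.left_commute)
      then show ?thesis
        using u idl.subspace_scale[OF Qsub u(2), of w] w polys_in_closed(5)
        unfolding C_def by metis
    qed
    have C_Q: "C z" if "z \<in> Q" for z
      unfolding C_def using that polys_in_closed(2) by (intro bexI[of _ 0]) auto
    have "C t"
      unfolding C_def using idl.subspace_0[OF Qsub] polys_in_closed(1)
      by (intro bexI[of _ 1]) auto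
    have "nz T" using eval_Q[of T ?x] T(2) insert.prems(2) by auto
    then obtain e where e: "e \<in> ?P" "nz e" "C (poly e ?x)"
      and emin: "\<And>q. q \<in> ?P \<Longrightarrow> nz q \<Longrightarrow> C (poly q ?x) \<Longrightarrow> degree e \<le> degree q"
      using ex_has_least_nat[of "\<lambda>p. p \<in> ?P \<and> nz p \<and> C (poly p ?x)" T degree] T \<open>C t\<close> by blast
    let ?l = "lead_coeff e"
    have l: "?l \<notin> Q"
      by (rule lead[of e C]) (use e emin C_diff in auto)
    have e0: "e \<noteq> 0" using l idl.subspace_0[OF Qsub] by auto
    have p0: "p \<noteq> 0" using c idl.subspace_0[OF Qsub] by auto
    have small: "\<not> nz r" if "r \<in> ?P" "C (poly r ?x)" "r = 0 \<or> degree r < degree e" for r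
    proof (cases "r = 0")
      case True
      then show ?thesis using idl.subspace_0[OF Qsub] by (simp add: nz_def)
    next
      case False
      then show ?thesis using that emin[of r] leD by blast
    qed
    \<comment> \<open>If \<open>e\<close> were in \<open>Q\<close>, dividing \<open>t\<close> by it would put \<open>t\<close> into \<open>Q\<close> as well.\<close>
    have "poly e ?x \<notin> Q"
    proof
      assume eQ: "poly e ?x \<in> Q"
      obtain N q r where d: "smult (?l ^ N) T = q * e + r" "q \<in> ?P" "r \<in> ?P"
        "r = 0 \<or> degree r < degree e"
        using pseudo_division[OF Bsub T(1) e(1) e0] by metis
      have eq: "?l ^ N * t = poly q ?x * poly e ?x + poly r ?x"
        using arg_cong[OF d(1), of "\<lambda>h. poly h ?x"] T(2) by simp
      then have "poly r ?x = ?l ^ N * t - poly q ?x * poly e ?x" by simp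
      moreover have "?l ^ N \<in> ?V"
        using e(1) polys_in_mono[of W "insert v W"]
        by (intro polys_in_closed(7)) (auto simp: polys_over_def)
      ultimately have "C (poly r ?x)"
        using C_diff[OF C_mult[OF \<open>C t\<close>] idl.subspace_scale[OF Qsub eQ]] by metis
      then have "poly r ?x \<in> Q" using eval_Q small d by blast
      then have "?l ^ N * t \<in> Q"
        unfolding eq by (intro idl.subspace_add[OF Qsub] idl.subspace_scale[OF Qsub] eQ)
      then show False using Qprime Qpow l insert.prems(2) by blast
    qed
    \<comment> \<open>Dividing \<open>p\<close> by \<open>e\<close> gives a quotient whose value is in \<open>Q\<close>, and whose degree is therefore at
        least that of \<open>p\<close>.\<close>
    have "degree e = 0"
    proof -
      obtain N q r where d: "smult (?l ^ N) p = q * e + r" "q \<in> ?P" "r \<in> ?P"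
        "r = 0 \<or> degree r < degree e" "q = 0 \<or> degree q + degree e \<le> degree p"
        using pseudo_division[OF Bsub p(1) e(1) e0] by metis
      have eq: "?l ^ N * poly p ?x = poly q ?x * poly e ?x + poly r ?x"
        using arg_cong[OF d(1), of "\<lambda>h. poly h ?x"] by simp
      have "C (poly r ?x)"
      proof -
        have "poly r ?x = ?l ^ N * poly p ?x - poly q ?x * poly e ?x" using eq by simp
        moreover have "C (poly q ?x * poly e ?x)"
          by (intro C_mult e poly_in_polys_in_insert d)
        then have "C (- 1 * (poly q ?x * poly e ?x))"
          by (rule C_mult) (metis mconst_in_polys_in single_uminus single_one)
        ultimately show ?thesis
          using C_diff[of "- 1 * (poly q ?x * poly e ?x)" "- (?l ^ N * poly p ?x)"]
            idl.subspace_scale[OF Qsub p(3), of "- (?l ^ N)"] by simp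
      qed
      then have r: "\<not> nz r" using small d by blast
      then have "poly q ?x * poly e ?x \<in> Q"
      proof -
        have "poly q ?x * poly e ?x = ?l ^ N * poly p ?x - poly r ?x" using eq by simp
        then show ?thesis
          using idl.subspace_diff[OF Qsub idl.subspace_scale[OF Qsub p(3)] eval_Q[OF r]] by metis
      qed
      then have qQ: "poly q ?x \<in> Q" using Qprime \<open>poly e ?x \<notin> Q\<close> by blast
      have "nz q"
      proof (rule ccontr)
        assume "\<not> nz q"
        then have "coeff (q * e) i \<in> Q" for i
          unfolding coeff_mult nz_def
          by (auto intro!: idl.subspace_sum[OF Qsub] subspace_mult_right[OF Qsub])
        then have "coeff (q * e + r) (degree p) \<in> Q"
          using r by (auto simp: nz_def intro!: idl.subspace_add[OF Qsub])
        then have "?l ^ N * ?c \<in> Q" by (simp flip: d(1))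
        then show False using Qprime Qpow l c by blast
      qed
      then have "degree p \<le> degree q" using pmin d(2) qQ by blast
      moreover have "q \<noteq> 0" using \<open>nz q\<close> idl.subspace_0[OF Qsub] by (auto simp: nz_def)
      ultimately show ?thesis using d(5) by linarith
    qed
    then have "poly e ?x = ?l" by (metis degree_0_id lead_coeff_pCons(2) poly_const_conv degree_eq_zeroE)
    then obtain u where u: "u \<in> ?V" "?l - t * u \<in> Q" using e(3) by (auto simp: C_def)
    have B: "?l \<in> ?B" "?c \<in> ?B" using e(1) p(1) by (auto simp: polys_over_def)
    then obtain a where a: "\<forall>g\<in>Q \<inter> ?B. eval_at a g = 0" "eval_at a (?c * ?l) \<noteq> 0"
      using insert.IH[of "?c * ?l"] Qprime c l subring_setD(5)[OF Bsub] by blast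
    \<comment> \<open>The new coordinate is a root of \<open>p\<close> specialised at \<open>a\<close>; up to a power of \<open>?c\<close>, which
        does not vanish at \<open>a\<close>, every element of \<open>Q\<close> is a multiple of \<open>p\<close> plus a polynomial
        with coefficients in \<open>Q\<close>.\<close>
    let ?p = "map_poly (eval_at a) p"
    have "degree p \<noteq> 0"
    proof
      assume "degree p = 0"
      then have "poly p ?x = ?c" by (metis lead_coeff_pCons(2) poly_const_conv degree_eq_zeroE)
      then show False using p(3) c by simp
    qed
    moreover have "degree p \<le> degree ?p"
      using a(2) by (intro le_degree) (simp add: coeff_map_poly)
    ultimately obtain r where r: "poly ?p r = 0"
      using alg_closed_imp_poly_has_root[of ?p] by auto
    have same: "eval_at (a(v := r)) b = eval_at a b" if "b \<in> ?B" for b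
      by (rule eval_at_cong[OF that]) (use insert.hyps(2) in auto)
    have zero: "eval_at (a(v := r)) g = 0" if g: "g \<in> Q" "g \<in> ?V" for g
    proof -
      obtain G where G: "G \<in> ?P" "poly G ?x = g"
        using polys_in_insert_as_poly[OF g(2)] by blast
      obtain N q s where d: "smult (?c ^ N) G = q * p + s" "q \<in> ?P" "s \<in> ?P"
        "s = 0 \<or> degree s < degree p"
        using pseudo_division[OF Bsub G(1) p(1) p0] by metis
      have eq: "?c ^ N * g = poly q ?x * poly p ?x + poly s ?x"
        using arg_cong[OF d(1), of "\<lambda>h. poly h ?x"] G(2) by simp
      then have "poly s ?x = ?c ^ N * g - poly q ?x * poly p ?x" by simp
      then have "poly s ?x \<in> Q"
        using idl.subspace_diff[OF Qsub idl.subspace_scale[OF Qsub g(1)] idl.subspace_scale[OF Qsub p(3)]]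
        by metis
      then have "\<not> nz s"
        using pmin[of s] d(3,4) idl.subspace_0[OF Qsub] leD[of "degree p" "degree s"]
        by (cases "s = 0") (auto simp: nz_def)
      then have "map_poly (eval_at a) s = 0"
        using a(1) d(3) by (intro poly_eqI) (auto simp: coeff_map_poly nz_def polys_over_def)
      then have "eval_at (a(v := r)) (poly s ?x) = 0"
        using eval_at_poly[OF d(3) insert.hyps(2), of a r] by simp
      moreover have "eval_at (a(v := r)) (poly p ?x) = 0"
        using eval_at_poly[OF p(1) insert.hyps(2), of a r] r by simp
      moreover have "eval_at (a(v := r)) ?c \<noteq> 0"
        using same[OF B(2)] a(2) by simp
      ultimately show ?thesis
        using arg_cong[OF eq, of "eval_at (a(v := r))"] by simp
    qed
    have "eval_at (a(v := r)) t \<noteq> 0"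
    proof
      assume "eval_at (a(v := r)) t = 0"
      moreover have "?l - t * u \<in> ?V"
        using u(1) insert.prems(1) B(1) polys_in_mono[of W "insert v W"]
        by (intro polys_in_closed(4,5)) auto
      ultimately have "eval_at (a(v := r)) ?l = 0"
        using zero[OF u(2)] by simp
      then show False
        using same[OF B(1)] a(2) by simp
    qed
    then show ?thesis using zero by blast
  qed
qed

lemma prime_ideal_has_zero:
  fixes Q :: "('v::finite, 'k::{alg_closed_field, field_char_0}) mpoly set"
  assumes "prime_ideal Q" "t \<notin> Q"
  obtains a where "a \<in> zero_locus Q" "eval_at a t \<noteq> 0"
  using prime_ideal_has_zero_finite[OF assms(1), of UNIV t] assms(2) that
  by (auto simp: zero_locus_def)

text \<open>An ideal that is maximal among those containing no power of \<open>g\<close> is prime.\<close>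

lemma exists_prime_ideal_avoiding:
  fixes I :: "'a::comm_ring_1 set"
  assumes I: "idl.subspace I" and g: "\<And>n. g ^ n \<notin> I"
  obtains Q where "prime_ideal Q" "I \<subseteq> Q" "g \<notin> Q"
proof -
  define A where "A = {K. idl.subspace K \<and> I \<subseteq> K \<and> (\<forall>n. g ^ n \<notin> K)}"
  have "\<exists>Q\<in>A. \<forall>K\<in>A. Q \<subseteq> K \<longrightarrow> K = Q"
  proof (rule subset_Zorn_nonempty)
    show "A \<noteq> {}" using assms by (auto simp: A_def)
    fix C assume C: "C \<noteq> {}" "subset.chain A C"
    have CA: "K \<in> C \<Longrightarrow> K \<in> A" for K using C by (auto simp: subset.chain_def)
    have "idl.subspace (\<Union>C)"
    proof (rule idl.subspaceI)
      show "0 \<in> \<Union>C" using C(1) CA by (force simp: A_def idl.subspace_0)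
      fix x y assume "x \<in> \<Union>C" "y \<in> \<Union>C"
      then obtain K L where KL: "K \<in> C" "L \<in> C" "x \<in> K" "y \<in> L" by auto
      then have "K \<subseteq> L \<or> L \<subseteq> K" using C(2) by (auto simp: subset_chain_def)
      then have "x + y \<in> K \<or> x + y \<in> L"
        using KL CA by (auto simp: A_def intro!: idl.subspace_add)
      then show "x + y \<in> \<Union>C" using KL by auto
    next
      fix c x assume "x \<in> \<Union>C"
      then obtain K where K: "K \<in> C" "x \<in> K" by auto
      then have "c * x \<in> K" using CA[OF K(1)] by (auto simp: A_def intro: idl.subspace_scale)
      then show "c * x \<in> \<Union>C" using K(1) by auto
    qed
    then show "\<Union>C \<in> A" using C(1) CA by (force simp: A_def)
  qed
  then obtain Q where Q: "Q \<in> A" "\<And>K. K \<in> A \<Longrightarrow> Q \<subseteq> K \<Longrightarrow> K = Q" by blast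
  have Qs: "idl.subspace Q" using Q by (auto simp: A_def)
  have pow: "\<exists>n c. g ^ n - c * x \<in> Q" if "x \<notin> Q" for x
  proof (rule ccontr)
    assume no: "\<nexists>n c. g ^ n - c * x \<in> Q"
    have sub: "Q \<subseteq> idl.span (insert x Q)" by (meson idl.span_superset subset_insertI subset_trans)
    moreover have "g ^ n \<notin> idl.span (insert x Q)" for n
      unfolding idl.span_breakdown_eq idl.span_eq_iff[THEN iffD2, OF Qs] using no by blast
    ultimately have "idl.span (insert x Q) \<in> A" using Q(1) by (auto simp: A_def)
    then have "idl.span (insert x Q) = Q" using Q(2) sub by blast
    then show False using that idl.span_base[of x "insert x Q"] by auto
  qed
  have "x \<in> Q \<or> y \<in> Q" if xy: "x * y \<in> Q" for x y
  proof (rule ccontr)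
    assume "\<not> (x \<in> Q \<or> y \<in> Q)"
    then obtain n c m d where cd: "g ^ n - c * x \<in> Q" "g ^ m - d * y \<in> Q" using pow by blast
    have "g ^ (n + m) = (g ^ n - c * x) * g ^ m + c * x * (g ^ m - d * y) + (c * d) * (x * y)"
      by (simp add: algebra_simps power_add)
    also have "\<dots> \<in> Q"
      by (intro idl.subspace_add[OF Qs] idl.subspace_scale[OF Qs cd(2)] idl.subspace_scale[OF Qs xy]
        subspace_mult_right[OF Qs cd(1)])
    finally show False using Q(1) by (auto simp: A_def)
  qed
  moreover have "1 \<notin> Q" "g \<notin> Q" using Q(1) by (auto simp: A_def dest: spec[of _ 0] spec[of _ 1])
  ultimately show thesis using that[of Q] Q(1) Qs by (auto simp: prime_ideal_def A_def)
qed

text \<open>If no power of \<open>g\<close> lay in \<open>I\<close>, a prime ideal containing \<open>I\<close> but not \<open>g\<close> would have a zero at which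
  \<open>g\<close> does not vanish.\<close>

theorem nullstellensatz:
  fixes I :: "('v::finite, 'k::{alg_closed_field, field_char_0}) mpoly set"
  assumes "idl.subspace I" "\<And>a. a \<in> zero_locus I \<Longrightarrow> eval_at a g = 0"
  obtains n where "g ^ n \<in> I"
proof (rule ccontr)
  assume "\<not> thesis"
  then have "g ^ n \<notin> I" for n using that by blast
  then obtain Q where Q: "prime_ideal Q" "I \<subseteq> Q" "g \<notin> Q"
    using exists_prime_ideal_avoiding[OF assms(1)] by blast
  then obtain a where "a \<in> zero_locus Q" "eval_at a g \<noteq> 0"
    using prime_ideal_has_zero by blast
  then show False using assms(2) Q(2) by (force simp: zero_locus_def)
qed

corollary proper_ideal_has_zero:
  fixes I :: "('v::finite, 'k::{alg_closed_field, field_char_0}) mpoly set"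
  assumes "idl.subspace I" "zero_locus I = {}"
  shows "1 \<in> I"
  using nullstellensatz[OF assms(1), of 1] assms(2) by auto

section \<open>Hilbert's basis theorem\<close>

definition lin_combs :: "'a::comm_ring_1 set \<Rightarrow> (nat \<Rightarrow> 'a) \<Rightarrow> nat \<Rightarrow> 'a set" where
  "lin_combs B a n = {\<Sum>i<n. b i * a i | b. \<forall>i. b i \<in> B}"

text \<open>Finite generation of ideals is encoded by sequences: in every sequence some
  element is a combination of its predecessors.\<close>

definition noetherian_on :: "'a::comm_ring_1 set \<Rightarrow> bool" where
  "noetherian_on B \<longleftrightarrow> (\<forall>a. range a \<subseteq> B \<longrightarrow> (\<exists>n. a n \<in> lin_combs B a n))"

lemma lin_combs_add:
  assumes "subring_set B" "x \<in> lin_combs B a n" "y \<in> lin_combs B a n"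
  shows "x + y \<in> lin_combs B a n"
proof -
  obtain b c where "\<forall>i. b i \<in> B" "\<forall>i. c i \<in> B" "x = (\<Sum>i<n. b i * a i)" "y = (\<Sum>i<n. c i * a i)"
    using assms by (auto simp: lin_combs_def)
  then show ?thesis
    using assms(1) unfolding lin_combs_def
    by (intro CollectI exI[of _ "\<lambda>i. b i + c i"]) (auto simp: subring_setD sum.distrib distrib_right)
qed

lemma lin_combs_scale:
  assumes "subring_set B" "x \<in> lin_combs B a n" "c \<in> B"
  shows "c * x \<in> lin_combs B a n"
proof -
  obtain b where "\<forall>i. b i \<in> B" "x = (\<Sum>i<n. b i * a i)"
    using assms by (auto simp: lin_combs_def)
  then show ?thesis
    using assms unfolding lin_combs_def
    by (intro CollectI exI[of _ "\<lambda>i. c * b i"]) (auto simp: subring_setD sum_distrib_left mult.assoc)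
qed

lemma lin_combs_zero: "subring_set B \<Longrightarrow> 0 \<in> lin_combs B a n"
  unfolding lin_combs_def by (intro CollectI exI[of _ "\<lambda>_. 0"]) (auto simp: subring_setD)

lemma lin_combs_sum:
  "subring_set B \<Longrightarrow> (\<And>i. i \<in> A \<Longrightarrow> g i \<in> lin_combs B a n) \<Longrightarrow> sum g A \<in> lin_combs B a n"
  by (induction A rule: infinite_finite_induct) (auto simp: lin_combs_zero intro: lin_combs_add)

lemma lin_combs_base:
  assumes "subring_set B" "i < n"
  shows "a i \<in> lin_combs B a n"
proof -
  have "(\<Sum>j<n. (if j = i then 1 else 0) * a j) = (\<Sum>j<n. if j = i then a j else 0)"
    by (intro sum.cong) auto
  also have "\<dots> = a i" using assms by simp
  finally show ?thesis
    unfolding lin_combs_def using assms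
    by (intro CollectI exI[of _ "\<lambda>j. if j = i then 1 else 0"]) (auto simp: subring_setD)
qed

lemma lin_combs_subset:
  assumes "subring_set B" "\<And>i. i < k \<Longrightarrow> f i \<in> lin_combs B a n"
  shows "lin_combs B f k \<subseteq> lin_combs B a n"
proof
  fix x assume "x \<in> lin_combs B f k"
  then obtain b where "\<forall>i. b i \<in> B" "x = (\<Sum>i<k. b i * f i)" by (auto simp: lin_combs_def)
  then show "x \<in> lin_combs B a n"
    using assms by (auto intro!: lin_combs_sum lin_combs_scale)
qed

lemma lin_combs_mono: "subring_set B \<Longrightarrow> m \<le> n \<Longrightarrow> lin_combs B a m \<subseteq> lin_combs B a n"
  by (rule lin_combs_subset) (auto intro: lin_combs_base)

lemma subring_set_polys_over:
  assumes "subring_set B"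
  shows "subring_set (polys_over B)"
proof -
  have "1 \<in> polys_over B"
    using polys_over_monom[OF assms, of 1 0] subring_setD(1)[OF assms] by simp
  then show ?thesis
    unfolding subring_set_def by (intro conjI ballI polys_over_closed[OF assms])
qed

text \<open>The classical argument: from an infinite ascending chain one picks polynomials of minimal
  degree outside the ideal of the previous ones; a relation between their leading coefficients
  produces one of smaller degree.\<close>

theorem noetherian_on_polys_over:
  fixes B :: "'a::comm_ring_1 set"
  assumes B: "subring_set B" and N: "noetherian_on B"
  shows "noetherian_on (polys_over B)"
  unfolding noetherian_on_def
proof (intro allI impI)
  fix p :: "nat \<Rightarrow> 'a poly" assume p: "range p \<subseteq> polys_over B"
  note PB = subring_set_polys_over[OF B]
  let ?L = "lin_combs (polys_over B)"
  show "\<exists>n. p n \<in> ?L p n"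
  proof (rule ccontr)
    assume no: "\<nexists>n. p n \<in> ?L p n"
    define A where "A = (\<Union>n. ?L p n)"
    have A_PB: "A \<subseteq> polys_over B"
      using p PB by (auto simp: A_def lin_combs_def intro!: subring_set_sum subring_setD)
    have A_closed: "x + c * y \<in> A" if xy: "x \<in> A" "y \<in> A" and c: "c \<in> polys_over B" for x y c
    proof -
      obtain m n where mn: "x \<in> ?L p m" "y \<in> ?L p n" using xy by (auto simp: A_def)
      have "x \<in> ?L p (max m n)" "y \<in> ?L p (max m n)"
        using mn lin_combs_mono[OF PB, of _ "max m n" p] by (meson max.cobounded1 max.cobounded2 subsetD)+
      then have "x + c * y \<in> ?L p (max m n)" using c PB by (intro lin_combs_add lin_combs_scale)
      then show ?thesis by (auto simp: A_def)
    qed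
    have new: "\<exists>x. x \<in> A - ?L f k" if f: "\<And>i. i < k \<Longrightarrow> f i \<in> A" for f k
    proof -
      obtain n where n: "\<And>i. i < k \<Longrightarrow> f i \<in> ?L p (n i)" 
      proof -
        have "\<forall>i. \<exists>m. i < k \<longrightarrow> f i \<in> ?L p m" using f by (auto simp: A_def)
        then show ?thesis using that by metis
      qed
      let ?N = "Max (n ` {..<k})"
      have "f i \<in> ?L p ?N" if "i < k" for i
        using n[OF that] lin_combs_mono[OF PB, of "n i" ?N p] that by auto
      then have "?L f k \<subseteq> ?L p ?N" by (intro lin_combs_subset PB) auto
      moreover have "p ?N \<in> A"
        using lin_combs_base[OF PB, of ?N "Suc ?N" p] by (auto simp: A_def)
      ultimately show ?thesis using no by blast
    qed
    \<comment> \<open>The sequence \<open>f\<close> is defined by course-of-values recursion; \<open>F k\<close> is the list of its first \<open>k\<close> members.\<close>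
    define pick where "pick l = (ARG_MIN degree x. x \<in> A - ?L (nth l) (length l))" for l
    define F where "F = rec_nat [] (\<lambda>_ l. l @ [pick l])"
    define f where "f k = pick (F k)" for k
    have F_rec: "F 0 = []" "F (Suc k) = F k @ [f k]" for k
      by (simp_all add: F_def f_def)
    have F: "F k = map f [0..<k]" for k
      by (induction k) (simp_all add: F_rec)
    have L_F: "?L (nth (F k)) (length (F k)) = ?L f k" for k
      unfolding lin_combs_def F by simp
    have f: "f k \<in> A - ?L f k \<and> (\<forall>x \<in> A - ?L f k. degree (f k) \<le> degree x)" for k
    proof (induction k rule: less_induct)
      case (less k)
      obtain x where "x \<in> A - ?L f k" using new[of k f] less by blast
      then show ?case
        using arg_min_nat_lemma[of "\<lambda>x. x \<in> A - ?L f k" x degree]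
        unfolding f_def[of k] pick_def L_F[of k] by blast
    qed
    have mono: "degree (f i) \<le> degree (f k)" if "i \<le> k" for i k
      using f[of i] f[of k] lin_combs_mono[OF PB that, of f] by blast
    have fB: "f k \<in> polys_over B" for k using f A_PB by blast
    then have "range (\<lambda>k. lead_coeff (f k)) \<subseteq> B" by (auto simp: polys_over_def)
    then obtain k where "lead_coeff (f k) \<in> lin_combs B (\<lambda>k. lead_coeff (f k)) k"
      using N unfolding noetherian_on_def by blast
    then obtain b where b: "\<forall>i. b i \<in> B" "lead_coeff (f k) = (\<Sum>i<k. b i * lead_coeff (f i))"
      by (auto simp: lin_combs_def)
    define s where "s = (\<Sum>i<k. monom (b i) (degree (f k) - degree (f i)) * f i)"
    have "s \<in> ?L f k"
      unfolding s_def using PB B b by (intro lin_combs_sum lin_combs_scale lin_combs_base polys_over_monom) auto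
    have "s \<in> A"
    proof -
      have "(\<Sum>i\<in>S. monom (b i) (degree (f k) - degree (f i)) * f i) \<in> A" if "finite S" for S
        using that
      proof (induction S rule: finite_induct)
        case empty
        show ?case using lin_combs_zero[OF PB] by (auto simp: A_def)
      next
        case (insert i S)
        then show ?case
          using A_closed[OF insert.IH, of "f i"] f[of i] polys_over_monom[OF B, of "b i"] b(1)
          by (simp add: add.commute)
      qed
      then show ?thesis by (simp add: s_def)
    qed
    define g where "g = f k - s"
    have "g \<in> A"
      using A_closed[OF _ \<open>s \<in> A\<close>, of "f k" "- 1"] f[of k] subring_setD(1,6)[OF PB] by (simp add: g_def)
    moreover have "g \<notin> ?L f k"
    proof
      assume "g \<in> ?L f k"
      then have "g + s \<in> ?L f k" using \<open>s \<in> ?L f k\<close> by (rule lin_combs_add[OF PB])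
      then show False using f[of k] by (simp add: g_def)
    qed
    ultimately have "degree (f k) \<le> degree g" using f[of k] by blast
    moreover have "degree s \<le> degree (f k)"
      unfolding s_def
    proof (rule degree_sum_le)
      fix i assume "i \<in> {..<k}"
      then have "degree (f i) \<le> degree (f k)" using mono by simp
      then show "degree (monom (b i) (degree (f k) - degree (f i)) * f i) \<le> degree (f k)"
        using degree_mult_le[of "monom (b i) (degree (f k) - degree (f i))" "f i"]
          degree_monom_le[of "b i" "degree (f k) - degree (f i)"] by linarith
    qed simp
    then have "degree g \<le> degree (f k)" unfolding g_def by (intro degree_diff_le) auto
    moreover have "coeff s (degree (f k)) = (\<Sum>i<k. b i * lead_coeff (f i))"
      unfolding s_def coeff_sum
    proof (rule sum.cong)
      fix i assume "i \<in> {..<k}"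
      then have "degree (f i) \<le> degree (f k)" using mono by simp
      then show "coeff (monom (b i) (degree (f k) - degree (f i)) * f i) (degree (f k)) = b i * lead_coeff (f i)"
        by (simp add: coeff_monom_mult)
    qed simp
    then have "coeff g (degree (f k)) = 0" using b(2) by (simp add: g_def)
    ultimately have "g = 0" by (metis le_antisym leading_coeff_0_iff)
    then show False using \<open>g \<notin> ?L f k\<close> lin_combs_zero[OF PB] by simp
  qed
qed

lemma noetherian_on_image:
  fixes h :: "'a::comm_ring_1 \<Rightarrow> 'b::comm_ring_1"
  assumes h: "coeff_hom h" and N: "noetherian_on B"
  shows "noetherian_on (h ` B)"
  unfolding noetherian_on_def
proof (intro allI impI)
  fix z :: "nat \<Rightarrow> 'b" assume "range z \<subseteq> h ` B"
  then have "\<forall>n. \<exists>a. a \<in> B \<and> z n = h a" by auto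
  then obtain a where a: "\<And>n. a n \<in> B" "\<And>n. z n = h (a n)" by metis
  then have "range a \<subseteq> B" by auto
  then obtain n where "a n \<in> lin_combs B a n" using N unfolding noetherian_on_def by blast
  then obtain b where "\<forall>i. b i \<in> B" "a n = (\<Sum>i<n. b i * a i)" by (auto simp: lin_combs_def)
  then show "\<exists>n. z n \<in> lin_combs (h ` B) z n"
    unfolding lin_combs_def
    by (intro exI[of _ n] CollectI exI[of _ "\<lambda>i. h (b i)"])
      (auto simp: a(2) coeff_hom.hom_sum[OF h] coeff_hom.hom_mult[OF h])
qed

lemma coeff_hom_poly: "coeff_hom (\<lambda>p. poly p x)"
  by unfold_locales auto

theorem noetherian_on_polys_in:
  assumes "finite W"
  shows "noetherian_on (polys_in W :: ('v, 'k::field) mpoly set)"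
  using assms
proof (induction W rule: finite_induct)
  case empty
  have K: "polys_in {} = range (mconst :: 'k \<Rightarrow> ('v, 'k) mpoly)"
  proof (intro equalityI subsetI)
    fix g :: "('v, 'k) mpoly" assume g: "g \<in> polys_in {}"
    have "g = mconst (lookup g 0)"
      using g by (intro eq_mconst_if_keys) (auto simp: polys_in_def)
    then show "g \<in> range mconst" by blast
  qed (auto simp: mconst_in_polys_in)
  have "noetherian_on (UNIV :: 'k set)"
    unfolding noetherian_on_def
  proof (intro allI impI)
    fix a :: "nat \<Rightarrow> 'k"
    show "\<exists>n. a n \<in> lin_combs UNIV a n"
    proof (cases "a 0 = 0")
      case True
      then show ?thesis by (intro exI[of _ 0]) (auto simp: lin_combs_def)
    next
      case False
      then show ?thesis
        unfolding lin_combs_def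
        by (intro exI[of _ 1] CollectI exI[of _ "\<lambda>_. a 1 / a 0"]) (simp add: One_nat_def)
    qed
  qed
  then show ?case unfolding K by (rule noetherian_on_image[OF coeff_hom_mconst])
next
  case (insert v W)
  have "polys_in (insert v W) = (\<lambda>P. poly P (mvar v)) ` polys_over (polys_in W :: ('v, 'k) mpoly set)"
  proof (intro equalityI subsetI)
    fix g :: "('v, 'k) mpoly" assume "g \<in> polys_in (insert v W)"
    then show "g \<in> (\<lambda>P. poly P (mvar v)) ` polys_over (polys_in W)"
      by (rule polys_in_insert_as_poly) blast
  qed (use poly_in_polys_in_insert in \<open>auto simp only: image_iff\<close>)
  then show ?case
    using noetherian_on_image[OF coeff_hom_poly noetherian_on_polys_over[OF subring_set_polys_in insert.IH]]
    by simp
qed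

lemma wf_ideals:
  assumes "noetherian_on (UNIV :: 'a::comm_ring_1 set)"
  shows "wf {(K, L). idl.subspace K \<and> idl.subspace L \<and> L \<subset> (K :: 'a set)}"
  unfolding wf_iff_no_infinite_down_chain
proof (intro notI, elim exE)
  fix Q :: "nat \<Rightarrow> 'a set"
  assume Q: "\<forall>i. (Q (Suc i), Q i) \<in> {(K, L). idl.subspace K \<and> idl.subspace L \<and> L \<subset> K}"
  then have "\<forall>i. \<exists>a. a \<in> Q (Suc i) - Q i" by blast
  then obtain a where a: "\<And>i. a i \<in> Q (Suc i) - Q i" by metis
  have "range a \<subseteq> UNIV" by simp
  then obtain n where "a n \<in> lin_combs UNIV a n" using assms unfolding noetherian_on_def by blast
  then obtain b where b: "a n = (\<Sum>i<n. b i * a i)" by (auto simp: lin_combs_def)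
  have mono: "Q i \<subseteq> Q j" if "i \<le> j" for i j
    using that by (rule lift_Suc_mono_le[rotated]) (use Q in blast)
  have "a i \<in> Q n" if "i < n" for i using a[of i] mono[of "Suc i" n] that by auto
  then have "a n \<in> Q n" unfolding b using Q by (intro idl.subspace_sum idl.subspace_scale) auto
  then show False using a by blast
qed

lemma maximal_ideal_in_family:
  assumes N: "noetherian_on (UNIV :: 'a::comm_ring_1 set)"
    and "A \<noteq> {}" "\<And>K. K \<in> A \<Longrightarrow> idl.subspace (K :: 'a set)"
  obtains K where "K \<in> A" "\<And>L. L \<in> A \<Longrightarrow> K \<subseteq> L \<Longrightarrow> L = K"
proof -
  obtain K0 where "K0 \<in> A" using assms(2) by blast
  from wfE_min[OF wf_ideals[OF N] this]
  obtain K where K: "K \<in> A" "\<And>L. (L, K) \<in> {(K, L). idl.subspace K \<and> idl.subspace L \<and> L \<subset> (K :: 'a set)} \<Longrightarrow> L \<notin> A"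
    by blast
  have "L = K" if L: "L \<in> A" "K \<subseteq> L" for L
    using K(2)[of L] assms(3)[OF K(1)] assms(3)[OF L(1)] L by auto
  then show thesis using that K(1) by blast
qed

lemma ideal_finitely_generated:
  assumes N: "noetherian_on (UNIV :: 'a::comm_ring_1 set)" and K: "idl.subspace (K :: 'a set)"
  obtains S where "finite S" "K = idl.span S"
proof -
  let ?A = "idl.span ` {S. finite S \<and> S \<subseteq> K}"
  obtain L where L: "L \<in> ?A" "\<And>L'. L' \<in> ?A \<Longrightarrow> L \<subseteq> L' \<Longrightarrow> L' = L"
    by (rule maximal_ideal_in_family[OF N, of ?A]) auto
  then obtain S where S: "finite S" "S \<subseteq> K" "L = idl.span S" by auto
  have "x \<in> L" if "x \<in> K" for x
  proof -
    have "idl.span (insert x S) = L"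
      using S that idl.span_mono[of S "insert x S"] by (intro L(2)) auto
    then show ?thesis using idl.span_base[of x "insert x S"] by auto
  qed
  then show thesis using that S idl.span_minimal[OF S(2) K] by blast
qed

section \<open>Associated primes and avoidance\<close>

definition colon :: "'a::comm_ring_1 set \<Rightarrow> 'a \<Rightarrow> 'a set" where
  "colon Q a = {r. r * a \<in> Q}"

definition associated_primes :: "'a::comm_ring_1 set \<Rightarrow> 'a set set" where
  "associated_primes Q = {P. prime_ideal P \<and> (\<exists>a. P = colon Q a)}"

definition nonzerodivisor_mod :: "'a::comm_ring_1 set \<Rightarrow> 'a \<Rightarrow> bool" where
  "nonzerodivisor_mod Q z \<longleftrightarrow> (\<forall>y. z * y \<in> Q \<longrightarrow> y \<in> Q)"

lemma subspace_colon: "idl.subspace Q \<Longrightarrow> idl.subspace (colon Q a)"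
  by (rule idl.subspaceI)
    (auto simp: colon_def distrib_right mult.assoc idl.subspace_0 intro: idl.subspace_add idl.subspace_scale)

text \<open>A colon ideal \<open>colon Q a\<close> that is maximal among those with \<open>a \<notin> Q\<close> and \<open>z \<in> colon Q a\<close> is prime: for
  \<open>y \<notin> colon Q a\<close> the larger ideal \<open>colon Q (y * a)\<close> belongs to the same family.\<close>

lemma zerodivisor_in_associated_prime:
  assumes N: "noetherian_on (UNIV :: 'a::comm_ring_1 set)" and Q: "idl.subspace (Q :: 'a set)"
    and z: "\<not> nonzerodivisor_mod Q z"
  obtains P where "P \<in> associated_primes Q" "z \<in> P"
proof -
  let ?A = "colon Q ` {a. a \<notin> Q \<and> z * a \<in> Q}"
  have "?A \<noteq> {}" using z by (auto simp: nonzerodivisor_mod_def)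
  then obtain P where P: "P \<in> ?A" "\<And>L. L \<in> ?A \<Longrightarrow> P \<subseteq> L \<Longrightarrow> L = P"
    using maximal_ideal_in_family[OF N, of ?A] subspace_colon[OF Q] by blast
  then obtain a where a: "a \<notin> Q" "z * a \<in> Q" "P = colon Q a" by auto
  have "x \<in> P \<or> y \<in> P" if xy: "x * y \<in> P" for x y
  proof (rule ccontr)
    assume no: "\<not> (x \<in> P \<or> y \<in> P)"
    then have "y * a \<notin> Q" by (simp add: a(3) colon_def)
    moreover have "z * (y * a) \<in> Q"
      using idl.subspace_scale[OF Q a(2), of y] by (simp add: mult.left_commute)
    ultimately have "colon Q (y * a) \<in> ?A" by auto
    moreover have "P \<subseteq> colon Q (y * a)"
    proof
      fix r assume "r \<in> P"
      then have "y * (r * a) \<in> Q" using idl.subspace_scale[OF Q] by (simp add: a(3) colon_def)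
      then show "r \<in> colon Q (y * a)" by (simp add: colon_def mult.left_commute)
    qed
    ultimately have "colon Q (y * a) = P" by (rule P(2))
    then show False using xy no by (auto simp: a(3) colon_def mult.assoc)
  qed
  then have "P \<in> associated_primes Q"
    using a subspace_colon[OF Q] by (auto simp: associated_primes_def prime_ideal_def colon_def)
  then show thesis using that a by (auto simp: colon_def)
qed

text \<open>Noetherian induction, one associated prime at a time: if \<open>P = colon Q a\<close>, then every other
  associated prime of \<open>Q\<close> is one of \<open>Q + (a)\<close>.\<close>

lemma finite_associated_primes:
  assumes N: "noetherian_on (UNIV :: 'a::comm_ring_1 set)" and Q: "idl.subspace (Q :: 'a set)"
  shows "finite (associated_primes Q)"
  using wf_ideals[OF N] Q
proof (induction Q rule: wf_induct_rule)
  case (less Q)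
  show ?case
  proof (cases "1 \<in> Q")
    case True
    then have "Q = UNIV" by (rule subspace_eq_UNIV[OF less.prems])
    then have "associated_primes Q = {}"
      by (auto simp: associated_primes_def colon_def prime_ideal_def)
    then show ?thesis by simp
  next
    case False
    then have "\<not> nonzerodivisor_mod Q 0"
      using idl.subspace_0[OF less.prems] by (auto simp: nonzerodivisor_mod_def)
    then obtain P where "P \<in> associated_primes Q"
      using zerodivisor_in_associated_prime[OF N less.prems] by blast
    then obtain a where P: "prime_ideal P" "P = colon Q a" by (auto simp: associated_primes_def)
    let ?Q = "idl.span (insert a Q)"
    have "a \<notin> Q" using P by (auto simp: prime_ideal_def colon_def)
    then have "Q \<subset> ?Q" by (metis idl.span_superset insert_subset psubsetI)
    then have IH: "finite (associated_primes ?Q)" using less by auto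
    have spanQ: "idl.span Q = Q" using less.prems by (simp only: idl.span_eq_iff)
    have "P' = P \<or> P' \<in> associated_primes ?Q" if "P' \<in> associated_primes Q" for P'
    proof -
      obtain b where P': "prime_ideal P'" "P' = colon Q b"
        using \<open>P' \<in> associated_primes Q\<close> by (auto simp: associated_primes_def)
      show ?thesis
      proof (cases "\<exists>c. c \<notin> P' \<and> c * b \<in> ?Q")
        case True
        then obtain c e where c: "c \<notin> P'" and e: "c * b - e * a \<in> Q"
          unfolding idl.span_breakdown_eq spanQ by blast
        have iff: "r * (c * b) \<in> Q \<longleftrightarrow> r * (e * a) \<in> Q" for r
          using idl.subspace_scale[OF less.prems e, of r]
          by (metis (no_types, opaque_lifting) add_diff_cancel_left' diff_add_cancel idl.subspace_add
            idl.subspace_diff less.prems right_diff_distrib)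
        have "r \<in> P' \<longleftrightarrow> r * (c * b) \<in> Q" for r
          using prime_idealD(3)[OF P'(1), of r c] c subspace_mult_right[OF prime_idealD(1)[OF P'(1)]]
          by (auto simp: P'(2) colon_def mult.assoc)
        moreover have "e \<notin> P"
        proof
          assume "e \<in> P"
          then have "c * b \<in> Q" using iff[of 1] by (simp add: P(2) colon_def)
          then show False using c by (simp add: P'(2) colon_def)
        qed
        then have "r \<in> P \<longleftrightarrow> r * (e * a) \<in> Q" for r
          using prime_idealD(3)[OF P(1), of r e] subspace_mult_right[OF prime_idealD(1)[OF P(1)]]
          by (auto simp: P(2) colon_def mult.assoc)
        ultimately show ?thesis using iff by auto
      next
        case False
        then have "P' = colon ?Q b"
          using idl.span_superset[of "insert a Q"] by (auto simp: P'(2) colon_def)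
        then show ?thesis using P'(1) by (auto simp: associated_primes_def)
      qed
    qed
    then have "associated_primes Q \<subseteq> insert P (associated_primes ?Q)" by blast
    then show ?thesis using IH by (meson finite_insert finite_subset)
  qed
qed

text \<open>A polynomial over a domain with infinitely many roots vanishes; here the domain is the quotient by \<open>P\<close>,
  and the positive integers outside \<open>P\<close> keep the points of evaluation distinct.\<close>

lemma coeffs_in_prime_if_infinitely_many_values:
  assumes P: "prime_ideal P" and unit: "\<And>n::nat. n > 0 \<Longrightarrow> of_nat n \<notin> P"
    and "infinite T" "\<And>t. t \<in> T \<Longrightarrow> poly G (of_nat t) \<in> P"
  shows "coeff G i \<in> P"
  using assms(3,4)
proof (induction "degree G" arbitrary: G T i)
  case 0
  then obtain t where "t \<in> T" by (metis ex_in_conv finite.emptyI)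
  moreover obtain c where "G = [:c:]" using 0 by (metis degree_eq_zeroE)
  ultimately show ?case
    using 0(3) idl.subspace_0[OF prime_idealD(1)[OF P]] by (cases i) (auto simp: coeff_pCons)
next
  case (Suc d)
  note sub = prime_idealD(1)[OF P]
  obtain t where t: "t \<in> T" using Suc.prems(1) by (metis ex_in_conv finite.emptyI)
  let ?c = "of_nat t :: 'a"
  let ?H = "synthetic_div G ?c"
  have G: "G + smult ?c ?H = pCons (poly G ?c) ?H" by (rule synthetic_div_correct)
  have "poly ?H (of_nat u) \<in> P" if u: "u \<in> T - {t}" for u
  proof -
    have "poly G (of_nat u) + ?c * poly ?H (of_nat u) = poly G ?c + of_nat u * poly ?H (of_nat u)"
      using arg_cong[OF G, of "\<lambda>p. poly p (of_nat u)"] by simp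
    then have "(of_nat u - ?c) * poly ?H (of_nat u) = poly G (of_nat u) - poly G ?c"
      by (simp add: algebra_simps)
    then have *: "(of_nat u - ?c) * poly ?H (of_nat u) \<in> P"
      using Suc.prems(2) t u idl.subspace_diff[OF sub] by auto
    have "of_nat u - ?c \<notin> P"
    proof (cases "u > t")
      case True
      then show ?thesis using unit[of "u - t"] by (simp add: of_nat_diff)
    next
      case False
      then have "of_nat u - ?c = - of_nat (t - u)" by (simp add: of_nat_diff)
      then show ?thesis using unit[of "t - u"] u False idl.subspace_neg[OF sub, of "- of_nat (t - u)"] by auto
    qed
    then show ?thesis using prime_idealD(3)[OF P *] by blast
  qed
  moreover have "d = degree ?H" by (simp add: degree_synthetic_div flip: Suc.hyps(2))
  moreover have "infinite (T - {t})" using Suc.prems(1) by simp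
  ultimately have H: "coeff ?H j \<in> P" for j using Suc.hyps(1) by blast
  have "coeff G i = coeff (pCons (poly G ?c) ?H) i - ?c * coeff ?H i"
    using arg_cong[OF G, of "\<lambda>p. coeff p i"] by (simp add: algebra_simps)
  then show ?case
    using H Suc.prems(2)[OF t] idl.subspace_diff[OF sub] idl.subspace_scale[OF sub]
    by (auto simp: coeff_pCons split: nat.splits)
qed

text \<open>Avoidance of the finitely many associated primes along the moment curve: by the
  Vandermonde argument, a prime that contains no positive integer but \<open>\<Sum>i. t ^ i * g i\<close> for infinitely many \<open>t\<close>
  contains all \<open>g i\<close>.\<close>

lemma nonzerodivisor_on_moment_curve:
  fixes Q :: "'a::comm_ring_1 set"
  assumes N: "noetherian_on (UNIV :: 'a set)" and Q: "idl.subspace Q"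
    and unit: "\<And>n::nat. n > 0 \<Longrightarrow> (of_nat n :: 'a) dvd 1"
    and y: "nonzerodivisor_mod Q y" "y \<in> idl.span (set gs \<union> Q)"
  obtains t :: nat where "nonzerodivisor_mod Q (poly (Poly gs) (of_nat t))"
proof (rule ccontr)
  assume "\<not> thesis"
  then have "\<forall>t. \<exists>P. P \<in> associated_primes Q \<and> poly (Poly gs) (of_nat t) \<in> P"
    using that zerodivisor_in_associated_prime[OF N Q] by metis
  then obtain P where P: "\<And>t. P t \<in> associated_primes Q" "\<And>t. poly (Poly gs) (of_nat t) \<in> P t"
    by metis
  have "finite (range P)"
    using finite_associated_primes[OF N Q] P(1) by (meson finite_subset image_subsetI)
  then obtain t0 where inf: "infinite {t. P t = P t0}"
    using pigeonhole_infinite[of "UNIV :: nat set" P] by auto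
  have prime: "prime_ideal (P t0)" using P(1) by (auto simp: associated_primes_def)
  obtain a where a: "P t0 = colon Q a" using P(1)[of t0] by (auto simp: associated_primes_def)
  have "of_nat n \<notin> P t0" if "n > 0" for n
  proof
    assume "of_nat n \<in> P t0"
    moreover obtain u :: 'a where "1 = of_nat n * u" using unit[OF \<open>n > 0\<close>] by (auto elim: dvdE)
    ultimately show False
      using subspace_mult_right[OF prime_idealD(1)[OF prime]] prime_idealD(2)[OF prime] by metis
  qed
  moreover have "poly (Poly gs) (of_nat t) \<in> P t0" if "t \<in> {t. P t = P t0}" for t
    using that P(2)[of t] by simp
  ultimately have "coeff (Poly gs) i \<in> P t0" for i
    using coeffs_in_prime_if_infinitely_many_values[OF prime _ inf] by blast
  then have "set gs \<subseteq> P t0"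
    by (metis coeff_Poly_eq in_set_conv_nth nth_default_nth subsetI)
  moreover have "Q \<subseteq> P t0" using subspace_mult_right[OF Q] idl.subspace_scale[OF Q] by (auto simp: a colon_def mult.commute)
  ultimately have "y \<in> P t0"
    using y(2) idl.span_minimal[of "set gs \<union> Q" "P t0"] prime_idealD(1)[OF prime] by auto
  then have "a \<in> Q" using y(1) by (auto simp: a colon_def nonzerodivisor_mod_def)
  then have "1 \<in> P t0" by (simp add: a colon_def)
  then show False using prime_idealD(2)[OF prime] by blast
qed

section \<open>Saturated ideals and regular sequences at a prime\<close>

text \<open>The contraction to the ring of the extension of \<open>Q\<close> to the local ring at \<open>M\<close>. Working with these
  contractions replaces ideals of the local ring by ideals of the ring itself.\<close>

definition saturation :: "'a::comm_ring_1 set \<Rightarrow> 'a set \<Rightarrow> 'a set" where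
  "saturation M Q = {r. \<exists>s. s \<notin> M \<and> s * r \<in> Q}"

text \<open>One step of a chain of ideals \<open>(x\<^sub>1, \<dots>, x\<^sub>i)\<close> of the local ring, contracted to the ring.\<close>

definition adjoin :: "'a::comm_ring_1 set \<Rightarrow> 'a set \<Rightarrow> 'a \<Rightarrow> 'a set" where
  "adjoin M Q x = saturation M (idl.span (insert x Q))"

text \<open>Regular sequences on the local ring modulo \<open>Q\<close>. Units count as regular here; the properness of
  the generated ideal is stated separately.\<close>

fun regular_mod :: "'a::comm_ring_1 set \<Rightarrow> 'a set \<Rightarrow> 'a list \<Rightarrow> bool" where
  "regular_mod M Q [] \<longleftrightarrow> True"
| "regular_mod M Q (x # xs) \<longleftrightarrow> nonzerodivisor_mod Q x \<and> regular_mod M (adjoin M Q x) xs"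

locale prime_localization =
  fixes M :: "'a::comm_ring_1 set"
  assumes prime_M: "prime_ideal M"
begin

abbreviation sat :: "'a set \<Rightarrow> 'a set" where "sat \<equiv> saturation M"

lemma one_notin_M: "1 \<notin> M"
  using prime_M by (simp add: prime_ideal_def)

lemma mult_notin_M: "s \<notin> M \<Longrightarrow> t \<notin> M \<Longrightarrow> s * t \<notin> M"
  using prime_M by (auto simp: prime_ideal_def)

lemma diff_notin_M: "s \<notin> M \<Longrightarrow> x \<in> M \<Longrightarrow> s - x \<notin> M"
  using prime_M idl.subspace_add[of M "s - x" x] by (auto simp: prime_ideal_def)

lemma prod_notin_M: "finite A \<Longrightarrow> (\<And>i. i \<in> A \<Longrightarrow> s i \<notin> M) \<Longrightarrow> prod s A \<notin> M"
  by (induction A rule: finite_induct) (auto simp: one_notin_M mult_notin_M)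

lemma saturationI: "s \<notin> M \<Longrightarrow> s * r \<in> Q \<Longrightarrow> r \<in> sat Q"
  by (auto simp: saturation_def)

lemma saturationE:
  assumes "r \<in> sat Q" obtains s where "s \<notin> M" "s * r \<in> Q"
  using assms by (auto simp: saturation_def)

lemma subspace_saturation:
  assumes Q: "idl.subspace Q"
  shows "idl.subspace (sat Q)"
proof (rule idl.subspaceI)
  show "0 \<in> sat Q"
    using one_notin_M idl.subspace_0[OF Q] by (auto simp: saturation_def)
  fix x y assume "x \<in> sat Q" "y \<in> sat Q"
  then obtain s t where st: "s \<notin> M" "s * x \<in> Q" "t \<notin> M" "t * y \<in> Q" by (auto simp: saturation_def)
  have "s * t * (x + y) = t * (s * x) + s * (t * y)" by (simp add: algebra_simps)
  also have "\<dots> \<in> Q" by (intro idl.subspace_add[OF Q] idl.subspace_scale[OF Q] st)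
  finally show "x + y \<in> sat Q" using mult_notin_M st by (auto intro: saturationI)
next
  fix c x assume "x \<in> sat Q"
  then obtain s where s: "s \<notin> M" "s * x \<in> Q" by (auto simp: saturation_def)
  then have "s * (c * x) \<in> Q" using idl.subspace_scale[OF Q s(2), of c] by (simp add: mult.left_commute)
  then show "c * x \<in> sat Q" using s by (auto intro: saturationI)
qed

lemma saturation_superset: "Q \<subseteq> sat Q"
  using one_notin_M by (auto simp: saturation_def intro!: exI[of _ 1])

lemma saturation_mono: "P \<subseteq> Q \<Longrightarrow> sat P \<subseteq> sat Q"
  by (auto simp: saturation_def)

lemma saturation_idem [simp]: "sat (sat Q) = sat Q"
proof
  show "sat (sat Q) \<subseteq> sat Q"
  proof
    fix x assume "x \<in> sat (sat Q)"
    then obtain s t where "s \<notin> M" "t \<notin> M" "t * (s * x) \<in> Q" by (auto simp: saturation_def)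
    then show "x \<in> sat Q"
      using mult_notin_M by (auto intro!: saturationI[of "t * s"] simp: mult.assoc)
  qed
qed (rule saturation_superset)

lemma saturation_span_minimal:
  assumes "S \<subseteq> sat Q" "idl.subspace Q"
  shows "sat (idl.span S) \<subseteq> sat Q"
  using saturation_mono[OF idl.span_minimal[OF assms(1) subspace_saturation[OF assms(2)]]] by simp

lemma saturation_span_insert_saturation:
  "sat (idl.span (A \<union> sat (idl.span B))) = sat (idl.span (A \<union> B))"
proof
  show "sat (idl.span (A \<union> sat (idl.span B))) \<subseteq> sat (idl.span (A \<union> B))"
  proof (rule saturation_span_minimal)
    show "A \<union> sat (idl.span B) \<subseteq> sat (idl.span (A \<union> B))"
      using saturation_mono[OF idl.span_mono[of B "A \<union> B"]] saturation_superset[of "idl.span (A \<union> B)"]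
        idl.span_superset[of "A \<union> B"] by auto
  qed simp
  show "sat (idl.span (A \<union> B)) \<subseteq> sat (idl.span (A \<union> sat (idl.span B)))"
    by (intro saturation_mono idl.span_mono)
      (use saturation_superset[of "idl.span B"] idl.span_superset[of B] in auto)
qed

text \<open>A saturated ideal \<open>Q\<close> enters as the equation \<open>Q = sat (idl.span Q)\<close>, which says both that
  \<open>Q\<close> is an ideal and that it is its own saturation.\<close>

lemma foldl_adjoin:
  assumes "Q = sat (idl.span Q)"
  shows "foldl (adjoin M) Q xs = sat (idl.span (set xs \<union> Q))"
  using assms
proof (induction xs arbitrary: Q)
  case (Cons x xs)
  let ?Q = "adjoin M Q x"
  have s: "?Q = sat (idl.span ?Q)"
    using saturation_span_insert_saturation[of "{}" "insert x Q"] by (simp add: adjoin_def)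
  have "foldl (adjoin M) Q (x # xs) = sat (idl.span (set xs \<union> ?Q))"
    using Cons.IH[OF s] by simp
  also have "\<dots> = sat (idl.span (set (x # xs) \<union> Q))"
    unfolding adjoin_def saturation_span_insert_saturation by simp
  finally show ?case .
qed simp

lemma saturated_adjoin: "adjoin M Q x = sat (idl.span (adjoin M Q x))"
  using saturation_span_insert_saturation[of "{}" "insert x Q"] by (simp add: adjoin_def)

lemma saturated_subspace: "Q = sat (idl.span Q) \<Longrightarrow> idl.subspace Q"
  using subspace_saturation[of "idl.span Q"] by simp

lemma saturatedD:
  assumes "Q = sat (idl.span Q)" "s \<notin> M" "s * x \<in> Q"
  shows "x \<in> Q"
proof -
  have "s * x \<in> idl.span Q" using assms(3) by (rule idl.span_base)
  then show ?thesis using assms(1,2) saturationI by blast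
qed

lemma adjoin_commute: "adjoin M (adjoin M Q x) y = adjoin M (adjoin M Q y) x"
  using saturation_span_insert_saturation[of "{y}" "insert x Q"]
    saturation_span_insert_saturation[of "{x}" "insert y Q"]
  by (simp add: adjoin_def insert_commute)

lemma in_adjoinE:
  assumes Q: "idl.subspace Q" and r: "r \<in> adjoin M Q x"
  obtains s k where "s \<notin> M" "s * r - k * x \<in> Q"
proof -
  have spanQ: "idl.span Q = Q" using Q by (simp only: idl.span_eq_iff)
  show thesis
    using r that unfolding adjoin_def idl.span_insert spanQ by (auto elim: saturationE)
qed

lemma in_adjoinI:
  assumes "idl.subspace Q" "s \<notin> M" "s * r - k * x \<in> Q"
  shows "r \<in> adjoin M Q x"
proof -
  have spanQ: "idl.span Q = Q" using assms(1) by (simp only: idl.span_eq_iff)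
  show ?thesis
    unfolding adjoin_def idl.span_insert spanQ using assms by (intro saturationI[of s]) auto
qed

text \<open>Nakayama's lemma, by eliminating one generator after the other. The hypothesis allows
  a denominator \<open>s\<close>, because the elimination produces one.\<close>

lemma nakayama:
  assumes Q: "Q = sat (idl.span Q)" and a: "a \<in> M" and "finite S"
    and "\<And>k. k \<in> S \<Longrightarrow> \<exists>s w. s \<notin> M \<and> w \<in> idl.span S \<and> s * k - a * w \<in> Q"
  shows "S \<subseteq> Q"
  using assms(3,4)
proof (induction S rule: finite_induct)
  case (insert k S)
  note Qs = saturated_subspace[OF Q]
  obtain u w where u: "u \<notin> M" "w \<in> idl.span (insert k S)" "u * k - a * w \<in> Q"
    using insert.prems[of k] by auto
  then obtain c where c: "w - c * k \<in> idl.span S" by (auto simp: idl.span_breakdown_eq)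
  define w' where "w' = w - c * k"
  define v where "v = u - a * c"
  have "v \<notin> M"
    unfolding v_def using u(1) subspace_mult_right[OF prime_idealD(1)[OF prime_M] a] by (rule diff_notin_M)
  have vk: "v * k - a * w' \<in> Q"
    using u(3) by (simp add: v_def w'_def algebra_simps)
  have "S \<subseteq> Q"
  proof (rule insert.IH)
    fix x assume "x \<in> S"
    then obtain s z where s: "s \<notin> M" "z \<in> idl.span (insert k S)" "s * x - a * z \<in> Q"
      using insert.prems[of x] by auto
    then obtain d where d: "z - d * k \<in> idl.span S" by (auto simp: idl.span_breakdown_eq)
    let ?z = "v * (z - d * k) + (a * d) * w'"
    have "(v * s) * x - a * ?z = v * (s * x - a * z) + (a * d) * (v * k - a * w')"
      by (simp add: algebra_simps)
    also have "\<dots> \<in> Q"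
      by (intro idl.subspace_add[OF Qs] idl.subspace_scale[OF Qs] s(3) vk)
    finally have "(v * s) * x - a * ?z \<in> Q" .
    moreover have "?z \<in> idl.span S"
      using c d by (intro idl.span_add idl.span_scale) (auto simp: w'_def)
    ultimately show "\<exists>s w. s \<notin> M \<and> w \<in> idl.span S \<and> s * x - a * w \<in> Q"
      using mult_notin_M[OF \<open>v \<notin> M\<close> s(1)] by blast
  qed
  then have "w' \<in> Q" using c idl.span_minimal[of S Q] Qs by (auto simp: w'_def)
  then have "v * k \<in> Q"
    using idl.subspace_add[OF Qs vk idl.subspace_scale[OF Qs, of w' a]] by simp
  then have "k \<in> Q" using saturatedD[OF Q \<open>v \<notin> M\<close>] by blast
  then show ?case using \<open>S \<subseteq> Q\<close> by simp
qed simp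

lemma regular_mod_append:
  "regular_mod M Q (xs @ ys) \<longleftrightarrow> regular_mod M Q xs \<and> regular_mod M (foldl (adjoin M) Q xs) ys"
  by (induction xs arbitrary: Q) auto

lemma regular_mod_iff:
  "regular_mod M Q xs \<longleftrightarrow>
    (\<forall>i<length xs. nonzerodivisor_mod (foldl (adjoin M) Q (take i xs)) (xs ! i))"
  by (induction xs arbitrary: Q) (auto simp: All_less_Suc2)

end

locale noetherian_localization = prime_localization M for M :: "'a::comm_ring_1 set" +
  assumes noetherian: "noetherian_on (UNIV :: 'a set)"
begin

text \<open>The two halves of the exchange of neighbours in a regular sequence. The first one
  needs the local ring: the annihilator \<open>K\<close> of \<open>b\<close> modulo \<open>Q\<close> satisfies \<open>K \<subseteq> Q + a K\<close> up to denominators.\<close>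

lemma nonzerodivisor_swap1:
  assumes Q: "Q = sat (idl.span Q)" and a: "a \<in> M"
    and ra: "nonzerodivisor_mod Q a" and rb: "nonzerodivisor_mod (adjoin M Q a) b"
  shows "nonzerodivisor_mod Q b"
proof -
  note Qs = saturated_subspace[OF Q]
  define K where "K = colon Q b"
  obtain S where S: "finite S" "K = idl.span S"
    using ideal_finitely_generated[OF noetherian subspace_colon[OF Qs]] K_def by metis
  have "S \<subseteq> Q"
  proof (rule nakayama[OF Q a S(1)])
    fix k assume "k \<in> S"
    then have "k \<in> K" using S(2) idl.span_base by auto
    then have k: "b * k \<in> Q" by (simp add: K_def colon_def mult.commute)
    have "b * k \<in> adjoin M Q a"
      by (rule in_adjoinI[OF Qs one_notin_M, of _ 0]) (simp add: k)
    then have "k \<in> adjoin M Q a" using rb by (simp add: nonzerodivisor_mod_def)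
    then obtain s w where s: "s \<notin> M" "s * k - w * a \<in> Q" by (rule in_adjoinE[OF Qs])
    have "a * (b * w) = s * (b * k) - b * (s * k - w * a)" by (simp add: algebra_simps)
    also have "\<dots> \<in> Q" by (intro idl.subspace_diff[OF Qs] idl.subspace_scale[OF Qs] k s)
    finally have "b * w \<in> Q" using ra by (simp add: nonzerodivisor_mod_def)
    then have "w \<in> K" by (simp add: K_def colon_def mult.commute)
    then have "w \<in> idl.span S" using S(2) by simp
    then show "\<exists>s w. s \<notin> M \<and> w \<in> idl.span S \<and> s * k - a * w \<in> Q"
      using s by (metis mult.commute)
  qed
  then have "K \<subseteq> Q" using S idl.span_minimal[of S Q] Qs by simp
  then show ?thesis by (auto simp: nonzerodivisor_mod_def K_def colon_def mult.commute)
qed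

lemma nonzerodivisor_swap2:
  assumes Q: "Q = sat (idl.span Q)"
    and ra: "nonzerodivisor_mod Q a" and rb: "nonzerodivisor_mod (adjoin M Q a) b"
  shows "nonzerodivisor_mod (adjoin M Q b) a"
  unfolding nonzerodivisor_mod_def
proof (intro allI impI)
  note Qs = saturated_subspace[OF Q]
  fix y assume "a * y \<in> adjoin M Q b"
  then obtain s z where s: "s \<notin> M" "s * (a * y) - z * b \<in> Q" by (rule in_adjoinE[OF Qs])
  have "b * z \<in> adjoin M Q a"
  proof (rule in_adjoinI[OF Qs one_notin_M])
    show "1 * (b * z) - (s * y) * a \<in> Q"
      using idl.subspace_neg[OF Qs s(2)] by (simp add: algebra_simps)
  qed
  then have "z \<in> adjoin M Q a" using rb by (simp add: nonzerodivisor_mod_def)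
  then obtain s' w where s': "s' \<notin> M" "s' * z - w * a \<in> Q" by (rule in_adjoinE[OF Qs])
  have "a * ((s' * s) * y - w * b) = s' * (s * (a * y) - z * b) + b * (s' * z - w * a)"
    by (simp add: algebra_simps)
  also have "\<dots> \<in> Q" by (intro idl.subspace_add[OF Qs] idl.subspace_scale[OF Qs] s s')
  finally have "(s' * s) * y - w * b \<in> Q" using ra by (simp add: nonzerodivisor_mod_def)
  then show "y \<in> adjoin M Q b"
    using in_adjoinI[OF Qs mult_notin_M[OF s'(1) s(1)]] by blast
qed

lemma regular_mod_move_last_to_front:
  assumes "Q = sat (idl.span Q)" "set ys \<subseteq> M" "regular_mod M Q (ys @ [z])"
  shows "regular_mod M Q (z # ys)"
  using assms
proof (induction ys arbitrary: Q)
  case (Cons y ys)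
  have y: "nonzerodivisor_mod Q y" and "regular_mod M (adjoin M Q y) (ys @ [z])"
    using Cons.prems by auto
  then have "regular_mod M (adjoin M Q y) (z # ys)"
    using Cons.IH[OF saturated_adjoin] Cons.prems(2) by auto
  then have z: "nonzerodivisor_mod (adjoin M Q y) z" and ys: "regular_mod M (adjoin M (adjoin M Q y) z) ys"
    by auto
  show ?case
    using nonzerodivisor_swap1[OF Cons.prems(1) _ y z] nonzerodivisor_swap2[OF Cons.prems(1) y z]
      ys Cons.prems(2) by (simp add: adjoin_commute[of Q z y])
qed simp

text \<open>An ideal generated by \<open>n\<close> elements that contains a regular sequence of length \<open>n\<close> is
  generated by a regular sequence. The generators are exchanged one after the other: a generic combination
  of the remaining generators is regular modulo all but the last member of \<open>ys\<close>, and it can be moved to the front.\<close>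

theorem generated_by_regular_sequence:
  assumes unit: "\<And>n::nat. n > 0 \<Longrightarrow> (of_nat n :: 'a) dvd 1"
    and "Q = sat (idl.span Q)" "length ys = length gs" "set ys \<subseteq> M"
    and "set ys \<subseteq> foldl (adjoin M) Q gs" "regular_mod M Q ys"
  shows "\<exists>zs. regular_mod M Q zs \<and> foldl (adjoin M) Q zs = foldl (adjoin M) Q gs"
  using assms(2-)
proof (induction gs arbitrary: ys Q)
  case (Cons g gs)
  note Q = Cons.prems(1)
  note Qs = saturated_subspace[OF Q]
  obtain ys' y where ys: "ys = ys' @ [y]"
    using Cons.prems(2) by (cases ys rule: rev_cases) auto
  define Q' where "Q' = foldl (adjoin M) Q ys'"
  have Q'_eq: "Q' = sat (idl.span (set ys' \<union> Q))"
    unfolding Q'_def by (rule foldl_adjoin[OF Q])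
  have Q': "Q' = sat (idl.span Q')"
    using saturation_span_insert_saturation[of "{}" "set ys' \<union> Q"] by (simp add: Q'_eq)
  have QQ': "Q \<subseteq> Q'"
    using saturation_superset[of "idl.span (set ys' \<union> Q)"] idl.span_superset[of "set ys' \<union> Q"]
    by (auto simp: Q'_eq)
  have reg: "regular_mod M Q ys'" "nonzerodivisor_mod Q' y"
    using Cons.prems(5) by (auto simp: ys regular_mod_append Q'_def)
  have "y \<in> sat (idl.span (set (g # gs) \<union> Q))"
    using Cons.prems(4) foldl_adjoin[OF Q, of "g # gs"] by (auto simp: ys)
  then obtain s where s: "s \<notin> M" "s * y \<in> idl.span (set (g # gs) \<union> Q)" by (rule saturationE)
  have sy: "s * y \<in> idl.span (set (g # gs) \<union> Q')"
    using s(2) idl.span_mono[of "set (g # gs) \<union> Q" "set (g # gs) \<union> Q'"] QQ' by auto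
  have "nonzerodivisor_mod Q' (s * y)"
    unfolding nonzerodivisor_mod_def
  proof (intro allI impI)
    fix x assume "s * y * x \<in> Q'"
    then have "y * x \<in> Q'" using saturatedD[OF Q' s(1)] by (simp only: mult.assoc)
    then show "x \<in> Q'" using reg(2) by (simp add: nonzerodivisor_mod_def)
  qed
  then obtain t :: nat where t: "nonzerodivisor_mod Q' (poly (Poly (g # gs)) (of_nat t))"
    using nonzerodivisor_on_moment_curve[OF noetherian saturated_subspace[OF Q'] unit _ sy] by blast
  define z where "z = poly (Poly (g # gs)) (of_nat t)"
  have z: "z = g + of_nat t * poly (Poly gs) (of_nat t)" by (simp add: z_def)
  have comb: "poly (Poly gs) x \<in> idl.span (set gs \<union> P)" for x P
    unfolding poly_altdef
  proof (intro idl.span_sum)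
    fix i
    have "coeff (Poly gs) i \<in> idl.span (set gs \<union> P)"
      by (cases "i < length gs")
        (auto simp: coeff_Poly_eq nth_default_def idl.span_zero intro!: idl.span_base)
    then show "coeff (Poly gs) i * x ^ i \<in> idl.span (set gs \<union> P)"
      by (rule subspace_mult_right[OF idl.subspace_span])
  qed
  have "regular_mod M Q (ys' @ [z])"
    using reg(1) t by (simp add: regular_mod_append Q'_def z_def)
  then have "regular_mod M Q (z # ys')"
    by (rule regular_mod_move_last_to_front[OF Q, rotated]) (use Cons.prems(3) in \<open>simp add: ys\<close>)
  then have zreg: "nonzerodivisor_mod Q z" "regular_mod M (adjoin M Q z) ys'" by auto
  have span_eq: "idl.span (set (z # gs) \<union> Q) = idl.span (set (g # gs) \<union> Q)"
    unfolding idl.span_eq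
  proof
    have c: "of_nat t * poly (Poly gs) (of_nat t) \<in> idl.span (set gs \<union> P)" for P
      by (intro idl.span_scale comb)
    have "z \<in> idl.span (set (g # gs) \<union> Q)"
      unfolding z using c[of "insert g Q"] by (intro idl.span_add) (auto intro: idl.span_base)
    then show "set (z # gs) \<union> Q \<subseteq> idl.span (set (g # gs) \<union> Q)"
      using idl.span_superset[of "set (g # gs) \<union> Q"] by auto
    have "g = z - of_nat t * poly (Poly gs) (of_nat t)" by (simp add: z)
    also have "\<dots> \<in> idl.span (set (z # gs) \<union> Q)"
      using c[of "insert z Q"] by (intro idl.span_diff) (auto intro: idl.span_base)
    finally show "set (g # gs) \<union> Q \<subseteq> idl.span (set (z # gs) \<union> Q)"
      using idl.span_superset[of "set (z # gs) \<union> Q"] by auto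
  qed
  have fold_eq: "foldl (adjoin M) (adjoin M Q z) gs = foldl (adjoin M) Q (g # gs)"
    using foldl_adjoin[OF Q, of "z # gs"] foldl_adjoin[OF Q, of "g # gs"] span_eq by simp
  obtain zs where "regular_mod M (adjoin M Q z) zs"
    "foldl (adjoin M) (adjoin M Q z) zs = foldl (adjoin M) (adjoin M Q z) gs"
  proof (rule exE[OF Cons.IH[of "adjoin M Q z" ys', OF saturated_adjoin]])
    show "length ys' = length gs" "set ys' \<subseteq> M" using Cons.prems(2,3) by (simp_all add: ys)
    show "set ys' \<subseteq> foldl (adjoin M) (adjoin M Q z) gs"
      using Cons.prems(4) unfolding fold_eq by (simp add: ys)
    show "regular_mod M (adjoin M Q z) ys'" by (rule zreg(2))
  qed blast
  then show ?case
    using zreg(1) fold_eq by (intro exI[of _ "z # zs"]) simp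
qed (auto intro: exI[of _ "[]"])

end

section \<open>Powers of coordinates\<close>

lemma lookup_single_mult:
  "lookup (single e 1 * g) (e + m) = lookup (g :: ('v, 'a::comm_ring_1) mpoly) m"
proof (induction g rule: mpoly_induct)
  case (monomial n c)
  show ?case by (simp add: mult_single lookup_single)
qed (simp_all add: distrib_left lookup_add)

lemma mvar_power:
  "mvar v ^ N = (single (single v N) 1 :: ('v, 'a::comm_ring_1) mpoly)"
  by (rule trans[OF monom_eval_single[symmetric] monomial_eq_prod[symmetric]])

text \<open>Membership in a monomial ideal is decided on each monomial by divisibility, so multiplication by a
  power of another variable cannot create it.\<close>

lemma in_span_of_powers_iff:
  fixes g :: "('v, 'a::comm_ring_1) mpoly"
  shows "g \<in> idl.span ((\<lambda>v. mvar v ^ N) ` W) \<longleftrightarrow>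
    (\<forall>m\<in>keys g. \<exists>v\<in>W. N \<le> lookup m v)"
proof
  note pw = mvar_power[where 'v='v and 'a='a]
  let ?D = "{g :: ('v, 'a) mpoly. \<forall>m\<in>keys g. \<exists>v\<in>W. N \<le> lookup m v}"
  have "idl.subspace ?D"
  proof (rule idl.subspaceI)
    fix p q assume "p \<in> ?D" "q \<in> ?D"
    then show "p + q \<in> ?D" using keys_add[of p q] by auto
  next
    fix c p assume p: "p \<in> ?D"
    show "c * p \<in> ?D"
    proof (intro CollectI ballI)
      fix m assume "m \<in> keys (c * p)"
      then obtain a b where "m = a + b" "b \<in> keys p" using keys_mult[of c p] by auto
      then show "\<exists>v\<in>W. N \<le> lookup m v"
        using p by (force simp: lookup_add intro: trans_le_add2)
    qed
  qed simp
  moreover have "(\<lambda>v. mvar v ^ N) ` W \<subseteq> ?D"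
    by (force simp: pw)
  ultimately have sub: "idl.span ((\<lambda>v. mvar v ^ N) ` W) \<subseteq> ?D" by (intro idl.span_minimal)
  show "g \<in> idl.span ((\<lambda>v. mvar v ^ N) ` W) \<Longrightarrow>
    \<forall>m\<in>keys g. \<exists>v\<in>W. N \<le> lookup m v"
    using sub by auto
  assume g: "\<forall>m\<in>keys g. \<exists>v\<in>W. N \<le> lookup m v"
  show "g \<in> idl.span ((\<lambda>v. mvar v ^ N) ` W)"
  proof (induction g rule: mpoly_induct)
    case (monomial m c)
    then obtain v where v: "v \<in> W" "N \<le> lookup m v" using g by auto
    let ?e = "single v N"
    have "m = (m - ?e) + ?e" using exponent_split[OF v(2)] by (simp add: add.commute)
    then have "single m c = single (m - ?e) c * mvar v ^ N"
      unfolding pw mult_single by simp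
    also have "\<dots> \<in> idl.span ((\<lambda>v. mvar v ^ N) ` W)"
      using v by (intro idl.span_scale idl.span_base) auto
    finally show ?case .
  qed (auto intro: idl.span_zero idl.span_add)
qed

lemma powers_of_variables_regular:
  fixes g :: "('v, 'a::comm_ring_1) mpoly"
  assumes "v \<notin> W" "mvar v ^ N * g \<in> idl.span ((\<lambda>v. mvar v ^ N) ` W)"
  shows "g \<in> idl.span ((\<lambda>v. mvar v ^ N) ` W)"
  unfolding in_span_of_powers_iff
proof
  fix m assume m: "m \<in> keys g"
  let ?e = "single v N"
  note pw = mvar_power[of v N, where 'a='a]
  have "?e + m \<in> keys (mvar v ^ N * g)"
    using m by (simp add: in_keys_iff pw lookup_single_mult)
  then obtain w where "w \<in> W" "N \<le> lookup (?e + m) w"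
    using assms(2) unfolding in_span_of_powers_iff by blast
  then show "\<exists>w\<in>W. N \<le> lookup m w"
    using assms(1) by (intro bexI[of _ w]) (auto simp: lookup_add lookup_single when_def split: if_splits)
qed

lemma span_image_hom:
  assumes h: "coeff_hom h" and x: "x \<in> idl.span S"
  shows "h x \<in> idl.span (h ` S)"
  using x
proof (induction rule: idl.span_induct_alt)
  case base
  show ?case by (simp add: coeff_hom.hom_zero[OF h] idl.span_zero)
next
  case (step c x y)
  then show ?case
    unfolding coeff_hom.hom_add[OF h] coeff_hom.hom_mult[OF h]
    by (intro idl.span_add idl.span_scale) (auto intro: idl.span_base)
qed

text \<open>The origin is moved to the point \<open>a\<close> by a translation of the polynomial ring.\<close>

lemma powers_of_coordinates_regular:
  fixes g :: "('v, 'a::comm_ring_1) mpoly" and a :: "'v \<Rightarrow> 'a" and N :: nat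
  defines "y \<equiv> \<lambda>v. (mvar v - mconst (a v)) ^ N"
  assumes "v \<notin> W" "y v * g \<in> idl.span (y ` W)"
  shows "g \<in> idl.span (y ` W)"
proof -
  let ?to = "mpoly_subst mconst (\<lambda>v. mvar v + mconst (a v)) :: ('v, 'a) mpoly \<Rightarrow> ('v, 'a) mpoly"
  let ?from = "mpoly_subst mconst (\<lambda>v. mvar v - mconst (a v)) :: ('v, 'a) mpoly \<Rightarrow> ('v, 'a) mpoly"
  note hom = coeff_hom.coeff_hom_subst[OF coeff_hom_mconst]
  note simps = coeff_hom.hom_simps[OF hom] coeff_hom.subst_mconst[OF coeff_hom_mconst]
    coeff_hom.subst_mvar[OF coeff_hom_mconst]
  have to: "?to (y w) = mvar w ^ N" for w by (simp add: y_def simps)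
  have "from": "?from (mvar w ^ N) = y w" for w by (simp add: y_def simps)
  have "?from (?to g) = g"
    by (rule mpoly_hom_eqI[of "\<lambda>g. ?from (?to g)" "\<lambda>g. g"]) (auto simp: simps coeff_hom_comp hom coeff_hom_id)
  moreover have "mvar v ^ N * ?to g \<in> idl.span ((\<lambda>v. mvar v ^ N) ` W)"
    using span_image_hom[OF hom assms(3), of "\<lambda>v. mvar v + mconst (a v)"]
    by (simp add: simps(3) to image_image)
  then have "?to g \<in> idl.span ((\<lambda>v. mvar v ^ N) ` W)"
    by (rule powers_of_variables_regular[OF assms(2)])
  then have "?from (?to g) \<in> idl.span (y ` W)"
    using span_image_hom[OF hom, of "?to g" _ "\<lambda>v. mvar v - mconst (a v)"] by (fastforce simp: "from" image_image)
  ultimately show ?thesis by simp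
qed

lemma (in prime_localization) regular_mod_powers_of_coordinates:
  assumes "distinct vs" "\<And>v W. v \<notin> W \<Longrightarrow> nonzerodivisor_mod (idl.span (y ` W)) (y v)"
  shows "regular_mod M (sat {0}) (map y vs)"
  unfolding regular_mod_iff
proof (intro allI impI)
  fix i assume i: "i < length (map y vs)"
  let ?W = "set (take i vs)"
  have s0: "sat {0} = sat (idl.span (sat {0}))"
    using saturation_span_insert_saturation[of "{}" "{}"] by simp
  have "foldl (adjoin M) (sat {0}) (take i (map y vs)) = sat (idl.span (y ` ?W))"
    unfolding foldl_adjoin[OF s0] using saturation_span_insert_saturation[of "y ` ?W" "{}"]
    by (simp add: take_map)
  moreover have "vs ! i \<notin> ?W"
    using assms(1) i by (auto simp: in_set_conv_nth nth_eq_iff_index_eq)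
  then have "nonzerodivisor_mod (idl.span (y ` ?W)) (y (vs ! i))" by (rule assms(2))
  then have "nonzerodivisor_mod (sat (idl.span (y ` ?W))) (y (vs ! i))"
    by (fastforce simp: nonzerodivisor_mod_def saturation_def mult.left_commute)
  ultimately show "nonzerodivisor_mod (foldl (adjoin M) (sat {0}) (take i (map y vs))) (map y vs ! i)"
    using i by simp
qed

section \<open>The local ring of fractions\<close>

lemma ring_of_type_algebra_simps:
  "carrier (ring_of_type_algebra :: 'a::comm_ring_1 ring) = UNIV"
  "x \<otimes>\<^bsub>ring_of_type_algebra\<^esub> y = (x * y :: 'a)"
  "x \<oplus>\<^bsub>ring_of_type_algebra\<^esub> y = (x + y :: 'a)"
  "\<one>\<^bsub>ring_of_type_algebra\<^esub> = (1 :: 'a)"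
  "\<zero>\<^bsub>ring_of_type_algebra\<^esub> = (0 :: 'a)"
  by (simp_all add: ring_of_type_algebra_def)

context prime_localization
begin

abbreviation frac :: "'a \<Rightarrow> 'a \<Rightarrow> ('a \<times> 'a) set" where
  "frac a s \<equiv> fraction ring_of_type_algebra (carrier ring_of_type_algebra - M) a s"

abbreviation local_ring :: "('a \<times> 'a) set ring" where
  "local_ring \<equiv> local_ring_at ring_of_type_algebra M"

abbreviation extend :: "'a set \<Rightarrow> ('a \<times> 'a) set set" where
  "extend A \<equiv> ideal_at ring_of_type_algebra A M"

text \<open>Fractions are treated with the extra factor \<open>u\<close> of the definition, so that no cancellation law is used.\<close>

lemma in_frac_iff:
  assumes "s \<notin> M"
  shows "(b, t) \<in> frac a s \<longleftrightarrow> t \<notin> M \<and> (\<exists>u. u \<notin> M \<and> u * (t * a) = u * (s * b))"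
  using assms by (auto simp: fraction_def frac_rel_def ring_of_type_algebra_simps)

lemma frac_refl: "s \<notin> M \<Longrightarrow> (a, s) \<in> frac a s"
  using one_notin_M by (auto simp: in_frac_iff)

lemma frac_eqI:
  assumes s: "s \<notin> M" and t: "t \<notin> M" and u: "u \<notin> M" and eq: "u * (t * a) = u * (s * b)"
  shows "frac a s = frac b t"
proof -
  have sub: "frac a s \<subseteq> frac b t"
    if s: "s \<notin> M" and t: "t \<notin> M" and u: "u \<notin> M" and eq: "u * (t * a) = u * (s * b)" for a s b t
  proof
    fix x assume "x \<in> frac a s"
    moreover obtain c r where x: "x = (c, r)" by (cases x)
    ultimately obtain v where v: "r \<notin> M" "v \<notin> M" "v * (r * a) = v * (s * c)" using s by (auto simp: in_frac_iff)
    have "(s * u * v) * (r * b) = (v * r) * (u * (s * b))" by (simp add: mult_ac)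
    also have "\<dots> = (u * t) * (v * (r * a))" unfolding eq[symmetric] by (simp add: mult_ac)
    also have "\<dots> = (s * u * v) * (t * c)" unfolding v(3) by (simp add: mult_ac)
    finally show "x \<in> frac b t"
      unfolding x in_frac_iff[OF t] using s u v(1,2)
      by (intro conjI exI[of _ "s * u * v"] mult_notin_M)
  qed
  show ?thesis using sub[OF s t u eq] sub[OF t s u eq[symmetric]] by auto
qed

lemma frac_eq_iff:
  assumes "s \<notin> M" "t \<notin> M"
  shows "frac a s = frac b t \<longleftrightarrow> (\<exists>u. u \<notin> M \<and> u * (t * a) = u * (s * b))"
  using frac_eqI[OF assms] frac_refl[OF assms(2), of b] in_frac_iff[OF assms(1), of b t a] by metis

lemma carrier_local_ring: "carrier local_ring = {frac a s | a s. s \<notin> M}"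
  by (auto simp: localization_def quotient_def fraction_def ring_of_type_algebra_simps)

lemma frac_in_carrier: "s \<notin> M \<Longrightarrow> frac a s \<in> carrier local_ring"
  by (auto simp: carrier_local_ring)

lemma one_local_ring: "\<one>\<^bsub>local_ring\<^esub> = frac 1 1"
  by (simp add: localization_def ring_of_type_algebra_simps)

lemma zero_local_ring: "\<zero>\<^bsub>local_ring\<^esub> = frac 0 1"
  by (simp add: localization_def ring_of_type_algebra_simps)

lemma UN_frac_const:
  assumes "s \<notin> M" "t \<notin> M"
    and "\<And>a' s' b' t'. (a', s') \<in> frac a s \<Longrightarrow> (b', t') \<in> frac b t \<Longrightarrow> F a' s' b' t' = C"
  shows "(\<Union>(a', s')\<in>frac a s. \<Union>(b', t')\<in>frac b t. F a' s' b' t') = C"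
  using frac_refl[OF assms(1), of a] frac_refl[OF assms(2), of b] assms(3) by blast

lemma frac_mult:
  assumes s: "s \<notin> M" and t: "t \<notin> M"
  shows "frac a s \<otimes>\<^bsub>local_ring\<^esub> frac b t = frac (a * b) (s * t)"
proof -
  have "frac (a' * b') (s' * t') = frac (a * b) (s * t)"
    if frac: "(a', s') \<in> frac a s" "(b', t') \<in> frac b t" for a' s' b' t'
  proof -
    obtain u v where u: "s' \<notin> M" "u \<notin> M" "u * (s' * a) = u * (s * a')"
      and v: "t' \<notin> M" "v \<notin> M" "v * (t' * b) = v * (t * b')"
      using frac s t by (auto simp: in_frac_iff)
    have "(u * v) * ((s * t) * (a' * b')) = (u * (s * a')) * (v * (t * b'))" by (simp add: mult_ac)
    also have "\<dots> = (u * v) * ((s' * t') * (a * b))"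
      unfolding u(3)[symmetric] v(3)[symmetric] by (simp add: mult_ac)
    finally show ?thesis using u v s t by (intro frac_eqI[of _ _ "u * v"] mult_notin_M)
  qed
  then show ?thesis
    using UN_frac_const[OF s t, of a b "\<lambda>a' s' b' t'. frac (a' * b') (s' * t')"]
    by (simp add: localization_def ring_of_type_algebra_simps)
qed

lemma frac_add:
  assumes s: "s \<notin> M" and t: "t \<notin> M"
  shows "frac a s \<oplus>\<^bsub>local_ring\<^esub> frac b t = frac (a * t + b * s) (s * t)"
proof -
  have "frac (a' * t' + b' * s') (s' * t') = frac (a * t + b * s) (s * t)"
    if frac: "(a', s') \<in> frac a s" "(b', t') \<in> frac b t" for a' s' b' t'
  proof -
    obtain u v where u: "s' \<notin> M" "u \<notin> M" "u * (s' * a) = u * (s * a')"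
      and v: "t' \<notin> M" "v \<notin> M" "v * (t' * b) = v * (t * b')"
      using frac s t by (auto simp: in_frac_iff)
    have "(u * v) * ((s * t) * (a' * t' + b' * s')) =
        (u * (s * a')) * (v * t * t') + (v * (t * b')) * (u * s * s')" by (simp add: algebra_simps)
    also have "\<dots> = (u * v) * ((s' * t') * (a * t + b * s))"
      unfolding u(3)[symmetric] v(3)[symmetric] by (simp add: algebra_simps)
    finally show ?thesis using u v s t by (intro frac_eqI[of _ _ "u * v"] mult_notin_M)
  qed
  then show ?thesis
    using UN_frac_const[OF s t, of a b "\<lambda>a' s' b' t'. frac (a' * t' + b' * s') (s' * t')"]
    by (simp add: localization_def ring_of_type_algebra_simps)
qed

lemma frac_eqI': "s \<notin> M \<Longrightarrow> t \<notin> M \<Longrightarrow> t * a = s * b \<Longrightarrow> frac a s = frac b t"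
  by (rule frac_eqI[OF _ _ one_notin_M]) simp_all

lemma cring_local_ring: "cring local_ring"
proof (rule cringI)
  note ops = frac_mult frac_add one_local_ring zero_local_ring mult_notin_M one_notin_M
  have frac: "\<exists>a s. s \<notin> M \<and> x = frac a s" if "x \<in> carrier local_ring" for x
    using that by (auto simp: carrier_local_ring)
  show "abelian_group local_ring"
  proof (rule abelian_groupI)
    show "\<zero>\<^bsub>local_ring\<^esub> \<in> carrier local_ring"
      unfolding zero_local_ring by (intro frac_in_carrier one_notin_M)
    fix x assume "x \<in> carrier local_ring"
    then obtain a s where x: "s \<notin> M" "x = frac a s" using frac by blast
    show "\<zero>\<^bsub>local_ring\<^esub> \<oplus>\<^bsub>local_ring\<^esub> x = x"
      using x by (simp add: ops)
    have "frac (- a) s \<oplus>\<^bsub>local_ring\<^esub> x = \<zero>\<^bsub>local_ring\<^esub>"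
      unfolding x(2) frac_add[OF x(1) x(1)] zero_local_ring
      using x(1) by (intro frac_eqI' mult_notin_M one_notin_M) simp_all
    then show "\<exists>y\<in>carrier local_ring. y \<oplus>\<^bsub>local_ring\<^esub> x = \<zero>\<^bsub>local_ring\<^esub>"
      using frac_in_carrier[OF x(1)] by blast
    fix y assume "y \<in> carrier local_ring"
    then obtain b t where y: "t \<notin> M" "y = frac b t" using frac by blast
    show "x \<oplus>\<^bsub>local_ring\<^esub> y \<in> carrier local_ring"
      using x y by (simp add: frac_add frac_in_carrier mult_notin_M)
    show "x \<oplus>\<^bsub>local_ring\<^esub> y = y \<oplus>\<^bsub>local_ring\<^esub> x"
      using x y by (simp add: frac_add mult.commute add.commute)
    fix z assume "z \<in> carrier local_ring"
    then obtain c r where z: "r \<notin> M" "z = frac c r" using frac by blast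
    show "x \<oplus>\<^bsub>local_ring\<^esub> y \<oplus>\<^bsub>local_ring\<^esub> z = x \<oplus>\<^bsub>local_ring\<^esub> (y \<oplus>\<^bsub>local_ring\<^esub> z)"
      using x y z by (simp add: frac_add mult_notin_M algebra_simps)
  qed
  show "Group.comm_monoid local_ring"
  proof (rule comm_monoidI)
    show "\<one>\<^bsub>local_ring\<^esub> \<in> carrier local_ring"
      unfolding one_local_ring by (intro frac_in_carrier one_notin_M)
    fix x assume "x \<in> carrier local_ring"
    then obtain a s where x: "s \<notin> M" "x = frac a s" using frac by blast
    show "\<one>\<^bsub>local_ring\<^esub> \<otimes>\<^bsub>local_ring\<^esub> x = x"
      using x by (simp add: ops)
    fix y assume "y \<in> carrier local_ring"
    then obtain b t where y: "t \<notin> M" "y = frac b t" using frac by blast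
    show "x \<otimes>\<^bsub>local_ring\<^esub> y \<in> carrier local_ring"
      using x y by (simp add: frac_mult frac_in_carrier mult_notin_M)
    show "x \<otimes>\<^bsub>local_ring\<^esub> y = y \<otimes>\<^bsub>local_ring\<^esub> x"
      using x y by (simp add: frac_mult mult.commute)
    fix z assume "z \<in> carrier local_ring"
    then obtain c r where z: "r \<notin> M" "z = frac c r" using frac by blast
    show "x \<otimes>\<^bsub>local_ring\<^esub> y \<otimes>\<^bsub>local_ring\<^esub> z = x \<otimes>\<^bsub>local_ring\<^esub> (y \<otimes>\<^bsub>local_ring\<^esub> z)"
      using x y z by (simp add: frac_mult mult_notin_M mult.assoc)
  qed
  fix x y z assume "x \<in> carrier local_ring" "y \<in> carrier local_ring" "z \<in> carrier local_ring"
  then obtain a s b t c r where xyz: "s \<notin> M" "x = frac a s" "t \<notin> M" "y = frac b t" "r \<notin> M" "z = frac c r"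
    using frac by metis
  have "(x \<oplus>\<^bsub>local_ring\<^esub> y) \<otimes>\<^bsub>local_ring\<^esub> z = frac ((a * t + b * s) * c) (s * t * r)"
    using xyz by (simp add: frac_mult frac_add mult_notin_M)
  also have "\<dots> = frac (a * c * (t * r) + b * c * (s * r)) (s * r * (t * r))"
    using xyz by (intro frac_eqI' mult_notin_M) (simp_all add: algebra_simps)
  also have "\<dots> = x \<otimes>\<^bsub>local_ring\<^esub> z \<oplus>\<^bsub>local_ring\<^esub> y \<otimes>\<^bsub>local_ring\<^esub> z"
    using xyz by (simp add: frac_mult frac_add mult_notin_M)
  finally show "(x \<oplus>\<^bsub>local_ring\<^esub> y) \<otimes>\<^bsub>local_ring\<^esub> z = x \<otimes>\<^bsub>local_ring\<^esub> z \<oplus>\<^bsub>local_ring\<^esub> y \<otimes>\<^bsub>local_ring\<^esub> z" .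
qed

lemma ideal_at_fractions: "extend A = {frac a s | a s. a \<in> A \<and> s \<notin> M}"
  by (simp add: ideal_at_def ring_of_type_algebra_simps)

lemma frac_in_ideal_at: "a \<in> A \<Longrightarrow> s \<notin> M \<Longrightarrow> frac a s \<in> extend A"
  unfolding ideal_at_fractions by blast

text \<open>Extension to the local ring followed by contraction is saturation; this is the dictionary between
  ideals of the local ring and saturated ideals.\<close>

lemma in_ideal_at_iff:
  assumes A: "idl.subspace A" and s: "s \<notin> M"
  shows "frac a s \<in> extend A \<longleftrightarrow> a \<in> sat A"
proof
  assume "frac a s \<in> extend A"
  then obtain b t where b: "b \<in> A" "t \<notin> M" "frac a s = frac b t" by (auto simp: ideal_at_fractions)
  then obtain u where u: "u \<notin> M" "u * (t * a) = u * (s * b)" using s by (auto simp: frac_eq_iff)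
  have "(u * t) * a = (u * s) * b" using u by (simp add: mult.assoc)
  also have "\<dots> \<in> A" by (rule idl.subspace_scale[OF A b(1)])
  finally show "a \<in> sat A" using u b by (intro saturationI[of "u * t"] mult_notin_M)
next
  assume "a \<in> sat A"
  then obtain u where u: "u \<notin> M" "u * a \<in> A" by (rule saturationE)
  have "frac a s = frac (u * a) (u * s)"
    using u s by (intro frac_eqI' mult_notin_M) (auto simp: mult_ac)
  then show "frac a s \<in> extend A"
    using frac_in_ideal_at[OF u(2) mult_notin_M[OF u(1) s]] by simp
qed

lemma ideal_at_eq_iff:
  assumes "idl.subspace A" "idl.subspace B"
  shows "extend A = extend B \<longleftrightarrow>
    sat A = sat B"
proof
  assume eq: "extend A = extend B"
  show "sat A = sat B"
    using in_ideal_at_iff[OF assms(1) one_notin_M] in_ideal_at_iff[OF assms(2) one_notin_M] eq by auto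
next
  assume "sat A = sat B"
  then have "frac a s \<in> extend A \<longleftrightarrow> frac a s \<in> extend B"
    if "s \<notin> M" for a s
    using in_ideal_at_iff[OF assms(1) that] in_ideal_at_iff[OF assms(2) that] by simp
  moreover have "x \<in> extend C \<Longrightarrow> \<exists>a s. s \<notin> M \<and> x = frac a s" for x C
    by (auto simp: ideal_at_fractions)
  ultimately show "extend A = extend B" by blast
qed

lemma ideal_ideal_at:
  assumes A: "idl.subspace A"
  shows "ideal (extend A) local_ring"
proof (rule idealI)
  interpret L: cring local_ring by (rule cring_local_ring)
  show "ring local_ring" by (rule L.ring_axioms)
  note ops = frac_mult frac_add one_local_ring zero_local_ring mult_notin_M one_notin_M
  note closed = idl.subspace_add[OF A] idl.subspace_scale[OF A] subspace_mult_right[OF A]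
  show "subgroup (extend A) (add_monoid local_ring)"
  proof (rule L.add.subgroupI)
    show "extend A \<subseteq> carrier local_ring"
      by (auto simp: ideal_at_fractions carrier_local_ring)
    show "extend A \<noteq> {}"
      using idl.subspace_0[OF A] one_notin_M by (auto simp: ideal_at_fractions)
    fix x assume "x \<in> extend A"
    then obtain a s where x: "x = frac a s" "s \<notin> M" "a \<in> A" by (auto simp: ideal_at_fractions)
    have "\<ominus>\<^bsub>local_ring\<^esub> x = frac (- a) s"
    proof (rule L.minus_equality)
      show "frac (- a) s \<oplus>\<^bsub>local_ring\<^esub> x = \<zero>\<^bsub>local_ring\<^esub>"
        unfolding x(1) frac_add[OF x(2) x(2)] zero_local_ring
        using x(2) by (intro frac_eqI' mult_notin_M one_notin_M) simp_all
    qed (use x frac_in_carrier in auto)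
    then show "\<ominus>\<^bsub>local_ring\<^esub> x \<in> extend A"
      using x idl.subspace_neg[OF A] by (auto simp: ideal_at_fractions)
    fix y assume "y \<in> extend A"
    then obtain b t where y: "y = frac b t" "t \<notin> M" "b \<in> A" by (auto simp: ideal_at_fractions)
    have "a * t + b * s \<in> A" using x y by (intro closed)
    then show "x \<oplus>\<^bsub>local_ring\<^esub> y \<in> extend A"
      using x y mult_notin_M by (auto simp: frac_add ideal_at_fractions)
  qed
  fix x y assume "x \<in> extend A" "y \<in> carrier local_ring"
  then obtain a s b t where *: "x = frac a s" "s \<notin> M" "a \<in> A" "y = frac b t" "t \<notin> M"
    by (auto simp: ideal_at_fractions carrier_local_ring)
  have "frac (b * a) (t * s) \<in> extend A"
    using * by (intro frac_in_ideal_at mult_notin_M closed)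
  then show "y \<otimes>\<^bsub>local_ring\<^esub> x \<in> extend A"
    and "x \<otimes>\<^bsub>local_ring\<^esub> y \<in> extend A"
    using * by (simp_all add: frac_mult mult.commute)
qed

lemma genideal_fractions:
  assumes G: "\<And>g s. (g, s) \<in> G \<Longrightarrow> s \<notin> M"
  shows "genideal local_ring ((\<lambda>(g, s). frac g s) ` G) =
    extend (idl.span (fst ` G))"
proof
  interpret L: cring local_ring by (rule cring_local_ring)
  let ?G = "(\<lambda>(g, s). frac g s) ` G"
  let ?E = "extend (idl.span (fst ` G))"
  have carr: "?G \<subseteq> carrier local_ring" using G by (auto simp: carrier_local_ring)
  have "g \<in> idl.span (fst ` G)" if "(g, s) \<in> G" for g s
    using that by (intro idl.span_base) force
  then have "?G \<subseteq> ?E" using G by (fastforce simp: ideal_at_fractions)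
  then show "genideal local_ring ?G \<subseteq> ?E"
    by (intro L.genideal_minimal ideal_ideal_at idl.subspace_span)
  have I: "ideal (genideal local_ring ?G) local_ring" by (rule L.genideal_ideal[OF carr])
  have "frac a s \<in> genideal local_ring ?G" if "a \<in> idl.span (fst ` G)" "s \<notin> M" for a s
    using that
  proof (induction rule: idl.span_induct_alt)
    case base
    have "frac 0 s = \<zero>\<^bsub>local_ring\<^esub>"
      unfolding zero_local_ring using base one_notin_M by (intro frac_eqI') auto
    then show ?case using additive_subgroup.zero_closed[OF ideal.axioms(1)[OF I]] by simp
  next
    case (step c g y)
    then obtain t where t: "(g, t) \<in> G" "t \<notin> M" using G by auto
    have "frac (c * g + y) s = frac (c * t) s \<otimes>\<^bsub>local_ring\<^esub> frac g t \<oplus>\<^bsub>local_ring\<^esub> frac y s"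
    proof -
      have "frac (c * t) s \<otimes>\<^bsub>local_ring\<^esub> frac g t \<oplus>\<^bsub>local_ring\<^esub> frac y s =
          frac (c * t * g * s + y * (s * t)) (s * t * s)"
        using step.prems t by (simp add: frac_mult frac_add mult_notin_M)
      also have "\<dots> = frac (c * g + y) s"
        using step.prems t by (intro frac_eqI' mult_notin_M) (simp_all add: algebra_simps)
      finally show ?thesis by simp
    qed
    moreover have "frac g t \<in> genideal local_ring ?G"
      using L.genideal_self[OF carr] t by force
    then have "frac (c * t) s \<otimes>\<^bsub>local_ring\<^esub> frac g t \<in> genideal local_ring ?G"
      by (rule ideal.I_l_closed[OF I]) (rule frac_in_carrier[OF step.prems])
    ultimately show ?case
      using additive_subgroup.a_closed[OF ideal.axioms(1)[OF I]] step by simp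
  qed
  then show "?E \<subseteq> genideal local_ring ?G" by (auto simp: ideal_at_fractions)
qed

lemma saturated_zero: "sat {0} = sat (idl.span (sat {0}))"
  using saturation_span_insert_saturation[of "{}" "{}"] by simp

lemma foldl_adjoin_zero: "foldl (adjoin M) (sat {0}) gs = sat (idl.span (set gs))"
  unfolding foldl_adjoin[OF saturated_zero] using saturation_span_insert_saturation[of "set gs" "{}"] by simp

text \<open>Regularity of fractions is regularity of the numerators, because denominators are units.\<close>

lemma regular_sequence_fractions_iff:
  fixes ps :: "('a \<times> 'a) list"
  defines "gs \<equiv> map fst ps"
  assumes ps: "\<And>g s. (g, s) \<in> set ps \<Longrightarrow> s \<notin> M"
  shows "regular_sequence local_ring (map (\<lambda>(g, s). frac g s) ps) \<longleftrightarrow>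
    regular_mod M (sat {0}) gs \<and> 1 \<notin> sat (idl.span (set gs))"
proof -
  interpret L: cring local_ring by (rule cring_local_ring)
  let ?xs = "map (\<lambda>(g, s). frac g s) ps"
  have carr: "set ?xs \<subseteq> carrier local_ring" using ps by (auto simp: carrier_local_ring)
  have gen: "genideal local_ring (set (take i ?xs)) =
      extend (idl.span (set (take i gs)))" for i
    using genideal_fractions[of "set (take i ps)"] ps set_take_subset[of i ps]
    by (auto simp: take_map gs_def)
  have gen': "genideal local_ring (set ?xs) = extend (idl.span (set gs))"
    using gen[of "length ps"] by (simp add: gs_def)
  have reg: "(\<forall>y \<in> carrier local_ring. ?xs ! i \<otimes>\<^bsub>local_ring\<^esub> y \<in> genideal local_ring (set (take i ?xs)) \<longrightarrow>
        y \<in> genideal local_ring (set (take i ?xs))) \<longleftrightarrow>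
      nonzerodivisor_mod (foldl (adjoin M) (sat {0}) (take i gs)) (gs ! i)"
    if i: "i < length ps" for i
  proof -
    obtain g s where gs: "ps ! i = (g, s)" by (cases "ps ! i")
    then have s: "s \<notin> M" using ps i by (metis nth_mem)
    have "?xs ! i \<otimes>\<^bsub>local_ring\<^esub> frac b t \<in> genideal local_ring (set (take i ?xs)) \<longleftrightarrow>
        g * b \<in> sat (idl.span (set (take i gs)))" if "t \<notin> M" for b t
      unfolding gen using i gs s that by (simp add: frac_mult in_ideal_at_iff mult_notin_M)
    moreover have "frac b t \<in> genideal local_ring (set (take i ?xs)) \<longleftrightarrow>
        b \<in> sat (idl.span (set (take i gs)))" if "t \<notin> M" for b t
      unfolding gen using that by (simp add: in_ideal_at_iff)
    moreover have "gs ! i = g" using i gs by (simp add: gs_def)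
    ultimately show ?thesis
      unfolding nonzerodivisor_mod_def foldl_adjoin_zero carrier_local_ring using one_notin_M by blast
  qed
  have "genideal local_ring (set ?xs) \<noteq> carrier local_ring \<longleftrightarrow> 1 \<notin> sat (idl.span (set gs))"
  proof -
    have I: "ideal (genideal local_ring (set ?xs)) local_ring" by (rule L.genideal_ideal[OF carr])
    have "genideal local_ring (set ?xs) = carrier local_ring \<longleftrightarrow> \<one>\<^bsub>local_ring\<^esub> \<in> genideal local_ring (set ?xs)"
      using ideal.one_imp_carrier[OF I] by auto
    then show ?thesis
      unfolding gen' one_local_ring using in_ideal_at_iff[OF idl.subspace_span one_notin_M] by auto
  qed
  then show ?thesis
    unfolding regular_sequence_def regular_mod_iff using carr reg by (simp add: gs_def)
qed

text \<open>Generators of an ideal of the local ring may be taken to be numerators, with denominator 1.\<close>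

theorem locally_complete_intersection_iff:
  assumes I: "idl.subspace I"
  shows "(\<exists>xs. regular_sequence local_ring xs \<and>
      extend I = genideal local_ring (set xs)) \<longleftrightarrow>
    (\<exists>gs. regular_mod M (sat {0}) gs \<and> 1 \<notin> sat (idl.span (set gs)) \<and>
      sat I = sat (idl.span (set gs)))"
proof
  assume "\<exists>xs. regular_sequence local_ring xs \<and>
      extend I = genideal local_ring (set xs)"
  then obtain xs where xs: "regular_sequence local_ring xs"
    "extend I = genideal local_ring (set xs)" by blast
  have "\<exists>p. snd p \<notin> M \<and> x = (\<lambda>(g, s). frac g s) p" if "x \<in> set xs" for x
  proof -
    have "x \<in> carrier local_ring" using xs(1) that by (auto simp: regular_sequence_def)
    then obtain g s where "s \<notin> M" "x = frac g s" by (auto simp: carrier_local_ring)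
    then show ?thesis by (intro exI[of _ "(g, s)"]) simp
  qed
  then obtain P where P: "\<And>x. x \<in> set xs \<Longrightarrow> snd (P x) \<notin> M \<and> x = (\<lambda>(g, s). frac g s) (P x)" by metis
  define ps where "ps = map P xs"
  have xs_eq: "xs = map (\<lambda>(g, s). frac g s) ps"
    unfolding ps_def map_map by (rule map_idI[symmetric]) (use P in simp)
  have ps: "s \<notin> M" if "(g, s) \<in> set ps" for g s
    using that P by (force simp: ps_def)
  have "genideal local_ring (set xs) = extend (idl.span (set (map fst ps)))"
    using genideal_fractions[of "set ps"] ps by (simp add: xs_eq)
  then have "sat I = sat (idl.span (set (map fst ps)))"
    using xs(2) ideal_at_eq_iff[OF I] by simp
  then show "\<exists>gs. regular_mod M (sat {0}) gs \<and> 1 \<notin> sat (idl.span (set gs)) \<and>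
      sat I = sat (idl.span (set gs))"
    using xs(1) regular_sequence_fractions_iff[of ps] ps unfolding xs_eq by blast
next
  assume "\<exists>gs. regular_mod M (sat {0}) gs \<and> 1 \<notin> sat (idl.span (set gs)) \<and>
      sat I = sat (idl.span (set gs))"
  then obtain gs where gs: "regular_mod M (sat {0}) gs" "1 \<notin> sat (idl.span (set gs))"
    "sat I = sat (idl.span (set gs))" by blast
  let ?ps = "map (\<lambda>g. (g, 1 :: 'a)) gs"
  have ps: "s \<notin> M" if "(g, s) \<in> set ?ps" for g s using that one_notin_M by auto
  have fst_ps: "map fst ?ps = gs" by (induction gs) auto
  have "genideal local_ring ((\<lambda>(g, s). frac g s) ` set ?ps) =
      extend (idl.span (fst ` set ?ps))"
    by (rule genideal_fractions) (rule ps)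
  moreover have "fst ` set ?ps = set gs" by (metis list.set_map fst_ps)
  ultimately have "genideal local_ring (set (map (\<lambda>(g, s). frac g s) ?ps)) =
      extend (idl.span (set gs))"
    by (simp only: list.set_map)
  moreover have "extend I = extend (idl.span (set gs))"
    using gs(3) ideal_at_eq_iff[OF I] by simp
  moreover have "regular_sequence local_ring (map (\<lambda>(g, s). frac g s) ?ps)"
    by (subst regular_sequence_fractions_iff[of ?ps, OF ps], assumption)
      (use gs(1,2) in \<open>simp only: fst_ps simp_thms\<close>)
  ultimately show "\<exists>xs. regular_sequence local_ring xs \<and>
      extend I = genideal local_ring (set xs)"
    by (intro exI[of _ "map (\<lambda>(g, s). frac g s) ?ps"] conjI) (simp_all only:)
qed

end

section \<open>Symmetric algebra and Rees algebra\<close>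

lemma cring_subring_set:
  assumes B: "subring_set (B :: 'a::comm_ring_1 set)"
  shows "cring (ring_of_type_algebra \<lparr> carrier := B \<rparr>)"
proof (rule cringI)
  note simps = ring_of_type_algebra_def subring_setD[OF B]
  show "abelian_group (ring_of_type_algebra \<lparr> carrier := B \<rparr>)"
  proof (rule abelian_groupI)
    fix x assume x: "x \<in> carrier (ring_of_type_algebra \<lparr> carrier := B \<rparr>)"
    then show "\<exists>y\<in>carrier (ring_of_type_algebra \<lparr> carrier := B \<rparr>).
        y \<oplus>\<^bsub>ring_of_type_algebra \<lparr> carrier := B \<rparr>\<^esub> x = \<zero>\<^bsub>ring_of_type_algebra \<lparr> carrier := B \<rparr>\<^esub>"
      by (intro bexI[of _ "- x"]) (simp_all add: simps)
  qed (simp_all add: simps add.assoc add.commute)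
  show "Group.comm_monoid (ring_of_type_algebra \<lparr> carrier := B \<rparr>)"
    by (rule comm_monoidI) (simp_all add: simps mult.assoc mult.commute)
qed (simp_all add: ring_of_type_algebra_def distrib_right)

lemma mpoly_ring_on_eq: "mpoly_ring_on V = ring_of_type_algebra \<lparr> carrier := polys_in V \<rparr>"
  by (simp add: mpoly_ring_on_def polys_in_def)

lemma mpoly_ring_on_simps [simp]:
  "carrier (mpoly_ring_on V :: ('v, 'a::comm_ring_1) mpoly ring) = polys_in V"
  "x \<otimes>\<^bsub>mpoly_ring_on V\<^esub> y = (x * y :: ('v, 'a) mpoly)"
  "x \<oplus>\<^bsub>mpoly_ring_on V\<^esub> y = (x + y :: ('v, 'a) mpoly)"
  "\<one>\<^bsub>mpoly_ring_on V\<^esub> = (1 :: ('v, 'a) mpoly)"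
  "\<zero>\<^bsub>mpoly_ring_on V\<^esub> = (0 :: ('v, 'a) mpoly)"
  by (simp_all add: mpoly_ring_on_eq ring_of_type_algebra_def)

lemma cring_mpoly_ring_on: "cring (mpoly_ring_on V)"
  unfolding mpoly_ring_on_eq by (rule cring_subring_set[OF subring_set_polys_in])

subsection \<open>Powers of an ideal\<close>

primrec ideal_power :: "'a::comm_ring_1 set \<Rightarrow> nat \<Rightarrow> 'a set" where
  "ideal_power I 0 = UNIV"
| "ideal_power I (Suc n) = idl.span {x * y | x y. x \<in> ideal_power I n \<and> y \<in> I}"

lemma subspace_ideal_power [simp]: "idl.subspace (ideal_power I n)"
  by (cases n) auto

lemma ideal_prod_eq_span:
  assumes A: "idl.subspace A" and B: "idl.subspace (B :: 'a::comm_ring_1 set)"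
  shows "ideal_prod ring_of_type_algebra A B = idl.span {x * y | x y. x \<in> A \<and> y \<in> B}"
proof
  show "ideal_prod ring_of_type_algebra A B \<subseteq> idl.span {x * y | x y. x \<in> A \<and> y \<in> B}"
  proof
    fix z assume "z \<in> ideal_prod ring_of_type_algebra A B"
    then show "z \<in> idl.span {x * y | x y. x \<in> A \<and> y \<in> B}"
      by (induction rule: ideal_prod.induct)
        (auto simp: ring_of_type_algebra_simps intro: idl.span_add idl.span_base)
  qed
  show "idl.span {x * y | x y. x \<in> A \<and> y \<in> B} \<subseteq> ideal_prod ring_of_type_algebra A B"
  proof
    fix z assume "z \<in> idl.span {x * y | x y. x \<in> A \<and> y \<in> B}"
    then show "z \<in> ideal_prod ring_of_type_algebra A B"
    proof (induction rule: idl.span_induct_alt)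
      case base
      show ?case
        using ideal_prod.prod[OF idl.subspace_0[OF A] idl.subspace_0[OF B], of ring_of_type_algebra]
        by (simp add: ring_of_type_algebra_simps)
    next
      case (step c z w)
      then obtain x y where xy: "z = x * y" "x \<in> A" "y \<in> B" by auto
      then have "(c * x) * y \<in> ideal_prod ring_of_type_algebra A B"
        using ideal_prod.prod[OF idl.subspace_scale[OF A xy(2), of c] xy(3), of ring_of_type_algebra]
        by (simp add: ring_of_type_algebra_simps)
      then show ?case
        using ideal_prod.sum[of _ ring_of_type_algebra A B, OF _ step.IH] xy(1)
        by (simp add: ring_of_type_algebra_simps mult.assoc)
    qed
  qed
qed

lemma ideals_set_power_eq:
  assumes "idl.subspace I"
  shows "I [^]\<^bsub>ideals_set ring_of_type_algebra\<^esub> (n :: nat) = ideal_power I n"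
  by (induction n)
    (simp_all add: nat_pow_def ideals_set_def ring_of_type_algebra_simps ideal_prod_eq_span assms)

lemma ideal_power_mult:
  assumes I: "idl.subspace I" and "x \<in> ideal_power I m" "y \<in> ideal_power I n"
  shows "x * y \<in> ideal_power I (m + n)"
  using assms(3)
proof (induction n arbitrary: y)
  case 0
  then show ?case using subspace_mult_right[OF subspace_ideal_power assms(2)] by simp
next
  case (Suc n)
  from Suc.prems have "y \<in> idl.span {x * y | x y. x \<in> ideal_power I n \<and> y \<in> I}" by simp
  then show ?case
  proof (induction rule: idl.span_induct_alt)
    case base
    show ?case by (simp add: idl.span_zero)
  next
    case (step c z w)
    then obtain a b where ab: "z = a * b" "a \<in> ideal_power I n" "b \<in> I" by auto
    have "(x * a) * b \<in> ideal_power I (m + Suc n)"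
      using Suc.IH[OF ab(2)] ab(3) by (auto intro: idl.span_base)
    then have "c * ((x * a) * b) + x * w \<in> ideal_power I (m + Suc n)"
      by (rule idl.subspace_add[OF subspace_ideal_power idl.subspace_scale[OF subspace_ideal_power] step.IH])
    then show ?case by (simp add: ab(1) algebra_simps)
  qed
qed

lemma ideal_power_one: "idl.subspace I \<Longrightarrow> x \<in> I \<Longrightarrow> x \<in> ideal_power I 1"
  unfolding One_nat_def ideal_power.simps
  by (rule idl.span_base, intro CollectI exI[of _ 1] exI[of _ x]) simp

definition rees_ring :: "'a::comm_ring_1 set \<Rightarrow> 'a poly set" where
  "rees_ring I = {p. \<forall>t. coeff p t \<in> ideal_power I t}"

lemma rees_algebra_eq: "idl.subspace I \<Longrightarrow> rees_algebra I = ring_of_type_algebra \<lparr> carrier := rees_ring I \<rparr>"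
  by (simp add: rees_algebra_def rees_ring_def ideals_set_power_eq)

lemma subring_set_rees_ring:
  assumes I: "idl.subspace I"
  shows "subring_set (rees_ring I)"
proof -
  have "p * q \<in> rees_ring I" if "p \<in> rees_ring I" "q \<in> rees_ring I" for p q
    unfolding rees_ring_def mem_Collect_eq coeff_mult
  proof (intro allI idl.subspace_sum subspace_ideal_power)
    fix t i :: nat assume "i \<in> {..t}"
    then show "coeff p i * coeff q (t - i) \<in> ideal_power I t"
      using ideal_power_mult[OF I, of "coeff p i" i "coeff q (t - i)" "t - i"] that
      by (simp add: rees_ring_def)
  qed
  moreover have "1 \<in> rees_ring I"
    by (auto simp: rees_ring_def coeff_1 intro: idl.subspace_0)
  ultimately show ?thesis
    by (auto simp: subring_set_def rees_ring_def intro: idl.subspace_add idl.subspace_diff)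
qed

lemma monom_in_rees_ring: "x \<in> ideal_power I t \<Longrightarrow> monom x t \<in> rees_ring I"
  by (auto simp: rees_ring_def intro: idl.subspace_0)

subsection \<open>The canonical map\<close>

abbreviation rees_map :: "('a::comm_ring_1, 'a) mpoly \<Rightarrow> 'a poly" where
  "rees_map \<equiv> mpoly_subst (\<lambda>c. [:c:]) (\<lambda>u. monom u 1)"

lemma coeff_hom_rees_map: "coeff_hom rees_map"
  by (rule coeff_hom.coeff_hom_subst[OF coeff_hom_pCons])

lemmas rees_map_simps = coeff_hom.hom_simps[OF coeff_hom_rees_map]
  coeff_hom.subst_mconst[OF coeff_hom_pCons] coeff_hom.subst_mvar[OF coeff_hom_pCons]

definition total_degree :: "('v \<Rightarrow>\<^sub>0 nat) \<Rightarrow> nat" where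
  "total_degree m = (\<Sum>v\<in>keys m. lookup m v)"

lemma total_degree_superset:
  "finite A \<Longrightarrow> keys m \<subseteq> A \<Longrightarrow> total_degree m = (\<Sum>v\<in>A. lookup m v)"
  unfolding total_degree_def by (rule sum.mono_neutral_left) (auto simp: in_keys_iff)

lemma total_degree_add: "total_degree (m + n) = total_degree m + total_degree n"
proof -
  let ?A = "keys m \<union> keys n"
  have k: "keys (m + n) \<subseteq> ?A" by (rule keys_add)
  show ?thesis
    by (simp add: total_degree_superset[of ?A] k lookup_add sum.distrib)
qed

lemma total_degree_single [simp]: "total_degree (single v n) = n"
  by (simp add: total_degree_def)

lemma total_degree_zero [simp]: "total_degree 0 = 0"
  by (simp add: total_degree_def)

lemma total_degree_eq_0_iff [simp]: "total_degree m = 0 \<longleftrightarrow> m = 0"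
  by (auto simp: total_degree_def in_keys_iff poly_mapping_eq_iff fun_eq_iff)

lemma monom_eval_monom:
  "monom_eval (\<lambda>v. monom (x v) 1) m = monom (monom_eval x m) (total_degree m)"
proof -
  have "(\<Prod>v\<in>A. monom (x v) 1 ^ lookup m v) =
      monom (\<Prod>v\<in>A. x v ^ lookup m v) (\<Sum>v\<in>A. lookup m v)" for A
    by (induction A rule: infinite_finite_induct) (auto simp: monom_power mult_monom monom_0 one_pCons)
  then show ?thesis by (simp add: monom_eval_def total_degree_def)
qed

lemma rees_map_single:
  "rees_map (single m c) = monom (c * monom_eval (\<lambda>u. u) m) (total_degree m)"
  by (simp add: coeff_hom.subst_single[OF coeff_hom_pCons] monom_eval_monom smult_monom)

lemma monom_eval_in_ideal_power:
  assumes I: "idl.subspace I" and "keys m \<subseteq> I"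
  shows "monom_eval (\<lambda>u. u) m \<in> ideal_power I (total_degree m)"
proof -
  have pw: "u ^ n \<in> ideal_power I n" if "u \<in> I" for u n
  proof (induction n)
    case (Suc n)
    then show ?case
      using ideal_power_mult[OF I ideal_power_one[OF I that], of "u ^ n" n]
      unfolding plus_1_eq_Suc power_Suc by blast
  qed simp
  have "(\<Prod>v\<in>A. v ^ lookup m v) \<in> ideal_power I (\<Sum>v\<in>A. lookup m v)"
    if "A \<subseteq> I" for A
    using that
    by (induction A rule: infinite_finite_induct) (auto intro!: ideal_power_mult[OF I] pw)
  then show ?thesis using assms(2) by (simp add: monom_eval_def total_degree_def)
qed

text \<open>An element of \<open>I\<^sup>t\<close> is a combination of products of \<open>t\<close> elements of \<open>I\<close>, and such a product in degree
  \<open>t\<close> is the image of a product of \<open>t\<close> variables.\<close>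

lemma rees_map_image:
  assumes I: "idl.subspace I"
  shows "rees_map ` polys_in I = rees_ring I"
proof (intro equalityI subsetI)
  fix q assume "q \<in> rees_map ` polys_in I"
  then obtain p where p: "p \<in> polys_in I" "q = rees_map p" by blast
  from p(1) have "rees_map p \<in> rees_ring I"
  proof (induction rule: polys_in_induct)
    case (monomial m c)
    then show ?case
      unfolding rees_map_single
      by (intro monom_in_rees_ring idl.subspace_scale subspace_ideal_power monom_eval_in_ideal_power I)
  next
    case (add q r)
    then show ?case by (simp add: rees_map_simps subring_setD[OF subring_set_rees_ring[OF I]])
  qed
  then show "q \<in> rees_ring I" by (simp add: p)
next
  have mon: "monom x t \<in> rees_map ` polys_in I" if "x \<in> ideal_power I t" for x t
    using that
  proof (induction t arbitrary: x)
    case 0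
    have "monom x 0 = rees_map (mconst x)" by (simp add: rees_map_simps monom_0)
    then show ?case using mconst_in_polys_in by blast
  next
    case (Suc t)
    from Suc.prems have "x \<in> idl.span {x * y | x y. x \<in> ideal_power I t \<and> y \<in> I}" by simp
    then show ?case
    proof (induction rule: idl.span_induct_alt)
      case base
      have "monom 0 (Suc t) = rees_map 0" by simp
      then show ?case using polys_in_closed(2) by blast
    next
      case (step c z w)
      then obtain a b where ab: "z = a * b" "a \<in> ideal_power I t" "b \<in> I" by auto
      obtain p q where p: "p \<in> polys_in I" "monom (c * a) t = rees_map p"
        and q: "q \<in> polys_in I" "monom w (Suc t) = rees_map q"
        using Suc.IH[OF idl.subspace_scale[OF subspace_ideal_power ab(2)]] step.IH by blast
      have "monom (c * z + w) (Suc t) = monom (c * a) t * monom b 1 + monom w (Suc t)"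
        by (simp add: ab mult_monom add_monom mult.assoc flip: Suc_eq_plus1)
      also have "\<dots> = rees_map (p * mvar b + q)"
        by (simp only: rees_map_simps p(2) q(2))
      finally have "monom (c * z + w) (Suc t) = rees_map (p * mvar b + q)" .
      moreover have "p * mvar b + q \<in> polys_in I"
        by (intro polys_in_closed(3,5) p q mvar_in_polys_in ab)
      ultimately show ?case by blast
    qed
  qed
  fix q assume "q \<in> rees_ring I"
  then have "\<forall>t. \<exists>p. p \<in> polys_in I \<and> monom (coeff q t) t = rees_map p"
    using mon unfolding rees_ring_def by blast
  then obtain p where p: "\<And>t. p t \<in> polys_in I" "\<And>t. monom (coeff q t) t = rees_map (p t)"
    by metis
  have "q = rees_map (\<Sum>t\<le>degree q. p t)"
    unfolding coeff_hom.hom_sum[OF coeff_hom_rees_map] p(2)[symmetric]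
    by (rule poly_as_sum_of_monoms[symmetric])
  then show "q \<in> rees_map ` polys_in I"
    using subring_set_sum[OF subring_set_polys_in, of "{..degree q}" p I] p(1) by blast
qed

abbreviation sym_ideal :: "'a::comm_ring_1 set \<Rightarrow> ('a, 'a) mpoly set" where
  "sym_ideal I \<equiv> genideal (mpoly_ring_on I) (sym_relations I)"

context
  fixes I :: "'a::comm_ring_1 set"
  assumes I: "idl.subspace I"
begin

lemma sym_relations_in_polys_in: "sym_relations I \<subseteq> polys_in I"
  using idl.subspace_add[OF I] idl.subspace_scale[OF I]
  by (auto simp: sym_relations_def
    intro!: polys_in_closed(3-5) mvar_in_polys_in mconst_in_polys_in)

lemma ideal_sym_ideal: "ideal (sym_ideal I) (mpoly_ring_on I)"
  using cring.axioms(1)[OF cring_mpoly_ring_on] sym_relations_in_polys_in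
  by (intro ring.genideal_ideal) simp_all

lemma sym_ideal_closed:
  shows "0 \<in> sym_ideal I"
    and "p \<in> sym_ideal I \<Longrightarrow> q \<in> sym_ideal I \<Longrightarrow> p + q \<in> sym_ideal I"
    and "p \<in> sym_ideal I \<Longrightarrow> q \<in> polys_in I \<Longrightarrow> q * p \<in> sym_ideal I"
    and "p \<in> sym_ideal I \<Longrightarrow> p \<in> polys_in I"
  using additive_subgroup.zero_closed[OF ideal.axioms(1)[OF ideal_sym_ideal]]
    additive_subgroup.a_closed[OF ideal.axioms(1)[OF ideal_sym_ideal], of p q]
    ideal.I_l_closed[OF ideal_sym_ideal, of p q] ideal.Icarr[OF ideal_sym_ideal, of p]
  by simp_all

lemma sym_ideal_uminus: "p \<in> sym_ideal I \<Longrightarrow> - p \<in> sym_ideal I"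
  using sym_ideal_closed(3)[OF _ subring_setD(6)[OF subring_set_polys_in polys_in_closed(1)]]
  by simp

lemma sym_ideal_diff: "p \<in> sym_ideal I \<Longrightarrow> q \<in> sym_ideal I \<Longrightarrow> p - q \<in> sym_ideal I"
  using sym_ideal_closed(2)[OF _ sym_ideal_uminus] by fastforce

lemma sym_ideal_sum: "(\<And>i. i \<in> A \<Longrightarrow> g i \<in> sym_ideal I) \<Longrightarrow> sum g A \<in> sym_ideal I"
  by (induction A rule: infinite_finite_induct) (auto simp: sym_ideal_closed)

lemma sym_relation_in_sym_ideal: "p \<in> sym_relations I \<Longrightarrow> p \<in> sym_ideal I"
  using ring.genideal_self[OF cring.axioms(1)[OF cring_mpoly_ring_on], of "sym_relations I" I]
    sym_relations_in_polys_in by auto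

lemma hom_vanishes_on_sym_ideal:
  fixes \<Phi> :: "('a, 'a) mpoly \<Rightarrow> 'b::comm_ring_1"
  assumes h: "coeff_hom \<Phi>" and r: "\<And>p. p \<in> sym_relations I \<Longrightarrow> \<Phi> p = 0" and p: "p \<in> sym_ideal I"
  shows "\<Phi> p = 0"
proof -
  interpret h: coeff_hom \<Phi> by fact
  interpret S: cring "mpoly_ring_on I :: ('a, 'a) mpoly ring" by (rule cring_mpoly_ring_on)
  let ?K = "{p \<in> polys_in I. \<Phi> p = 0}"
  have "ideal ?K (mpoly_ring_on I)"
  proof (rule idealI)
    show "ring (mpoly_ring_on I :: ('a, 'a) mpoly ring)" by (rule S.ring_axioms)
    show "subgroup ?K (add_monoid (mpoly_ring_on I))"
    proof (rule S.add.subgroupI)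
      fix a assume a: "a \<in> ?K"
      have "\<ominus>\<^bsub>mpoly_ring_on I\<^esub> a = - a"
        using a polys_in_closed(6) by (intro S.minus_equality) auto
      then show "\<ominus>\<^bsub>mpoly_ring_on I\<^esub> a \<in> ?K"
        using a polys_in_closed(6) by (auto simp: h.hom_uminus)
    next
      have "0 \<in> ?K" by (simp add: h.hom_zero polys_in_closed)
      then show "?K \<noteq> {}" by blast
    qed (auto simp: h.hom_simps polys_in_closed)
  qed (auto simp: h.hom_simps polys_in_closed)
  moreover have "sym_relations I \<subseteq> ?K" using r sym_relations_in_polys_in by blast
  ultimately have "sym_ideal I \<subseteq> ?K" by (rule S.genideal_minimal)
  then show ?thesis using p by blast
qed

lemma rees_map_sym_relations: "p \<in> sym_relations I \<Longrightarrow> rees_map p = 0"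
  by (auto simp: sym_relations_def rees_map_simps add_monom[symmetric] smult_monom)

lemma rees_map_sym_ideal: "p \<in> sym_ideal I \<Longrightarrow> rees_map p = 0"
  by (rule hom_vanishes_on_sym_ideal[OF coeff_hom_rees_map rees_map_sym_relations])

text \<open>The canonical map is surjective for every ideal, so linear type amounts to injectivity: the
  kernel of the evaluation \<open>T\<^sub>u \<mapsto> u t\<close> is generated by the linear relations.\<close>

theorem linear_type_iff:
  "linear_type I \<longleftrightarrow> (\<forall>p\<in>polys_in I. rees_map p = 0 \<longrightarrow> p \<in> sym_ideal I)"
proof
  interpret S: cring "mpoly_ring_on I :: ('a, 'a) mpoly ring" by (rule cring_mpoly_ring_on)
  interpret R: cring "rees_algebra I"
    unfolding rees_algebra_eq[OF I] by (rule cring_subring_set[OF subring_set_rees_ring[OF I]])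
  have carr: "carrier (rees_algebra I) = rees_ring I" by (simp add: rees_algebra_eq[OF I])
  interpret E: ring_hom_ring "mpoly_ring_on I" "rees_algebra I" rees_map
  proof (rule ring_hom_ringI)
    show "\<And>x. x \<in> carrier (mpoly_ring_on I) \<Longrightarrow> rees_map x \<in> carrier (rees_algebra I)"
      using rees_map_image[OF I] carr by auto
  qed (unfold_locales, simp_all add: rees_map_simps rees_algebra_eq[OF I] ring_of_type_algebra_def)
  {
    assume ker: "\<forall>p\<in>polys_in I. rees_map p = 0 \<longrightarrow> p \<in> sym_ideal I"
    have zero: "\<zero>\<^bsub>rees_algebra I\<^esub> = 0" by (simp add: rees_algebra_eq[OF I] ring_of_type_algebra_def)
    have "a_kernel (mpoly_ring_on I) (rees_algebra I) rees_map = sym_ideal I"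
      unfolding a_kernel_def' zero mpoly_ring_on_simps
      using ker rees_map_sym_ideal sym_ideal_closed(4) by blast
    then show "linear_type I"
      using E.FactRing_iso_set rees_map_image[OF I] carr
      by (simp add: linear_type_def sym_algebra_def sym_to_rees_def[abs_def])
  }
  assume lt: "linear_type I"
  show "\<forall>p\<in>polys_in I. rees_map p = 0 \<longrightarrow> p \<in> sym_ideal I"
  proof (intro ballI impI)
    fix p assume p: "p \<in> polys_in I" "rees_map p = 0"
    let ?c = "\<lambda>p. sym_ideal I +>\<^bsub>mpoly_ring_on I\<^esub> p"
    have inj: "inj_on sym_to_rees (carrier (sym_algebra I))"
      using lt by (auto simp: linear_type_def ring_iso_def bij_betw_def)
    have coset: "?c q = (\<lambda>l. l + q) ` sym_ideal I" for q
      by (auto simp: a_r_coset_def')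
    have in_carr: "?c q \<in> carrier (sym_algebra I)" if "q \<in> polys_in I" for q
      using that by (auto simp: sym_algebra_def FactRing_def A_RCOSETS_def')
    have val: "sym_to_rees (?c q) = rees_map q" for q
    proof -
      have "rees_map ` ?c q = (\<lambda>_. rees_map q) ` sym_ideal I"
        unfolding coset image_image by (intro image_cong) (simp_all add: rees_map_simps rees_map_sym_ideal)
      also have "\<dots> = {rees_map q}" using sym_ideal_closed(1) by auto
      finally show ?thesis by (simp add: sym_to_rees_def)
    qed
    have "?c p = ?c 0"
      using p subring_setD(2)[OF subring_set_polys_in, of I]
      by (intro inj_onD[OF inj] in_carr) (simp_all add: val)
    moreover have "p \<in> ?c p" unfolding coset using sym_ideal_closed(1) by force
    ultimately show "p \<in> sym_ideal I" unfolding coset by auto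
  qed
qed

lemma mvar_zero_in_sym_ideal: "mvar 0 \<in> sym_ideal I"
proof -
  have "mvar (0 * 0) - mconst 0 * mvar 0 \<in> sym_relations I"
    using idl.subspace_0[OF I] unfolding sym_relations_def by blast
  then show ?thesis using sym_relation_in_sym_ideal by fastforce
qed

lemma mvar_scale_in_sym_ideal: "u \<in> I \<Longrightarrow> mvar (c * u) - mconst c * mvar u \<in> sym_ideal I"
  by (rule sym_relation_in_sym_ideal) (auto simp: sym_relations_def)

lemma mvar_add_in_sym_ideal: "u \<in> I \<Longrightarrow> v \<in> I \<Longrightarrow> mvar (u + v) - (mvar u + mvar v) \<in> sym_ideal I"
  by (rule sym_relation_in_sym_ideal) (auto simp: sym_relations_def)

lemma mvar_lin_comb_in_sym_ideal:
  assumes "\<And>i. i \<in> A \<Longrightarrow> g i \<in> I"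
  shows "mvar (\<Sum>i\<in>A. c i * g i) - (\<Sum>i\<in>A. mconst (c i) * mvar (g i)) \<in> sym_ideal I"
  using assms
proof (induction A rule: infinite_finite_induct)
  case (insert i A)
  have mem: "c i * g i \<in> I" "(\<Sum>i\<in>A. c i * g i) \<in> I"
    using insert.prems by (auto intro!: idl.subspace_scale[OF I] idl.subspace_sum[OF I])
  have IH: "mvar (\<Sum>i\<in>A. c i * g i) - (\<Sum>i\<in>A. mconst (c i) * mvar (g i)) \<in> sym_ideal I"
    using insert by auto
  have "mvar (c i * g i + (\<Sum>i\<in>A. c i * g i)) - (mconst (c i) * mvar (g i) + (\<Sum>i\<in>A. mconst (c i) * mvar (g i))) =
      (mvar (c i * g i + (\<Sum>i\<in>A. c i * g i)) - (mvar (c i * g i) + mvar (\<Sum>i\<in>A. c i * g i)))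
      + (mvar (c i * g i) - mconst (c i) * mvar (g i))
      + (mvar (\<Sum>i\<in>A. c i * g i) - (\<Sum>i\<in>A. mconst (c i) * mvar (g i)))"
    by simp
  also have "\<dots> \<in> sym_ideal I"
    using insert.prems by (intro sym_ideal_closed(2) mvar_add_in_sym_ideal mem mvar_scale_in_sym_ideal IH) auto
  finally show ?case using insert.hyps by simp
qed (use mvar_zero_in_sym_ideal in \<open>simp_all del: single_one\<close>)

lemma syzygy_in_sym_ideal:
  assumes "u \<in> I" "\<And>i. i \<in> A \<Longrightarrow> g i \<in> I" "s * u = (\<Sum>i\<in>A. c i * g i)"
  shows "mconst s * mvar u - (\<Sum>i\<in>A. mconst (c i) * mvar (g i)) \<in> sym_ideal I"
  using sym_ideal_diff[OF mvar_lin_comb_in_sym_ideal[of A g c, OF assms(2)] mvar_scale_in_sym_ideal[OF assms(1), of s]]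
  by (simp add: assms(3))

end

section \<open>Local complete intersections are of linear type\<close>

definition homogeneous :: "'v set \<Rightarrow> nat \<Rightarrow> ('v, 'a::zero) mpoly set" where
  "homogeneous V d = {p. \<forall>m\<in>keys p. keys m \<subseteq> V \<and> total_degree m = d}"

lemma homogeneous_zero: "0 \<in> homogeneous V d"
  by (simp add: homogeneous_def)

lemma homogeneous_add:
  "p \<in> homogeneous V d \<Longrightarrow> q \<in> homogeneous V d \<Longrightarrow> p + q \<in> homogeneous V d"
  using keys_add[of p q] by (auto simp: homogeneous_def)

lemma homogeneous_mult:
  assumes "p \<in> homogeneous V d" "q \<in> homogeneous V e"
  shows "p * (q :: ('v, 'a::comm_ring_1) mpoly) \<in> homogeneous V (d + e)"
  using assms keys_mult[of p q] by (fastforce simp: homogeneous_def keys_add_nat total_degree_add)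

lemma homogeneous_single:
  "keys m \<subseteq> V \<Longrightarrow> total_degree m = d \<Longrightarrow> single m c \<in> homogeneous V d"
  by (auto simp: homogeneous_def)

lemma homogeneous_mconst: "mconst c \<in> homogeneous V 0"
  by (rule homogeneous_single) simp_all

lemma homogeneous_mvar: "v \<in> V \<Longrightarrow> mvar v \<in> homogeneous V 1"
  by (rule homogeneous_single) simp_all

lemma homogeneous_scale: "p \<in> homogeneous V d \<Longrightarrow> mconst c * p \<in> homogeneous V d"
  for p :: "('v, 'a::comm_ring_1) mpoly"
  using homogeneous_mult[OF homogeneous_mconst, of p V d c] by simp

lemma homogeneous_0E:
  assumes "p \<in> homogeneous V 0" obtains c where "p = mconst (c :: 'a::comm_ring_1)"
proof
  show "p = mconst (lookup p 0)"
    using assms by (intro eq_mconst_if_keys) (auto simp: homogeneous_def)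
qed

definition homogeneous_part :: "nat \<Rightarrow> ('v, 'a::comm_ring_1) mpoly \<Rightarrow> ('v, 'a) mpoly" where
  "homogeneous_part d p =
    (\<Sum>m\<in>{m \<in> keys p. total_degree m = d}. single m (lookup p m))"

lemma homogeneous_part_in:
  assumes "p \<in> polys_in V"
  shows "homogeneous_part d p \<in> homogeneous V d"
proof -
  have "(\<Sum>m\<in>A. single m (lookup p m)) \<in> homogeneous V d"
    if "A \<subseteq> {m \<in> keys p. total_degree m = d}" for A
    using that assms
    by (induction A rule: infinite_finite_induct)
      (auto simp: homogeneous_zero polys_in_def intro!: homogeneous_add homogeneous_single)
  then show ?thesis unfolding homogeneous_part_def by blast
qed

lemma sum_homogeneous_parts:
  "(\<Sum>d\<in>total_degree ` keys p. homogeneous_part d p) = p"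
  unfolding homogeneous_part_def
  by (subst sum.group) (simp_all add: mpoly_sum_monomials)

lemma rees_map_homogeneous:
  assumes "p \<in> homogeneous I d"
  shows "rees_map p = monom (eval_at (\<lambda>u. u) p) d"
  using assms
proof -
  have "rees_map p = (\<Sum>m\<in>keys p. rees_map (single m (lookup p m)))"
    by (subst mpoly_sum_monomials[of p, symmetric]) (simp only: rees_map_simps)
  also have "\<dots> = (\<Sum>m\<in>keys p. monom (lookup p m * monom_eval (\<lambda>u. u) m) d)"
    using assms by (intro sum.cong) (auto simp: rees_map_single homogeneous_def)
  also have "\<dots> = monom (eval_at (\<lambda>u. u) p) d"
    by (simp add: mpoly_subst_monom_eval monom_sum)
  finally show ?thesis .
qed

lemma eval_at_homogeneous_part_of_kernel:
  assumes p: "p \<in> polys_in I" "rees_map p = 0"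
  shows "eval_at (\<lambda>u. u) (homogeneous_part d p) = 0"
proof (cases "d \<in> total_degree ` keys p")
  case True
  have "0 = rees_map (\<Sum>d\<in>total_degree ` keys p. homogeneous_part d p)"
    unfolding sum_homogeneous_parts by (simp add: p)
  also have "\<dots> = (\<Sum>e\<in>total_degree ` keys p. monom (eval_at (\<lambda>u. u) (homogeneous_part e p)) e)"
    using rees_map_homogeneous[OF homogeneous_part_in[OF p(1)]] by (simp add: rees_map_simps)
  finally have "0 = coeff (\<Sum>e\<in>total_degree ` keys p.
      monom (eval_at (\<lambda>u. u) (homogeneous_part e p)) e) d" by simp
  then show ?thesis using True by (simp add: coeff_sum)
next
  case False
  then have "{m \<in> keys p. total_degree m = d} = {}" by auto
  then show ?thesis unfolding homogeneous_part_def by (simp only: sum.empty mpoly_subst_zero)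
qed

text \<open>Clearing denominators moves a regular sequence of the local ring into a given ideal of the ring.\<close>

lemma (in prime_localization) regular_mod_scale_units:
  assumes "s \<notin> M" "Q = sat (idl.span Q)"
  shows "regular_mod M Q (map ((*) s) gs) \<longleftrightarrow> regular_mod M Q gs"
  using assms(2)
proof (induction gs arbitrary: Q)
  case (Cons g gs)
  note Q = Cons.prems
  note Qs = saturated_subspace[OF Q]
  have "adjoin M Q (s * g) = adjoin M Q g"
  proof (intro equalityI subsetI)
    fix x assume "x \<in> adjoin M Q (s * g)"
    then obtain t k where t: "t \<notin> M" "t * x - k * (s * g) \<in> Q" by (rule in_adjoinE[OF Qs])
    then show "x \<in> adjoin M Q g" by (intro in_adjoinI[OF Qs, of t x "k * s"]) (simp_all add: mult.assoc)
  next
    fix x assume "x \<in> adjoin M Q g"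
    then obtain t k where t: "t \<notin> M" "t * x - k * g \<in> Q" by (rule in_adjoinE[OF Qs])
    have "(s * t) * x - k * (s * g) = s * (t * x - k * g)" by (simp add: algebra_simps)
    also have "\<dots> \<in> Q" by (rule idl.subspace_scale[OF Qs t(2)])
    finally show "x \<in> adjoin M Q (s * g)" by (rule in_adjoinI[OF Qs mult_notin_M[OF assms(1) t(1)]])
  qed
  moreover have "s * g * y \<in> Q \<longleftrightarrow> g * y \<in> Q" for y
    using saturatedD[OF Q assms(1)] idl.subspace_scale[OF Qs, of "g * y" s] by (auto simp: mult.assoc)
  then have "nonzerodivisor_mod Q (s * g) \<longleftrightarrow> nonzerodivisor_mod Q g"
    by (simp add: nonzerodivisor_mod_def)
  ultimately show ?case using Cons.IH[OF saturated_adjoin] by simp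
qed simp

locale locally_regular_ideal = prime_localization M for M :: "'a::comm_ring_1 set" +
  fixes I :: "'a set" and gs :: "'a list"
  assumes I: "idl.subspace I" and gs_in_I: "set gs \<subseteq> I"
    and regular: "regular_mod M (sat {0}) gs"
    and I_sat: "I \<subseteq> sat (idl.span (set gs))"
begin

abbreviation gens :: "nat \<Rightarrow> 'a set" where
  "gens j \<equiv> sat (idl.span (set (take j gs)))"

text \<open>\<open>P\<close> lies in the ideal generated by the relations of the symmetric algebra and the first
  \<open>j\<close> of the variables \<open>T\<^sub>g\<close>, with homogeneous cofactors of degree \<open>d\<close>, up to a denominator outside \<open>M\<close>.\<close>

definition reducible_to :: "nat \<Rightarrow> nat \<Rightarrow> ('a, 'a) mpoly \<Rightarrow> bool" where
  "reducible_to d j P \<longleftrightarrow> (\<exists>s G. s \<notin> M \<and> (\<forall>i. G i \<in> homogeneous I d) \<and>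
    mconst s * P - (\<Sum>i<j. mvar (gs ! i) * G i) \<in> sym_ideal I)"

lemma g_in_I: "i < length gs \<Longrightarrow> gs ! i \<in> I"
  using gs_in_I by auto

lemma in_gensE:
  assumes "x \<in> gens j" "j \<le> length gs"
  obtains s c where "s \<notin> M" "s * x = (\<Sum>i<j. c i * gs ! i)"
proof -
  obtain s where s: "s \<notin> M" "s * x \<in> idl.span (set (take j gs))"
    using assms by (auto simp: saturation_def)
  moreover have "set (take j gs) = (!) gs ` {..<j}"
    using assms(2) by (simp add: nth_image lessThan_atLeast0)
  ultimately show thesis
    using in_span_range_iff[of "{..<j}" "s * x" "(!) gs"] that by auto
qed

lemma in_gensI:
  assumes "s \<notin> M" "j \<le> length gs" "s * x - (\<Sum>i<j. c i * gs ! i) \<in> gens j"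
  shows "x \<in> gens j"
proof -
  have "(\<Sum>i<j. c i * gs ! i) \<in> idl.span (set (take j gs))"
    using assms(2) by (intro idl.span_sum idl.span_scale idl.span_base) (auto simp: in_set_conv_nth)
  then have "(\<Sum>i<j. c i * gs ! i) \<in> gens j" using saturation_superset by blast
  then have "s * x \<in> gens j"
    using idl.subspace_add[OF subspace_saturation[OF idl.subspace_span] assms(3)] by fastforce
  then have "x \<in> sat (gens j)" by (rule saturationI[OF assms(1)])
  then show ?thesis by simp
qed

text \<open>The start of the descent: each factor \<open>T\<^sub>u\<close> is a combination of the variables of the
  generators, because up to a denominator \<open>u\<close> is a combination of the generators.\<close>

lemma reducible_to_all:
  assumes P: "P \<in> homogeneous I (Suc d)"
  shows "reducible_to d (length gs) P"
proof (induction P rule: mpoly_induct)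
  case zero
  show ?case
    unfolding reducible_to_def
    by (intro exI[of _ 1] exI[of _ "\<lambda>_. 0"]) (simp add: one_notin_M homogeneous_zero sym_ideal_closed[OF I])
next
  case (add P1 P2)
  obtain s1 G1 s2 G2 where 1: "s1 \<notin> M" "\<And>i. G1 i \<in> homogeneous I d"
      "mconst s1 * P1 - (\<Sum>i<length gs. mvar (gs ! i) * G1 i) \<in> sym_ideal I"
    and 2: "s2 \<notin> M" "\<And>i. G2 i \<in> homogeneous I d"
      "mconst s2 * P2 - (\<Sum>i<length gs. mvar (gs ! i) * G2 i) \<in> sym_ideal I"
    using add unfolding reducible_to_def by blast
  let ?G = "\<lambda>i. mconst s2 * G1 i + mconst s1 * G2 i"
  have m: "mconst (s1 * s2) = mconst s1 * mconst s2" by (simp add: mult_single)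
  have "mconst (s1 * s2) * (P1 + P2) - (\<Sum>i<length gs. mvar (gs ! i) * ?G i) =
      mconst s2 * (mconst s1 * P1 - (\<Sum>i<length gs. mvar (gs ! i) * G1 i)) +
      mconst s1 * (mconst s2 * P2 - (\<Sum>i<length gs. mvar (gs ! i) * G2 i))"
  proof -
    have alg: "a * b * (p + q) - (b * x + a * y) = b * (a * p - x) + a * (b * q - y)"
      for a b p q x y :: "('a, 'a) mpoly"
      by (simp add: algebra_simps)
    have "(\<Sum>i<length gs. mvar (gs ! i) * ?G i) =
        mconst s2 * (\<Sum>i<length gs. mvar (gs ! i) * G1 i) + mconst s1 * (\<Sum>i<length gs. mvar (gs ! i) * G2 i)"
      by (simp only: distrib_left sum.distrib sum_distrib_left mult.left_commute)
    then show ?thesis by (simp only: m alg)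
  qed
  also have "\<dots> \<in> sym_ideal I"
    by (intro sym_ideal_closed(2,3)[OF I] 1 2 mconst_in_polys_in)
  finally show ?case
    unfolding reducible_to_def
    by (intro exI[of _ "s1 * s2"] exI[of _ ?G] conjI allI mult_notin_M 1 2 homogeneous_add homogeneous_scale)
next
  case (monomial m c)
  then have m: "keys m \<subseteq> I" "total_degree m = Suc d"
    using P by (auto simp: homogeneous_def)
  then have "m \<noteq> 0" by auto
  then obtain u where u: "u \<in> keys m" by (metis all_not_in_conv keys_eq_empty)
  define n where "n = m - single u 1"
  have mn: "m = single u 1 + n"
    unfolding n_def by (rule exponent_split) (use u in \<open>simp add: in_keys_iff Suc_le_eq One_nat_def\<close>)
  have n: "keys n \<subseteq> I" "total_degree n = d"
    using m unfolding mn by (auto simp: keys_add_nat total_degree_add)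
  have uI: "u \<in> I" using u m by blast
  have "u \<in> gens (length gs)" using uI I_sat by auto
  then obtain s b where s: "s \<notin> M" "s * u = (\<Sum>i<length gs. b i * gs ! i)" by (rule in_gensE) simp
  have "mconst s * mvar u - (\<Sum>i<length gs. mconst (b i) * mvar (gs ! i)) \<in> sym_ideal I"
    using s(2) g_in_I by (intro syzygy_in_sym_ideal[OF I uI]) auto
  then have "single n c * (mconst s * mvar u - (\<Sum>i<length gs. mconst (b i) * mvar (gs ! i))) \<in> sym_ideal I"
    using n by (intro sym_ideal_closed(3)[OF I] polys_in_single)
  also have "single n c * (mconst s * mvar u - (\<Sum>i<length gs. mconst (b i) * mvar (gs ! i))) =
      mconst s * (mvar u * single n c) -
      (\<Sum>i<length gs. mvar (gs ! i) * (mconst (b i) * single n c))"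
    by (simp only: right_diff_distrib sum_distrib_left mult_ac)
  also have "mvar u * single n c = single m c"
    by (simp add: mult_single mn)
  finally show ?case
    unfolding reducible_to_def using s(1) homogeneous_scale[OF homogeneous_single[OF n]]
    by (intro exI[of _ s] exI[of _ "\<lambda>i. mconst (b i) * single n c"]) auto
qed

lemma koszul_in_sym_ideal:
  assumes "g \<in> I" "h \<in> I"
  shows "mconst g * mvar h - mconst h * mvar g \<in> sym_ideal I"
  using sym_ideal_diff[OF I mvar_scale_in_sym_ideal[OF I assms(1), of h] mvar_scale_in_sym_ideal[OF I assms(2), of g]]
  by (simp add: mult.commute)

text \<open>The variables are removed one by one. If the value of \<open>P\<close> lies in \<open>(g\<^sub>0, \<dots>, g\<^sub>j\<^sub>-\<^sub>1)\<close>, the cofactor of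
  \<open>T\<close> at \<open>g\<^sub>j\<close> takes a value in that ideal too, because \<open>g\<^sub>j\<close> is regular modulo it. By induction on the
  degree this cofactor itself reduces to the previous variables; in degree zero
  a Koszul relation does the same.\<close>

lemma reducible_to_step:
  assumes P: "P \<in> homogeneous I (Suc d)" and j: "j \<le> length gs"
    and ev: "eval_at (\<lambda>u. u) P \<in> gens j"
  shows "reducible_to d j P"
proof -
  \<comment> \<open>Both cases of the outer induction share the descent in \<open>j\<close>; they differ in how the cofactor of the
      last variable is treated.\<close>
  have descent: "reducible_to d j P"
    if P: "P \<in> homogeneous I (Suc d)" and j: "j \<le> length gs" and ev: "eval_at (\<lambda>u. u) P \<in> gens j"
      and cof: "\<And>H j. H \<in> homogeneous I d \<Longrightarrow> j < length gs \<Longrightarrow> eval_at (\<lambda>u. u) H \<in> gens j \<Longrightarrow>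
        \<exists>s G. s \<notin> M \<and> (\<forall>i. G i \<in> homogeneous I d) \<and>
          mconst s * (mvar (gs ! j) * H) - (\<Sum>i<j. mvar (gs ! i) * G i) \<in> sym_ideal I" for d P j
    using j ev
  proof (induction j rule: inc_induct)
    case base
    show ?case by (rule reducible_to_all[OF P])
  next
    case (step j)
    have "gens j \<subseteq> gens (Suc j)"
      by (intro saturation_mono idl.span_mono set_take_subset_set_take) simp
    then have "reducible_to d (Suc j) P" using step by blast
    then obtain s G where s: "s \<notin> M" "\<And>i. G i \<in> homogeneous I d"
      "mconst s * P - (\<Sum>i<Suc j. mvar (gs ! i) * G i) \<in> sym_ideal I"
      unfolding reducible_to_def by blast
    let ?e = "eval_at (\<lambda>u. u) :: ('a, 'a) mpoly \<Rightarrow> 'a"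
    have "?e (mconst s * P - (\<Sum>i<Suc j. mvar (gs ! i) * G i)) = 0"
      by (rule hom_vanishes_on_sym_ideal[OF I coeff_hom_eval_at _ s(3)]) (auto simp: sym_relations_def)
    then have val: "gs ! j * ?e (G j) = s * ?e P - (\<Sum>i<j. ?e (G i) * gs ! i)"
      by (simp add: mult.commute algebra_simps)
    have "s * ?e P \<in> gens j"
      using step.prems by (intro idl.subspace_scale subspace_saturation idl.subspace_span)
    moreover have "(\<Sum>i<j. ?e (G i) * gs ! i) \<in> gens j"
      by (rule in_gensI[OF one_notin_M, of j _ "\<lambda>i. ?e (G i)"])
        (use step.hyps in \<open>simp_all add: idl.subspace_0 subspace_saturation\<close>)
    ultimately have "gs ! j * ?e (G j) \<in> gens j"
      unfolding val by (rule idl.subspace_diff[OF subspace_saturation[OF idl.subspace_span]])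
    moreover have "nonzerodivisor_mod (gens j) (gs ! j)"
      using regular step.hyps unfolding regular_mod_iff foldl_adjoin_zero by blast
    ultimately have "?e (G j) \<in> gens j" by (simp add: nonzerodivisor_mod_def)
    then obtain s' G' where s': "s' \<notin> M" "\<And>i. G' i \<in> homogeneous I d"
      "mconst s' * (mvar (gs ! j) * G j) - (\<Sum>i<j. mvar (gs ! i) * G' i) \<in> sym_ideal I"
      using cof[OF s(2)] step.hyps by blast
    let ?G = "\<lambda>i. mconst s' * G i + G' i"
    have m: "mconst (s' * s) = mconst s' * mconst s" by (simp add: mult_single)
    have "mconst (s' * s) * P - (\<Sum>i<j. mvar (gs ! i) * ?G i) =
        mconst s' * (mconst s * P - (\<Sum>i<Suc j. mvar (gs ! i) * G i)) +
        (mconst s' * (mvar (gs ! j) * G j) - (\<Sum>i<j. mvar (gs ! i) * G' i))"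
    proof -
      have alg: "a * b * p - (a * x + y) = a * (b * p - (x + z)) + (a * z - y)"
        for a b p x y z :: "('a, 'a) mpoly"
        by (simp add: algebra_simps)
      have "(\<Sum>i<j. mvar (gs ! i) * ?G i) =
          mconst s' * (\<Sum>i<j. mvar (gs ! i) * G i) + (\<Sum>i<j. mvar (gs ! i) * G' i)"
        by (simp only: distrib_left sum.distrib sum_distrib_left mult.left_commute)
      then show ?thesis unfolding m sum.lessThan_Suc by (simp only: alg)
    qed
    also have "\<dots> \<in> sym_ideal I"
      by (intro sym_ideal_closed(2,3)[OF I] s s' mconst_in_polys_in)
    finally show ?case
      unfolding reducible_to_def
      by (intro exI[of _ "s' * s"] exI[of _ ?G] conjI allI mult_notin_M s s' homogeneous_add homogeneous_scale)
  qed
  show ?thesis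
    using assms
  proof (induction d arbitrary: P j)
    case 0
    show ?case
    proof (rule descent[OF 0])
      fix H :: "('a, 'a) mpoly" and j
      assume H: "H \<in> homogeneous I 0" and j: "j < length gs" and ev: "eval_at (\<lambda>u. u) H \<in> gens j"
      obtain c where c: "H = mconst c" using H by (rule homogeneous_0E)
      then obtain s b where s: "s \<notin> M" "s * c = (\<Sum>i<j. b i * gs ! i)"
        using ev j by (auto elim: in_gensE)
      have "mconst s * (mvar (gs ! j) * H) = mconst (s * c) * mvar (gs ! j)"
        by (simp add: c mult_single mult_ac)
      also have "\<dots> = (\<Sum>i<j. mconst (b i) * (mconst (gs ! i) * mvar (gs ! j)))"
        unfolding s(2) coeff_hom.hom_sum[OF coeff_hom_mconst] coeff_hom.hom_mult[OF coeff_hom_mconst]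
        by (simp add: sum_distrib_right mult.assoc)
      finally have "mconst s * (mvar (gs ! j) * H) - (\<Sum>i<j. mvar (gs ! i) * (mconst (b i) * mconst (gs ! j))) =
          (\<Sum>i<j. mconst (b i) * (mconst (gs ! i) * mvar (gs ! j) - mconst (gs ! j) * mvar (gs ! i)))"
        by (simp only: sum_subtractf right_diff_distrib mult_ac)
      also have "\<dots> \<in> sym_ideal I"
        using j by (intro sym_ideal_sum[OF I] sym_ideal_closed(3)[OF I] koszul_in_sym_ideal g_in_I mconst_in_polys_in) auto
      finally show "\<exists>s G. s \<notin> M \<and> (\<forall>i. G i \<in> homogeneous I 0) \<and>
          mconst s * (mvar (gs ! j) * H) - (\<Sum>i<j. mvar (gs ! i) * G i) \<in> sym_ideal I"
        using s(1) homogeneous_scale[OF homogeneous_mconst]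
        by (intro exI[of _ s] exI[of _ "\<lambda>i. mconst (b i) * mconst (gs ! j)"]) blast
    qed
  next
    case (Suc d)
    show ?case
    proof (rule descent[OF Suc.prems])
      fix H :: "('a, 'a) mpoly" and j
      assume H: "H \<in> homogeneous I (Suc d)" and j: "j < length gs" and ev: "eval_at (\<lambda>u. u) H \<in> gens j"
      obtain s G where s: "s \<notin> M" "\<And>i. G i \<in> homogeneous I d"
        "mconst s * H - (\<Sum>i<j. mvar (gs ! i) * G i) \<in> sym_ideal I"
        using Suc.IH[OF H _ ev] j unfolding reducible_to_def by auto
      have "mconst s * (mvar (gs ! j) * H) - (\<Sum>i<j. mvar (gs ! i) * (mvar (gs ! j) * G i)) =
          mvar (gs ! j) * (mconst s * H - (\<Sum>i<j. mvar (gs ! i) * G i))"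
        by (simp only: right_diff_distrib sum_distrib_left mult_ac)
      also have "\<dots> \<in> sym_ideal I"
        using j by (intro sym_ideal_closed(3)[OF I] s mvar_in_polys_in g_in_I)
      finally show "\<exists>s G. s \<notin> M \<and> (\<forall>i. G i \<in> homogeneous I (Suc d)) \<and>
          mconst s * (mvar (gs ! j) * H) - (\<Sum>i<j. mvar (gs ! i) * G i) \<in> sym_ideal I"
        using s(1) homogeneous_mult[OF homogeneous_mvar[OF g_in_I[OF j]] s(2)]
        by (intro exI[of _ s] exI[of _ "\<lambda>i. mvar (gs ! j) * G i"]) (simp add: plus_1_eq_Suc)
    qed
  qed
qed

text \<open>An element of the kernel of \<open>rees_map\<close> has homogeneous parts with value zero, to which the descent
  applies with \<open>j = 0\<close>. Finitely many denominators have a common multiple.\<close>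

lemma kernel_in_sym_ideal_locally:
  assumes P: "P \<in> polys_in I" "rees_map P = 0"
  obtains s where "s \<notin> M" "mconst s * P \<in> sym_ideal I"
proof -
  have "\<exists>s. s \<notin> M \<and> mconst s * homogeneous_part d P \<in> sym_ideal I" for d
  proof -
    let ?H = "homogeneous_part d P"
    have H: "?H \<in> homogeneous I d" "eval_at (\<lambda>u. u) ?H = 0"
      by (rule homogeneous_part_in[OF P(1)], rule eval_at_homogeneous_part_of_kernel[OF P])
    show ?thesis
    proof (cases d)
      case 0
      then obtain c where "?H = mconst c" using H(1) homogeneous_0E by blast
      then have "?H = 0" using H(2) by simp
      then show ?thesis using one_notin_M sym_ideal_closed(1)[OF I] by (metis mult_zero_right)
    next
      case (Suc e)
      have "eval_at (\<lambda>u. u) ?H \<in> gens 0"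
        unfolding H(2) by (rule idl.subspace_0[OF subspace_saturation[OF idl.subspace_span]])
      then have "reducible_to e 0 ?H" using reducible_to_step H(1) Suc by blast
      then show ?thesis unfolding reducible_to_def lessThan_0 sum.empty diff_zero by blast
    qed
  qed
  then obtain s where s: "\<And>d. s d \<notin> M" "\<And>d. mconst (s d) * homogeneous_part d P \<in> sym_ideal I" by metis
  let ?D = "total_degree ` keys P"
  let ?s = "prod s ?D"
  have "mconst ?s * homogeneous_part d P \<in> sym_ideal I" if "d \<in> ?D" for d
  proof -
    have "?s = prod s (?D - {d}) * s d" using that by (simp add: prod.remove[of ?D d] mult.commute)
    then have "mconst ?s * homogeneous_part d P = mconst (prod s (?D - {d})) * (mconst (s d) * homogeneous_part d P)"
      by (simp only: coeff_hom.hom_mult[OF coeff_hom_mconst] mult.assoc)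
    then show ?thesis using sym_ideal_closed(3)[OF I s(2) mconst_in_polys_in] by simp
  qed
  then have "(\<Sum>d\<in>?D. mconst ?s * homogeneous_part d P) \<in> sym_ideal I" by (rule sym_ideal_sum[OF I])
  then have "mconst ?s * P \<in> sym_ideal I"
    unfolding sum_distrib_left[symmetric] sum_homogeneous_parts .
  moreover have "?s \<notin> M" by (rule prod_notin_M) (simp_all add: s(1))
  ultimately show thesis by (rule that[rotated])
qed

end

lemma prime_ideal_point_ideal: "prime_ideal (point_ideal (a :: 'n \<Rightarrow> 'k::field))"
proof -
  have "idl.subspace (point_ideal a)"
    by (rule idl.subspaceI) (simp_all add: point_ideal_def)
  then show ?thesis by (auto simp: prime_ideal_def point_ideal_def)
qed

text \<open>Linear type is a local property: the elements \<open>s\<close> with \<open>s P = 0\<close> in the symmetric algebra form an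
  ideal, which is not contained in any maximal ideal.\<close>

theorem linear_type_if_locally_regular:
  fixes I :: "('n::finite, 'k::{alg_closed_field, field_char_0}) mpoly set"
  assumes I: "idl.subspace I"
    and loc: "\<And>a. \<exists>gs. set gs \<subseteq> I \<and> regular_mod (point_ideal a) (saturation (point_ideal a) {0}) gs \<and>
      I \<subseteq> saturation (point_ideal a) (idl.span (set gs))"
  shows "linear_type I"
  unfolding linear_type_iff[OF I]
proof (intro ballI impI)
  fix P assume P: "P \<in> polys_in I" "rees_map P = 0"
  define U where "U = {s. mconst s * P \<in> sym_ideal I}"
  have "idl.subspace U"
  proof (rule idl.subspaceI)
    show "0 \<in> U" by (simp add: U_def sym_ideal_closed(1)[OF I])
  next
    fix x y assume "x \<in> U" "y \<in> U"
    then show "x + y \<in> U"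
      using sym_ideal_closed(2)[OF I] by (simp add: U_def coeff_hom.hom_add[OF coeff_hom_mconst] distrib_right)
  next
    fix c x assume "x \<in> U"
    then have "mconst x * P \<in> sym_ideal I" by (simp add: U_def)
    then have "mconst c * (mconst x * P) \<in> sym_ideal I"
      by (rule sym_ideal_closed(3)[OF I _ mconst_in_polys_in])
    then show "c * x \<in> U" by (simp add: U_def coeff_hom.hom_mult[OF coeff_hom_mconst] mult.assoc)
  qed
  moreover have "a \<notin> zero_locus U" for a
  proof -
    obtain gs where gs: "set gs \<subseteq> I" "regular_mod (point_ideal a) (saturation (point_ideal a) {0}) gs"
      "I \<subseteq> saturation (point_ideal a) (idl.span (set gs))" using loc[of a] by blast
    interpret locally_regular_ideal "point_ideal a" I gs
      by unfold_locales (rule prime_ideal_point_ideal I gs)+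
    obtain s where s: "s \<notin> point_ideal a" "mconst s * P \<in> sym_ideal I"
      using kernel_in_sym_ideal_locally[OF P] by blast
    have "s \<in> U" using s(2) by (simp add: U_def)
    then show ?thesis using s(1) by (auto simp: zero_locus_def point_ideal_def)
  qed
  then have "zero_locus U = {}" by blast
  ultimately have "1 \<in> U" by (rule proper_ideal_has_zero)
  then show "P \<in> sym_ideal I" by (simp add: U_def)
qed

section \<open>Algebraic dependence by counting\<close>

text \<open>Gaussian elimination of one equation at a time.\<close>

lemma homogeneous_system_has_nontrivial_solution:
  fixes a :: "'i \<Rightarrow> 'j \<Rightarrow> 'k::field"
  assumes "finite B" "finite A" "card B < card A"
  shows "\<exists>c. (\<exists>i\<in>A. c i \<noteq> 0) \<and> (\<forall>j\<in>B. (\<Sum>i\<in>A. c i * a i j) = 0)"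
  using assms
proof (induction B arbitrary: A a rule: finite_induct)
  case empty
  then obtain i where "i \<in> A" by fastforce
  then show ?case by (intro exI[of _ "\<lambda>_. 1"]) auto
next
  case (insert b B)
  show ?case
  proof (cases "\<forall>i\<in>A. a i b = 0")
    case True
    have "card B < card A" using insert by simp
    then obtain c where "\<exists>i\<in>A. c i \<noteq> 0" "\<forall>j\<in>B. (\<Sum>i\<in>A. c i * a i j) = 0"
      using insert.IH[OF insert.prems(1), of a] by blast
    then show ?thesis using True by (intro exI[of _ c]) auto
  next
    case False
    then obtain p where p: "p \<in> A" "a p b \<noteq> 0" by blast
    let ?A = "A - {p}"
    let ?a = "\<lambda>i j. a i j - a i b / a p b * a p j"
    have "card B < card ?A" using insert p by (simp add: card_Diff_singleton)
    then obtain c where c: "\<exists>i\<in>?A. c i \<noteq> 0" "\<And>j. j \<in> B \<Longrightarrow> (\<Sum>i\<in>?A. c i * ?a i j) = 0"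
      using insert.IH[of ?A ?a] insert.prems(1) by blast
    define cp where "cp = - (\<Sum>i\<in>?A. c i * a i b) / a p b"
    let ?c = "c(p := cp)"
    have split: "(\<Sum>i\<in>A. ?c i * a i j) = cp * a p j + (\<Sum>i\<in>?A. c i * a i j)" for j
    proof -
      have "(\<Sum>i\<in>A. ?c i * a i j) = ?c p * a p j + (\<Sum>i\<in>?A. ?c i * a i j)"
        by (rule sum.remove[OF insert.prems(1) p(1)])
      also have "(\<Sum>i\<in>?A. ?c i * a i j) = (\<Sum>i\<in>?A. c i * a i j)" by (intro sum.cong) auto
      finally show ?thesis by simp
    qed
    have "(\<Sum>i\<in>A. ?c i * a i j) = 0" if "j \<in> insert b B" for j
    proof (cases "j = b")
      case True
      then show ?thesis unfolding split using p(2) by (simp add: cp_def)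
    next
      case False
      have "(\<Sum>i\<in>?A. c i * ?a i j) = (\<Sum>i\<in>?A. c i * a i j) - (\<Sum>i\<in>?A. c i * a i b) / a p b * a p j"
        by (simp add: right_diff_distrib sum_subtractf sum_distrib_right sum_divide_distrib mult.assoc)
      also have "\<dots> = cp * a p j + (\<Sum>i\<in>?A. c i * a i j)" by (simp add: cp_def)
      finally show ?thesis unfolding split using c(2)[of j] that False by simp
    qed
    then show ?thesis using c(1) by (intro exI[of _ ?c]) auto
  qed
qed

definition exponents_bounded :: "nat \<Rightarrow> ('v, 'a::zero) mpoly \<Rightarrow> bool" where
  "exponents_bounded e p \<longleftrightarrow> (\<forall>m\<in>keys p. \<forall>v. lookup m v \<le> e)"

lemma exponents_bounded_one: "exponents_bounded 0 (1 :: ('v, 'a::comm_ring_1) mpoly)"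
  by (simp add: exponents_bounded_def)

lemma exponents_bounded_mult:
  assumes "exponents_bounded e p" "exponents_bounded e' q"
  shows "exponents_bounded (e + e') (p * (q :: ('v, 'a::comm_ring_1) mpoly))"
  unfolding exponents_bounded_def
proof (intro ballI allI)
  fix m v assume "m \<in> keys (p * q)"
  then obtain a b where "m = a + b" "a \<in> keys p" "b \<in> keys q"
    using keys_mult[of p q] by auto
  then show "lookup m v \<le> e + e'"
    using assms by (simp add: exponents_bounded_def lookup_add add_mono)
qed

lemma exponents_bounded_power:
  "exponents_bounded e p \<Longrightarrow> exponents_bounded (n * e) (p ^ n)" for p :: "('v, 'a::comm_ring_1) mpoly"
  by (induction n) (auto simp: exponents_bounded_one intro: exponents_bounded_mult)

lemma exponents_bounded_prod:
  fixes h :: "'i \<Rightarrow> ('v, 'a::comm_ring_1) mpoly"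
  assumes "finite A" "\<And>i. i \<in> A \<Longrightarrow> exponents_bounded (e i) (h i)"
  shows "exponents_bounded (sum e A) (prod h A)"
  using assms by (induction A rule: finite_induct) (auto simp: exponents_bounded_one intro: exponents_bounded_mult)

lemma exponents_bounded_exists:
  fixes p :: "('v::finite, 'a::zero) mpoly"
  shows "\<exists>e. exponents_bounded e p"
proof
  show "exponents_bounded (\<Sum>m\<in>keys p. \<Sum>v\<in>UNIV. lookup m v) p"
    unfolding exponents_bounded_def
  proof (intro ballI allI)
    fix m and v :: 'v assume m: "m \<in> keys p"
    have "lookup m v \<le> (\<Sum>v\<in>UNIV. lookup m v)"
      by (rule member_le_sum) auto
    also have "\<dots> \<le> (\<Sum>m\<in>keys p. \<Sum>v\<in>UNIV. lookup m v)"
      using m by (intro member_le_sum[of m _ "\<lambda>m. \<Sum>v\<in>UNIV. lookup m v"]) auto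
    finally show "lookup m v \<le> (\<Sum>m\<in>keys p. \<Sum>v\<in>UNIV. lookup m v)" .
  qed
qed

lemma exponents_bounded_mono: "exponents_bounded e p \<Longrightarrow> e \<le> e' \<Longrightarrow> exponents_bounded e' p"
  by (auto simp: exponents_bounded_def intro: order_trans)

text \<open>More than \<open>n\<close> polynomials in \<open>n\<close> variables are algebraically dependent: the number of
  monomials in them with exponents below \<open>E\<close> grows faster than the number of monomials in the \<open>n\<close> variables
  that occur there.\<close>

theorem algebraically_dependent:
  fixes h :: "'w::finite \<Rightarrow> ('v::finite, 'k::field) mpoly"
  assumes card: "CARD('v) < CARD('w)"
  obtains P :: "('w, 'k) mpoly" where "P \<noteq> 0" "mpoly_subst mconst h P = 0"
proof -
  have "\<forall>w. \<exists>e. exponents_bounded e (h w)" using exponents_bounded_exists by blast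
  then obtain e where e: "\<And>w. exponents_bounded (e w) (h w)" by metis
  define e0 where "e0 = sum e UNIV"
  have e0: "exponents_bounded e0 (h w)" for w
    using e by (rule exponents_bounded_mono) (simp add: e0_def member_le_sum)
  \<comment> \<open>Monomials in \<open>h\<close> with exponents below \<open>E\<close> have exponents at most \<open>D \<le> C * E - 1\<close> in the variables, and
      \<open>(C * E) ^ n < E ^ (n + 1)\<close> as soon as \<open>E > C ^ n\<close>.\<close>
  define C where "C = CARD('w) * e0 + 1"
  define E where "E = C ^ CARD('v) + 1"
  define D where "D = CARD('w) * (E * e0)"
  define A where "A = PiE (UNIV :: 'w set) (\<lambda>_. {..<E})"
  define B where "B = PiE (UNIV :: 'v set) (\<lambda>_. {..D})"
  have fin: "finite A" "finite B" by (auto simp: A_def B_def intro: finite_PiE)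
  have "E \<ge> 1" by (simp add: E_def)
  have "D + 1 \<le> C * E"
    using \<open>E \<ge> 1\<close> by (simp add: D_def C_def algebra_simps)
  have "card B = (D + 1) ^ CARD('v)" by (simp add: B_def card_PiE Suc_eq_plus1)
  also have "\<dots> \<le> (C * E) ^ CARD('v)" using \<open>D + 1 \<le> C * E\<close> by (rule power_mono) simp
  also have "\<dots> = C ^ CARD('v) * E ^ CARD('v)" by (rule power_mult_distrib)
  also have "\<dots> < E * E ^ CARD('v)" using \<open>E \<ge> 1\<close> by (simp add: E_def)
  also have "\<dots> = E ^ Suc (CARD('v))" by simp
  also have "\<dots> \<le> E ^ CARD('w)" using card \<open>E \<ge> 1\<close> by (intro power_increasing) auto
  also have "\<dots> = card A" by (simp add: A_def card_PiE)
  finally have "card B < card A" .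
  define vec where "vec = (Abs_poly_mapping :: ('w \<Rightarrow> nat) \<Rightarrow> _)"
  have vec: "lookup (vec g) = g" for g by (simp add: vec_def)
  obtain c where c: "\<exists>g\<in>A. c g \<noteq> 0"
    "\<And>b. b \<in> B \<Longrightarrow> (\<Sum>g\<in>A. c g * lookup (monom_eval h (vec g)) (Abs_poly_mapping b)) = 0"
    using homogeneous_system_has_nontrivial_solution[OF fin(2,1) \<open>card B < card A\<close>,
      of "\<lambda>g b. lookup (monom_eval h (vec g)) (Abs_poly_mapping b)"] by blast
  define P where "P = (\<Sum>g\<in>A. single (vec g) (c g))"
  obtain g0 where g0: "g0 \<in> A" "c g0 \<noteq> 0" using c(1) by blast
  have inj: "vec g = vec g' \<Longrightarrow> g = g'" for g g' by (metis vec)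
  have "lookup P (vec g0) = (\<Sum>g\<in>A. if g = g0 then c g else 0)"
    unfolding P_def lookup_sum by (intro sum.cong) (auto simp: lookup_single when_def dest: inj)
  also have "\<dots> = c g0" using g0(1) fin by simp
  finally have "P \<noteq> 0" using g0(2) by auto
  have bound: "exponents_bounded D (monom_eval h (vec g))" if "g \<in> A" for g
  proof -
    have "exponents_bounded (\<Sum>w\<in>UNIV. g w * e0) (\<Prod>w\<in>UNIV. h w ^ g w)"
      by (intro exponents_bounded_prod exponents_bounded_power e0) simp
    moreover have "(\<Sum>w\<in>UNIV. g w * e0) \<le> (\<Sum>w\<in>(UNIV::'w set). E * e0)"
      using that by (intro sum_mono mult_right_mono) (auto simp: A_def PiE_iff intro: less_imp_le)
    then have "(\<Sum>w\<in>UNIV. g w * e0) \<le> D" by (simp add: D_def)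
    moreover have "monom_eval h (vec g) = (\<Prod>w\<in>UNIV. h w ^ g w)"
      by (simp add: monom_eval_superset[of UNIV] vec)
    ultimately show ?thesis by (metis exponents_bounded_mono)
  qed
  have "mpoly_subst mconst h P = (\<Sum>g\<in>A. mconst (c g) * monom_eval h (vec g))"
    unfolding P_def coeff_hom.hom_sum[OF coeff_hom.coeff_hom_subst[OF coeff_hom_mconst]]
      coeff_hom.subst_single[OF coeff_hom_mconst] ..
  also have "\<dots> = 0"
  proof (rule poly_mapping_eqI)
    fix m :: "'v \<Rightarrow>\<^sub>0 nat"
    have sm: "lookup (mconst x * q) m = x * lookup q m" for x and q :: "('v, 'k) mpoly"
    proof (induction q rule: mpoly_induct)
      case (monomial n y)
      show ?case by (simp add: mult_single lookup_single when_def)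
    qed (simp_all add: distrib_left lookup_add)
    have "(\<Sum>g\<in>A. c g * lookup (monom_eval h (vec g)) m) = 0"
    proof (cases "lookup m \<in> B")
      case True
      then show ?thesis using c(2)[OF True] by (simp only: lookup_inverse)
    next
      case False
      then obtain v where "\<not> lookup m v \<le> D" by (auto simp: B_def PiE_iff)
      then have "lookup (monom_eval h (vec g)) m = 0" if "g \<in> A" for g
        using bound[OF that] by (auto simp: exponents_bounded_def in_keys_iff)
      then show ?thesis by simp
    qed
    then show "lookup (\<Sum>g\<in>A. mconst (c g) * monom_eval h (vec g)) m = lookup 0 m"
      by (simp add: lookup_sum sm)
  qed
  finally show thesis using that \<open>P \<noteq> 0\<close> by blast
qed

section \<open>Linear type forces a syzygy with a unit entry\<close>

lemma exists_smaller_exponent: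
  fixes m :: "'v \<Rightarrow>\<^sub>0 nat"
  assumes "d \<le> total_degree m"
  shows "\<exists>b c. m = b + c \<and> total_degree b = d"
  using assms
proof (induction d)
  case 0
  show ?case by (intro exI[of _ 0] exI[of _ m]) simp
next
  case (Suc d)
  then obtain b c where bc: "m = b + c" "total_degree b = d" by auto
  then have "c \<noteq> 0" using Suc.prems by auto
  then obtain v where v: "v \<in> keys c" by (metis all_not_in_conv keys_eq_empty)
  let ?e = "single v (1 :: nat)"
  have "c = ?e + (c - ?e)"
    by (rule exponent_split) (use v in \<open>simp add: in_keys_iff Suc_le_eq One_nat_def\<close>)
  then have "m = (b + ?e) + (c - ?e)" using bc(1) by (metis add.assoc)
  moreover have "total_degree (b + ?e) = Suc d" using bc(2) by (simp add: total_degree_add)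
  ultimately show ?case by blast
qed

text \<open>If all syzygies of generators \<open>h\<close> of \<open>I\<close> have their entries in the maximal ideal of \<open>a\<close>, the generators
  form a basis of \<open>I / \<mm>I\<close>, and linear type makes the fibre of the Rees algebra over \<open>a\<close> the
  polynomial ring on that basis. An algebraic relation between the generators has a lowest form, and this form
  would be a relation in the fibre.\<close>

theorem linear_type_syzygy:
  fixes h :: "'w::finite \<Rightarrow> ('n::finite, 'k::{alg_closed_field, field_char_0}) mpoly"
  defines "I \<equiv> idl.span (range h)"
  assumes lt: "linear_type I" and card: "CARD('n) < CARD('w)" and a: "a \<in> zero_locus I"
  shows "\<exists>r. (\<Sum>w\<in>UNIV. r w * h w) = 0 \<and> (\<exists>w. eval_at a (r w) \<noteq> 0)"
proof (rule ccontr)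
  assume "\<not> ?thesis"
  then have syz: "(\<Sum>w\<in>UNIV. r w * h w) = 0 \<Longrightarrow> eval_at a (r w) = 0" for r w by blast
  have I: "idl.subspace I" unfolding I_def by (rule idl.subspace_span)
  have hI: "h w \<in> I" for w unfolding I_def by (rule idl.span_base) simp
  have h0: "eval_at a (h w) = 0" for w using a hI by (simp add: zero_locus_def)
  \<comment> \<open>The coordinates of \<open>u \<in> I\<close> with respect to \<open>h\<close> are unique after evaluation at \<open>a\<close>, so \<open>coord_form\<close> is the
      linear map from \<open>I\<close> to the linear forms that sends \<open>h w\<close> to the variable \<open>w\<close>. It
      extends to the ring homomorphism \<open>\<Phi>\<close> from the symmetric algebra to the polynomial ring.\<close>
  define coords where "coords u = (SOME r. u = (\<Sum>w\<in>UNIV. r w * h w))" for u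
  define coord_form where "coord_form u = (\<Sum>w\<in>UNIV. mconst (eval_at a (coords u w)) * mvar w :: ('w, 'k) mpoly)" for u
  have coords: "u = (\<Sum>w\<in>UNIV. coords u w * h w)" if "u \<in> I" for u
  proof -
    have "\<exists>r. u = (\<Sum>w\<in>UNIV. r w * h w)"
      using that in_span_range_iff[of UNIV u h] by (simp add: I_def)
    then show ?thesis unfolding coords_def by (rule someI_ex)
  qed
  have unique: "coord_form (\<Sum>w\<in>UNIV. r w * h w) = (\<Sum>w\<in>UNIV. mconst (eval_at a (r w)) * mvar w)" for r
  proof -
    let ?u = "\<Sum>w\<in>UNIV. r w * h w"
    have "?u \<in> I" using hI by (intro idl.subspace_sum[OF I] idl.subspace_scale[OF I])
    then have "(\<Sum>w\<in>UNIV. (coords ?u w - r w) * h w) = 0"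
      using coords[of ?u] by (simp add: left_diff_distrib sum_subtractf)
    then have "eval_at a (coords ?u w) = eval_at a (r w)" for w
      using syz[of "\<lambda>w. coords ?u w - r w" w] by simp
    then show ?thesis by (simp add: coord_form_def)
  qed
  define \<Phi> where "\<Phi> = mpoly_subst (\<lambda>r. mconst (eval_at a r)) coord_form"
  have c\<Phi>: "coeff_hom (\<lambda>r. mconst (eval_at a r) :: ('w, 'k) mpoly)"
    by (rule coeff_hom_comp[OF coeff_hom_mconst coeff_hom_eval_at])
  note h\<Phi> = coeff_hom.coeff_hom_subst[OF c\<Phi>, of coord_form, folded \<Phi>_def]
  have \<Phi>_mvar: "\<Phi> (mvar u) = coord_form u" for u
    unfolding \<Phi>_def by (rule coeff_hom.subst_mvar[OF c\<Phi>])
  have \<Phi>_mconst: "\<Phi> (mconst r) = mconst (eval_at a r)" for r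
    unfolding \<Phi>_def by (rule coeff_hom.subst_mconst[OF c\<Phi>])
  have coord_form_h: "coord_form (h w) = mvar w" for w
  proof -
    have "h w = (\<Sum>v\<in>UNIV. (if v = w then 1 else 0) * h v)"
      by (simp add: if_distrib[of "\<lambda>x. x * _"] cong: if_cong)
    then have "coord_form (h w) = (\<Sum>v\<in>UNIV. mconst (eval_at a (if v = w then 1 else 0)) * mvar v)"
      using unique[of "\<lambda>v. if v = w then 1 else 0"] by simp
    also have "\<dots> = (\<Sum>v\<in>UNIV. if v = w then mvar v else 0)"
      by (intro sum.cong) auto
    also have "\<dots> = mvar w" by simp
    finally show ?thesis .
  qed
  have rel: "\<Phi> p = 0" if "p \<in> sym_relations I" for p
  proof -
    have add: "coord_form (u + v) = coord_form u + coord_form v" if "u \<in> I" "v \<in> I" for u v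
    proof -
      have "u + v = (\<Sum>w\<in>UNIV. (coords u w + coords v w) * h w)"
        using coords[OF that(1)] coords[OF that(2)] by (simp add: distrib_right sum.distrib)
      then have "coord_form (u + v) = (\<Sum>w\<in>UNIV. mconst (eval_at a (coords u w + coords v w)) * mvar w)"
        using unique[of "\<lambda>w. coords u w + coords v w"] by metis
      then show ?thesis by (simp add: coord_form_def single_add distrib_right sum.distrib)
    qed
    have scale: "coord_form (c * u) = mconst (eval_at a c) * coord_form u" if "u \<in> I" for c u
    proof -
      have "c * u = (\<Sum>w\<in>UNIV. (c * coords u w) * h w)"
        by (subst coords[OF that]) (simp add: sum_distrib_left mult.assoc)
      then have "coord_form (c * u) = (\<Sum>w\<in>UNIV. mconst (eval_at a (c * coords u w)) * mvar w)"
        using unique[of "\<lambda>w. c * coords u w"] by metis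
      also have "\<dots> = (\<Sum>w\<in>UNIV. mconst (eval_at a c) * (mconst (eval_at a (coords u w)) * mvar w))"
        by (intro sum.cong refl) (simp only: eval_at_simps coeff_hom.hom_mult[OF coeff_hom_mconst] mult.assoc)
      finally show ?thesis by (simp only: coord_form_def sum_distrib_left)
    qed
    show ?thesis
      using that unfolding sym_relations_def
      by (auto simp only: coeff_hom.hom_simps[OF h\<Phi>] \<Phi>_mvar \<Phi>_mconst add scale Un_iff mem_Collect_eq)
        (simp_all add: add scale coeff_hom.hom_simps[OF h\<Phi>] \<Phi>_mvar \<Phi>_mconst)
  qed
  obtain P :: "('w, 'k) mpoly" where P: "P \<noteq> 0" "mpoly_subst mconst h P = 0"
    using algebraically_dependent[OF card] by blast
  obtain m0 where m0: "m0 \<in> keys P"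
    "\<And>m. m \<in> keys P \<Longrightarrow> total_degree m0 \<le> total_degree m"
    using P(1) ex_has_least_nat[of "\<lambda>m. m \<in> keys P" _ total_degree]
    by (metis all_not_in_conv keys_eq_empty)
  \<comment> \<open>Every monomial of \<open>P\<close> is split as \<open>b + c\<close> with \<open>b\<close> of degree \<open>d\<close>. In \<open>F\<close> the part \<open>b\<close> is read in the
      symmetric algebra and \<open>c\<close> is evaluated in the ring, which makes \<open>F\<close> homogeneous with value \<open>P h = 0\<close>.\<close>
  define d where "d = total_degree m0"
  have "\<forall>m. \<exists>bc. m \<in> keys P \<longrightarrow> m = fst bc + snd bc \<and> total_degree (fst bc) = d"
    using exists_smaller_exponent m0(2) unfolding d_def by (metis fst_conv snd_conv)
  then obtain bc where bc: "\<And>m. m \<in> keys P \<Longrightarrow> m = fst (bc m) + snd (bc m) \<and> total_degree (fst (bc m)) = d"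
    by metis
  define summand where "summand m = mconst (mconst (lookup P m) * monom_eval h (snd (bc m))) *
    monom_eval (\<lambda>w. mvar (h w)) (fst (bc m))" for m
  define F where "F = (\<Sum>m\<in>keys P. summand m)"
  have me_in: "monom_eval (\<lambda>w. mvar (h w)) b \<in> (polys_in I :: (('n, 'k) mpoly, ('n, 'k) mpoly) mpoly set)" for b
    unfolding monom_eval_def
  proof -
    have "(\<Prod>w\<in>A. mvar (h w) ^ lookup b w) \<in> (polys_in I :: (('n, 'k) mpoly, ('n, 'k) mpoly) mpoly set)" for A
      by (induction A rule: infinite_finite_induct)
        (simp_all add: polys_in_closed mvar_in_polys_in hI)
    then show "(\<Prod>w\<in>keys b. mvar (h w) ^ lookup b w)
      \<in> (polys_in I :: (('n, 'k) mpoly, ('n, 'k) mpoly) mpoly set)" .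
  qed
  have "summand m \<in> polys_in I" for m
    unfolding summand_def
    by (intro polys_in_closed(5) mconst_in_polys_in me_in)
  then have F_in: "F \<in> polys_in I"
    unfolding F_def by (intro subring_set_sum[OF subring_set_polys_in])
  note me_hom = coeff_hom.hom_monom_eval
  have "rees_map (summand m) = monom (mconst (lookup P m) * monom_eval h m) d"
    if m: "m \<in> keys P" for m
  proof -
    have "rees_map (summand m) =
        [:mconst (lookup P m) * monom_eval h (snd (bc m)):] * monom (monom_eval h (fst (bc m))) d"
      using bc[OF m] by (simp add: summand_def rees_map_simps me_hom[OF coeff_hom_rees_map] monom_eval_monom)
    also have "\<dots> = monom (mconst (lookup P m) * (monom_eval h (fst (bc m)) * monom_eval h (snd (bc m)))) d"
      by (simp add: smult_monom mult_ac)
    also have "monom_eval h (fst (bc m)) * monom_eval h (snd (bc m)) = monom_eval h m"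
      using bc[OF m] by (metis monom_eval_add)
    finally show ?thesis .
  qed
  then have "rees_map F = (\<Sum>m\<in>keys P. monom (mconst (lookup P m) * monom_eval h m) d)"
    by (simp add: F_def rees_map_simps)
  also have "\<dots> = monom (mpoly_subst mconst h P) d"
    by (simp add: mpoly_subst_monom_eval monom_sum)
  finally have "rees_map F = 0" by (simp add: P(2))
  then have "F \<in> sym_ideal I" using lt F_in linear_type_iff[OF I] by blast
  have "\<Phi> F = 0"
    by (rule hom_vanishes_on_sym_ideal[OF I h\<Phi> _ \<open>F \<in> sym_ideal I\<close>]) (rule rel)
  \<comment> \<open>The terms of degree above \<open>d\<close> carry a factor \<open>h w\<close>, which vanishes at \<open>a\<close>.\<close>
  have \<Phi>_summand: "\<Phi> (summand m) = single (fst (bc m)) (lookup P m * monom_eval (\<lambda>_. 0) (snd (bc m)))" for m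
  proof -
    have "\<Phi> (summand m) = mconst (lookup P m * monom_eval (\<lambda>_. 0) (snd (bc m))) * monom_eval mvar (fst (bc m))"
      by (simp add: summand_def coeff_hom.hom_mult[OF h\<Phi>] \<Phi>_mconst me_hom[OF h\<Phi>] me_hom[OF coeff_hom_eval_at] h0 \<Phi>_mvar coord_form_h)
    then show ?thesis by (simp only: monomial_eq_prod[symmetric] mult_single add_0 mult_1_right)
  qed
  have me_zero: "monom_eval (\<lambda>_. 0 :: 'k) b = (if b = 0 then 1 else 0)" for b :: "'w \<Rightarrow>\<^sub>0 nat"
    by (auto simp: monom_eval_def in_keys_iff zero_power_eq)
  have "0 = lookup (\<Phi> F) m0" by (simp add: \<open>\<Phi> F = 0\<close>)
  also have "\<dots> = (\<Sum>m\<in>keys P. lookup (\<Phi> (summand m)) m0)"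
    by (simp add: F_def coeff_hom.hom_sum[OF h\<Phi>] lookup_sum)
  also have "\<dots> = (\<Sum>m\<in>keys P. if m = m0 then lookup P m else 0)"
  proof (rule sum.cong)
    fix m assume m: "m \<in> keys P"
    have dec: "m = fst (bc m) + snd (bc m)" "total_degree (fst (bc m)) = d" using bc[OF m] by auto
    show "lookup (\<Phi> (summand m)) m0 = (if m = m0 then lookup P m else 0)"
    proof (cases "snd (bc m) = 0")
      case True
      then have "fst (bc m) = m" using dec by simp
      then show ?thesis using True by (auto simp: \<Phi>_summand me_zero lookup_single when_def)
    next
      case False
      then have "total_degree m \<noteq> d" using dec total_degree_add[of "fst (bc m)" "snd (bc m)"] by simp
      then have "m \<noteq> m0" by (auto simp: d_def)
      then show ?thesis using False by (simp add: \<Phi>_summand me_zero)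
    qed
  qed simp
  also have "\<dots> = lookup P m0" using m0(1) by simp
  finally show False using m0(1) by (simp add: in_keys_iff)
qed

section \<open>Hypersurfaces with isolated singularities\<close>

interpretation point: prime_localization "point_ideal (a :: 'n \<Rightarrow> 'k::field)" for a
  by unfold_locales (rule prime_ideal_point_ideal)

lemma noetherian_mpoly: "noetherian_on (UNIV :: ('n::finite, 'k::field) mpoly set)"
  using noetherian_on_polys_in[of "UNIV :: 'n set"] by simp

lemma of_nat_unit_mpoly:
  assumes "n > 0"
  shows "(of_nat n :: ('n, 'k::field_char_0) mpoly) dvd 1"
proof
  have "of_nat n = (mconst (of_nat n) :: ('n, 'k) mpoly)" by simp
  then show "(1 :: ('n, 'k) mpoly) = of_nat n * mconst (inverse (of_nat n))"
    using assms by (simp only: mult_single) simp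
qed

text \<open>Nullstellensatz at an isolated zero: a polynomial that does not vanish at \<open>a\<close> but at the other
  zeros of \<open>I\<close> serves as the denominator.\<close>

lemma powers_of_coordinates_in_saturation:
  fixes I :: "('n::finite, 'k::{alg_closed_field, field_char_0}) mpoly set"
  assumes I: "idl.subspace I" and fin: "finite (zero_locus I)"
  obtains N where "\<And>v. (mvar v - mconst (a v)) ^ Suc N \<in> saturation (point_ideal a) I"
proof -
  let ?V = "zero_locus I - {a}"
  have "\<forall>b. \<exists>w. b \<in> ?V \<longrightarrow> b w \<noteq> a w" by auto
  then obtain w where w: "\<And>b. b \<in> ?V \<Longrightarrow> b (w b) \<noteq> a (w b)" by metis
  define h where "h = (\<Prod>b\<in>?V. mvar (w b) - mconst (b (w b)) :: ('n, 'k) mpoly)"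
  have "eval_at a (mvar (w b) - mconst (b (w b))) \<noteq> 0" if "b \<in> ?V" for b
    using w[OF that] by simp
  then have ha: "eval_at a h \<noteq> 0"
    unfolding h_def coeff_hom.hom_prod[OF coeff_hom_eval_at] using fin by (simp add: prod_zero_iff)
  have hb: "eval_at b h = 0" if "b \<in> ?V" for b
  proof -
    have "\<exists>c\<in>?V. eval_at b (mvar (w c) - mconst (c (w c))) = 0" using that by (intro bexI[of _ b]) auto
    then show ?thesis using fin by (simp add: h_def prod_zero_iff)
  qed
  have "\<exists>n. (mvar v - mconst (a v)) ^ n \<in> saturation (point_ideal a) I" for v
  proof -
    let ?y = "mvar v - mconst (a v) :: ('n, 'k) mpoly"
    have "eval_at b (h * ?y) = 0" if "b \<in> zero_locus I" for b
      using hb[of b] that by (cases "b = a") auto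
    then obtain n where "(h * ?y) ^ n \<in> I" using nullstellensatz[OF I] by blast
    then have "h ^ n * ?y ^ n \<in> I" by (simp add: power_mult_distrib)
    moreover have "h ^ n \<notin> point_ideal a" using ha by (simp add: point_ideal_def)
    ultimately show ?thesis using point.saturationI by blast
  qed
  then obtain n where n: "\<And>v. (mvar v - mconst (a v)) ^ n v \<in> saturation (point_ideal a) I" by metis
  \<comment> \<open>One exponent serves all coordinates, and its form \<open>Suc ?N\<close> makes the powers vanish at \<open>a\<close>.\<close>
  let ?N = "\<Sum>v\<in>UNIV. n v"
  have "(mvar v - mconst (a v)) ^ Suc ?N \<in> saturation (point_ideal a) I" for v
  proof -
    have "n v \<le> Suc ?N" using member_le_sum[of v UNIV n] by simp
    then have "(mvar v - mconst (a v)) ^ Suc ?N =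
        (mvar v - mconst (a v)) ^ (Suc ?N - n v) * (mvar v - mconst (a v) :: ('n, 'k) mpoly) ^ n v"
      by (simp only: power_add[symmetric] le_add_diff_inverse2)
    then show ?thesis
      using idl.subspace_scale[OF point.subspace_saturation[OF I] n[of v]] by metis
  qed
  then show thesis using that by blast
qed

context
  fixes f :: "('n::finite, 'k::{alg_closed_field, field_char_0}) mpoly" and a :: "'n \<Rightarrow> 'k"
begin

abbreviation partials :: "('n, 'k) mpoly set" where
  "partials \<equiv> range (\<lambda>i. mpoly_pderiv i f)"

lemma gradient_ideal_eq: "gradient_ideal f = idl.span partials"
  unfolding gradient_ideal_def genideal_eq_span by (simp add: full_SetCompr_eq)

lemma jacobian_ideal_eq: "jacobian_ideal f = idl.span (insert f partials)"
  unfolding jacobian_ideal_def genideal_eq_span by (simp add: full_SetCompr_eq)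

lemma locally_eulerian_iff:
  "fraction ring_of_type_algebra (carrier ring_of_type_algebra - point_ideal a) f 1
      \<in> ideal_at ring_of_type_algebra (gradient_ideal f) (point_ideal a) \<longleftrightarrow>
    f \<in> saturation (point_ideal a) (idl.span partials)"
  unfolding gradient_ideal_eq by (rule point.in_ideal_at_iff[OF idl.subspace_span point.one_notin_M])

lemma one_notin_saturation:
  assumes "a \<in> zero_locus I"
  shows "1 \<notin> saturation (point_ideal a) I"
  using assms by (auto simp: saturation_def zero_locus_def point_ideal_def)

text \<open>In the Eulerian case the \<open>n\<close> partial derivatives generate the Jacobian ideal at \<open>a\<close>, which
  contains the regular sequence of the powers of the \<open>n\<close> coordinates.\<close>

lemma eulerian_imp_complete_intersection:
  assumes fin: "finite (singular_locus f)" and a: "a \<in> singular_locus f"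
    and f: "f \<in> saturation (point_ideal a) (idl.span partials)"
  shows "\<exists>gs. regular_mod (point_ideal a) (saturation (point_ideal a) {0}) gs \<and>
    1 \<notin> saturation (point_ideal a) (idl.span (set gs)) \<and>
    saturation (point_ideal a) (jacobian_ideal f) = saturation (point_ideal a) (idl.span (set gs))"
proof -
  let ?M = "point_ideal a"
  let ?I = "jacobian_ideal f"
  have I: "idl.subspace ?I" unfolding jacobian_ideal_eq by (rule idl.subspace_span)
  interpret noetherian_localization ?M
    by unfold_locales (rule noetherian_mpoly)
  have I_eq: "saturation ?M ?I = saturation ?M (idl.span partials)"
  proof
    have "insert f partials \<subseteq> saturation ?M (idl.span partials)"
      using f point.saturation_superset idl.span_superset[of partials] by blast
    then show "saturation ?M ?I \<subseteq> saturation ?M (idl.span partials)"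
      unfolding jacobian_ideal_eq by (rule point.saturation_span_minimal) (rule idl.subspace_span)
    show "saturation ?M (idl.span partials) \<subseteq> saturation ?M ?I"
      unfolding jacobian_ideal_eq by (intro point.saturation_mono idl.span_mono) auto
  qed
  obtain vs :: "'n list" where vs: "distinct vs" "set vs = UNIV"
    using finite_distinct_list[of "UNIV :: 'n set"] by auto
  obtain N where N: "\<And>v. (mvar v - mconst (a v)) ^ Suc N \<in> saturation ?M ?I"
    using powers_of_coordinates_in_saturation[OF I] fin unfolding singular_locus_def by blast
  define y where "y v = (mvar v - mconst (a v) :: ('n, 'k) mpoly) ^ Suc N" for v
  let ?gs = "map (\<lambda>i. mpoly_pderiv i f) vs"
  have gens: "foldl (adjoin ?M) (saturation ?M {0}) ?gs = saturation ?M ?I"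
    unfolding point.foldl_adjoin_zero I_eq by (simp add: vs)
  have "\<exists>zs. regular_mod ?M (saturation ?M {0}) zs \<and>
    foldl (adjoin ?M) (saturation ?M {0}) zs = foldl (adjoin ?M) (saturation ?M {0}) ?gs"
  proof (rule generated_by_regular_sequence[OF of_nat_unit_mpoly point.saturated_zero])
    show "length (map y vs) = length ?gs" by simp
    show "set (map y vs) \<subseteq> ?M" by (auto simp: y_def point_ideal_def)
    show "set (map y vs) \<subseteq> foldl (adjoin ?M) (saturation ?M {0}) ?gs"
      unfolding gens using N by (auto simp: y_def)
    show "regular_mod ?M (saturation ?M {0}) (map y vs)"
    proof (rule point.regular_mod_powers_of_coordinates[OF vs(1)])
      fix v :: 'n and W assume "v \<notin> W"
      then show "nonzerodivisor_mod (idl.span (y ` W)) (y v)"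
        using powers_of_coordinates_regular[of v W a "Suc N"] unfolding nonzerodivisor_mod_def y_def by blast
    qed
  qed
  then obtain zs where zs: "regular_mod ?M (saturation ?M {0}) zs"
    "saturation ?M (idl.span (set zs)) = saturation ?M ?I"
    unfolding gens unfolding point.foldl_adjoin_zero by blast
  have "1 \<notin> saturation ?M ?I" using a unfolding singular_locus_def by (rule one_notin_saturation)
  then show ?thesis using zs by (intro exI[of _ zs]) simp
qed

text \<open>At a singular point the regular sequence is multiplied into the Jacobian ideal. At any other
  point the Jacobian ideal contains a unit of the local ring, which is regular and generates its extension.\<close>

lemma complete_intersection_imp_linear_type:
  assumes ci: "\<And>a. a \<in> singular_locus f \<Longrightarrow>
    \<exists>gs. regular_mod (point_ideal a) (saturation (point_ideal a) {0}) gs \<and>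
      1 \<notin> saturation (point_ideal a) (idl.span (set gs)) \<and>
      saturation (point_ideal a) (jacobian_ideal f) = saturation (point_ideal a) (idl.span (set gs))"
  shows "linear_type (jacobian_ideal f)"
proof (rule linear_type_if_locally_regular)
  let ?I = "jacobian_ideal f"
  show I: "idl.subspace ?I" unfolding jacobian_ideal_eq by (rule idl.subspace_span)
  fix b :: "'n \<Rightarrow> 'k"
  let ?M = "point_ideal b"
  show "\<exists>gs. set gs \<subseteq> ?I \<and> regular_mod ?M (saturation ?M {0}) gs \<and> ?I \<subseteq> saturation ?M (idl.span (set gs))"
  proof (cases "b \<in> singular_locus f")
    case False
    \<comment> \<open>Away from the singular locus an element of the ideal becomes a unit.\<close>
    then obtain u where u: "u \<in> ?I" "u \<notin> ?M"
      by (auto simp: singular_locus_def zero_locus_def point_ideal_def)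
    have "nonzerodivisor_mod (saturation ?M {0}) u"
      unfolding nonzerodivisor_mod_def
      using point.saturatedD[OF point.saturated_zero u(2)] by blast
    moreover have "1 \<in> saturation ?M (idl.span {u})"
      using u(2) by (intro point.saturationI[of u]) (auto intro: idl.span_base)
    then have "saturation ?M (idl.span {u}) = UNIV"
      by (rule subspace_eq_UNIV[OF point.subspace_saturation[OF idl.subspace_span]])
    ultimately show ?thesis using u(1) by (intro exI[of _ "[u]"]) simp
  next
    case True
    then obtain gs where gs: "regular_mod ?M (saturation ?M {0}) gs"
      "saturation ?M ?I = saturation ?M (idl.span (set gs))" using ci by blast
    have "\<exists>s. s \<notin> ?M \<and> s * g \<in> ?I" if "g \<in> set gs" for g
    proof -
      have "g \<in> saturation ?M ?I"
        unfolding gs(2) using that point.saturation_superset idl.span_base by blast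
      then show ?thesis by (auto elim: point.saturationE)
    qed
    then obtain s where s: "\<And>g. g \<in> set gs \<Longrightarrow> s g \<notin> ?M \<and> s g * g \<in> ?I" by metis
    define t where "t = prod s (set gs)"
    have t: "t \<notin> ?M" unfolding t_def using s by (intro point.prod_notin_M) auto
    have tI: "t * g \<in> ?I" if "g \<in> set gs" for g
    proof -
      have "t * g = prod s (set gs - {g}) * (s g * g)"
        using that by (simp add: t_def prod.remove[of _ g] mult_ac)
      then show ?thesis using s[OF that] idl.subspace_scale[OF I] by metis
    qed
    let ?gs = "map ((*) t) gs"
    have "set gs \<subseteq> saturation ?M (idl.span (set ?gs))"
    proof
      fix g assume "g \<in> set gs"
      then have "t * g \<in> idl.span (set ?gs)" by (intro idl.span_base) auto
      then show "g \<in> saturation ?M (idl.span (set ?gs))" by (rule point.saturationI[OF t])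
    qed
    then have "saturation ?M (idl.span (set gs)) \<subseteq> saturation ?M (idl.span (set ?gs))"
      by (rule point.saturation_span_minimal) (rule idl.subspace_span)
    then have "?I \<subseteq> saturation ?M (idl.span (set ?gs))"
      using point.saturation_superset[of ?I b] gs(2) by blast
    moreover have "regular_mod ?M (saturation ?M {0}) ?gs"
      using gs(1) point.regular_mod_scale_units[OF t point.saturated_zero] by blast
    ultimately show ?thesis using tI by (intro exI[of _ ?gs]) auto
  qed
qed

text \<open>A syzygy of \<open>f\<close> and its partial derivatives with a unit entry at \<open>a\<close> comes from \<open>f\<close>: otherwise it is a
  vector field \<open>\<delta>\<close> with \<open>\<delta> f \<in> (f)\<close> that does not vanish at \<open>a\<close>. Such a field preserves the
  Jacobian ideal, and applied to the least power of a coordinate in that ideal it produces a smaller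
  one, since the characteristic is zero.\<close>

lemma unit_syzygy_imp_eulerian:
  assumes fin: "finite (singular_locus f)" and a: "a \<in> singular_locus f"
    and syz: "r0 * f + (\<Sum>i\<in>UNIV. r i * mpoly_pderiv i f) = 0"
    and unit: "r0 \<notin> point_ideal a \<or> (\<exists>i. r i \<notin> point_ideal a)"
  shows "f \<in> saturation (point_ideal a) (idl.span partials)"
proof (cases "r0 \<in> point_ideal a")
  case False
  have "r0 * f = - (\<Sum>i\<in>UNIV. r i * mpoly_pderiv i f)"
    using syz by (simp add: eq_neg_iff_add_eq_0)
  also have "\<dots> \<in> idl.span partials"
    by (intro idl.span_neg idl.span_sum idl.span_scale idl.span_base) simp
  finally show ?thesis by (rule point.saturationI[OF False])
next
  case True
  then obtain j where j: "r j \<notin> point_ideal a" using unit by blast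
  let ?M = "point_ideal a"
  let ?I = "jacobian_ideal f"
  have I: "idl.subspace ?I" unfolding jacobian_ideal_eq by (rule idl.subspace_span)
  have fI: "f \<in> ?I" and dI: "mpoly_pderiv i f \<in> ?I" for i
    unfolding jacobian_ideal_eq by (auto intro: idl.span_base)
  define \<delta> where "\<delta> p = (\<Sum>i\<in>UNIV. r i * mpoly_pderiv i p)" for p
  have \<delta>_add: "\<delta> (p + q) = \<delta> p + \<delta> q" for p q
    by (simp add: \<delta>_def pderiv_add distrib_left sum.distrib)
  have \<delta>_mult: "\<delta> (p * q) = p * \<delta> q + \<delta> p * q" for p q
    by (simp add: \<delta>_def pderiv_mult distrib_left sum.distrib sum_distrib_left sum_distrib_right mult_ac)
  have \<delta>_f: "\<delta> f = - (r0 * f)"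
    using syz by (simp add: \<delta>_def eq_neg_iff_add_eq_0 add.commute)
  have \<delta>_partial: "\<delta> (mpoly_pderiv i f) \<in> ?I" for i
  proof -
    have "mpoly_pderiv i (\<delta> f) = \<delta> (mpoly_pderiv i f) + (\<Sum>k\<in>UNIV. mpoly_pderiv i (r k) * mpoly_pderiv k f)"
      by (simp add: \<delta>_def pderiv_sum pderiv_mult sum.distrib pderiv_commute[of i])
    moreover have "mpoly_pderiv i (\<delta> f) = mpoly_pderiv i ((- r0) * f)"
      by (simp add: \<delta>_f)
    ultimately have "\<delta> (mpoly_pderiv i f) =
        (- r0) * mpoly_pderiv i f + mpoly_pderiv i (- r0) * f - (\<Sum>k\<in>UNIV. mpoly_pderiv i (r k) * mpoly_pderiv k f)"
      unfolding pderiv_mult by (simp only: eq_diff_eq)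
    also have "\<dots> \<in> ?I"
      by (intro idl.subspace_diff[OF I] idl.subspace_add[OF I] idl.subspace_scale[OF I] idl.subspace_sum[OF I] fI dI)
    finally show ?thesis .
  qed
  have \<delta>_I: "\<delta> p \<in> ?I" if "p \<in> ?I" for p
  proof -
    have "p \<in> idl.span (insert f partials)" using that by (simp only: jacobian_ideal_eq)
    then show ?thesis
    proof (induction rule: idl.span_induct_alt)
      case base
      show ?case by (simp add: \<delta>_def idl.subspace_0[OF I])
    next
      case (step c x y)
      have "x \<in> ?I" "\<delta> x \<in> ?I"
        using step.hyps fI dI \<delta>_partial idl.subspace_scale[OF I fI, of "- r0"] by (auto simp: \<delta>_f)
      then show ?case
        unfolding \<delta>_add \<delta>_mult
        by (intro idl.subspace_add[OF I] idl.subspace_scale[OF I] step.IH)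
    qed
  qed
  let ?x = "mvar j - mconst (a j) :: ('n, 'k) mpoly"
  have \<delta>_x: "\<delta> ?x = r j"
  proof -
    have d: "mpoly_pderiv i ?x = (if i = j then 1 else 0)" for i
    proof -
      have "mpoly_pderiv i (?x + mconst (a j)) = mpoly_pderiv i ?x + mpoly_pderiv i (mconst (a j))"
        by (rule pderiv_add)
      then show ?thesis by (simp add: pderiv_mvar)
    qed
    have "\<delta> ?x = (\<Sum>i\<in>UNIV. if i = j then r i else 0)"
      unfolding \<delta>_def d by (intro sum.cong) auto
    then show ?thesis by simp
  qed
  have \<delta>_one: "\<delta> 1 = 0" using \<delta>_mult[of 1 1] by simp
  have \<delta>_power: "\<delta> (?x ^ Suc n) = of_nat (Suc n) * ?x ^ n * r j" for n
  proof (induction n)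
    case 0
    show ?case by (simp add: \<delta>_x)
  next
    case (Suc n)
    have alg: "x * (of_nat (Suc n) * x ^ n * y) + y * x ^ Suc n = of_nat (Suc (Suc n)) * x ^ Suc n * y"
      for x y :: "('n, 'k) mpoly"
      by (simp add: algebra_simps)
    show ?case
      unfolding power_Suc[of ?x "Suc n"] \<delta>_mult[of ?x] Suc.IH \<delta>_x by (rule alg[unfolded power_Suc[of _ "Suc n"]])
  qed
  have descend: "?x ^ n \<in> saturation ?M ?I" if "?x ^ Suc n \<in> saturation ?M ?I" for n
  proof -
    obtain s where s: "s \<notin> ?M" "s * ?x ^ Suc n \<in> ?I" using \<open>?x ^ Suc n \<in> saturation ?M ?I\<close> by (rule point.saturationE)
    have "s * \<delta> (s * ?x ^ Suc n) - \<delta> s * (s * ?x ^ Suc n) \<in> ?I"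
      by (intro idl.subspace_diff[OF I] idl.subspace_scale[OF I] \<delta>_I s)
    also have "s * \<delta> (s * ?x ^ Suc n) - \<delta> s * (s * ?x ^ Suc n) = (s * s * of_nat (Suc n) * r j) * ?x ^ n"
      unfolding \<delta>_mult[of s] \<delta>_power by (simp only: distrib_left mult_ac add_diff_cancel_right')
    finally have in_I: "(s * s * of_nat (Suc n) * r j) * ?x ^ n \<in> ?I" .
    have "of_nat (Suc n) \<notin> ?M"
    proof
      assume "of_nat (Suc n) \<in> ?M"
      moreover obtain u where "(1 :: ('n, 'k) mpoly) = of_nat (Suc n) * u"
        using of_nat_unit_mpoly[OF zero_less_Suc] unfolding dvd_def by blast
      ultimately show False
        using subspace_mult_right[OF prime_idealD(1)[OF prime_ideal_point_ideal]] point.one_notin_M by metis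
    qed
    then have "s * s * of_nat (Suc n) * r j \<notin> ?M" by (intro point.mult_notin_M s j)
    then show ?thesis using in_I by (rule point.saturationI)
  qed
  obtain N where "?x ^ Suc N \<in> saturation ?M ?I"
    using powers_of_coordinates_in_saturation[OF I] fin unfolding singular_locus_def by blast
  then have "?x ^ N \<in> saturation ?M ?I" by (rule descend)
  then have "?x ^ 0 \<in> saturation ?M ?I" by (induction N) (use descend in blast)+
  moreover have "1 \<notin> saturation ?M ?I" using a unfolding singular_locus_def by (rule one_notin_saturation)
  ultimately show ?thesis by simp
qed

lemma linear_type_imp_eulerian:
  assumes fin: "finite (singular_locus f)" and a: "a \<in> singular_locus f"
    and lt: "linear_type (jacobian_ideal f)"
  shows "f \<in> saturation (point_ideal a) (idl.span partials)"
proof -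
  define h where "h w = (case w of None \<Rightarrow> f | Some i \<Rightarrow> mpoly_pderiv i f)" for w
  have sum_option: "(\<Sum>w\<in>UNIV. g w) = g None + (\<Sum>i\<in>UNIV. g (Some i))" for g :: "'n option \<Rightarrow> ('n, 'k) mpoly"
    by (simp add: UNIV_option_conv sum.reindex)
  have "range h = insert f partials"
    by (auto simp: h_def UNIV_option_conv image_image)
  then have I_eq: "jacobian_ideal f = idl.span (range h)" by (simp only: jacobian_ideal_eq)
  have "CARD('n) < CARD('n option)" by simp
  then obtain r w where r: "(\<Sum>w\<in>UNIV. r w * h w) = 0" "eval_at a (r w) \<noteq> 0"
    using linear_type_syzygy[of h a] lt a unfolding I_eq singular_locus_def by blast
  show ?thesis
  proof (rule unit_syzygy_imp_eulerian[OF fin a])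
    show "r None * f + (\<Sum>i\<in>UNIV. r (Some i) * mpoly_pderiv i f) = 0"
      using r(1) unfolding sum_option by (simp add: h_def)
    show "r None \<notin> point_ideal a \<or> (\<exists>i. r (Some i) \<notin> point_ideal a)"
      using r(2) by (cases w) (auto simp: point_ideal_def)
  qed
qed

end

theorem theorem1p4:
  fixes f :: "('n::finite, 'k::{alg_closed_field, field_char_0}) mpoly"
  assumes "CARD('n) \<ge> 2"
    and "squarefree f"
    and "isolated_singularities f"
  shows "(locally_eulerian f \<longleftrightarrow> jacobian_locally_ci f) \<and>
         (jacobian_locally_ci f \<longleftrightarrow> jacobian_linear_type f)"
proof -
  have fin: "finite (singular_locus f)" using assms(3) by (simp add: isolated_singularities_def)
  have I: "idl.subspace (jacobian_ideal f)" unfolding jacobian_ideal_eq by (rule idl.subspace_span)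
  have eulerian: "locally_eulerian f \<longleftrightarrow>
      (\<forall>a\<in>singular_locus f. f \<in> saturation (point_ideal a) (idl.span (range (\<lambda>i. mpoly_pderiv i f))))"
    unfolding locally_eulerian_def locally_eulerian_iff ..
  have ci: "jacobian_locally_ci f \<longleftrightarrow> (\<forall>a\<in>singular_locus f.
      \<exists>gs. regular_mod (point_ideal a) (saturation (point_ideal a) {0}) gs \<and>
        1 \<notin> saturation (point_ideal a) (idl.span (set gs)) \<and>
        saturation (point_ideal a) (jacobian_ideal f) = saturation (point_ideal a) (idl.span (set gs)))"
    unfolding jacobian_locally_ci_def point.locally_complete_intersection_iff[OF I] ..
  have "jacobian_locally_ci f" if "locally_eulerian f"
    unfolding ci using that[unfolded eulerian] eulerian_imp_complete_intersection[OF fin] by blast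
  moreover have "jacobian_linear_type f" if "jacobian_locally_ci f"
    unfolding jacobian_linear_type_def
    using that[unfolded ci] by (intro complete_intersection_imp_linear_type) blast
  moreover have "locally_eulerian f" if "jacobian_linear_type f"
    unfolding eulerian using that linear_type_imp_eulerian[OF fin] by (simp add: jacobian_linear_type_def)
  ultimately show ?thesis by blast
qed

end
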